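(* Let $k$ and $n$ be positive integers and let $\nu=(\nu_1,\nu_2,\dots)$ be a partition of $n$ such that $n>k+\nu_2$ and such that $\nu$ indexes an irreducible representation of $QP_k(n)$, i.e. $S^{\nu}$ occurs in $W^{\otimes k}$. Put $\lambda=(\nu_2,\nu_3,\dots)$, a partition of $|\lambda|=n-\nu_1$. Then the dimension of the irreducible representation of $QP_k(n)$ indexed by $\nu$ is $$f^{\lambda}\sum_{m_1=0}^{|\lambda|}\left(\binom{k}{m_1}\sum_{m_2=|\lambda|-m_1}^{\lfloor\frac{k-m_1}{2}\rfloor}\binom{m_2}{|\lambda|-m_1}\,sp_2(k-m_1,m_2)\right),$$ where $f^{\lambda}$ is the number of standard tableaux of shape $\lambda$ and $sp_2(a,b)$ is the number of set partitions of a set with $a$ elements into $b$ parts, each of size at least $2$.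
   Context: The quasi-partition algebra is $QP_k(n)=\mathrm{End}_{S_n}(W^{\otimes k})$, where $W=S^{(n-1,1)}$ is the irreducible complex representation of $S_n$ indexed by $(n-1,1)$ and $S_n$ acts diagonally. The irreducible representation of $QP_k(n)$ indexed by $\nu$ is the multiplicity space of the irreducible $S_n$-module $S^{\nu}$ in $W^{\otimes k}$. Conventions: $f^{\emptyset}=1$, $sp_2(0,0)=1$, and empty sums are $0$. *)

theory Defs
  imports
    Complex_Main
    "HOL-Library.Function_Algebras"
    "HOL-Library.FuncSet"
    "HOL-Library.Disjoint_Sets"
    "HOL-Library.More_List"
    "HOL-Combinatorics.Permutations"
begin

section \<open>Partitions, tableaux and set partitions\<close>

text \<open>A partition is the list of its nonzero parts; rows, columns and parts are
  indexed from 0, so the second part of \<open>\<nu>\<close> is \<open>nth_default 0 \<nu> 1\<close>.\<close>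

definition partition_of :: "nat list \<Rightarrow> nat \<Rightarrow> bool" where
  "partition_of \<nu> n \<longleftrightarrow> sorted_wrt (\<ge>) \<nu> \<and> 0 \<notin> set \<nu> \<and> sum_list \<nu> = n"

definition diagram :: "nat list \<Rightarrow> (nat \<times> nat) set" where
  "diagram \<nu> = {(i, j). i < length \<nu> \<and> j < \<nu> ! i}"

text \<open>The symmetric group on \<open>n\<close> letters is realised as the permutations of \<open>{..<n}\<close>,
  so tableaux have entries \<open>0, \<dots>, n - 1\<close>.\<close>

definition tableau :: "nat list \<Rightarrow> (nat \<times> nat \<Rightarrow> nat) \<Rightarrow> bool" where
  "tableau \<nu> t \<longleftrightarrow> bij_betw t (diagram \<nu>) {..<sum_list \<nu>}"

definition standard_tableaux :: "nat list \<Rightarrow> (nat \<times> nat \<Rightarrow> nat) set" where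
  "standard_tableaux \<nu> = {t \<in> extensional (diagram \<nu>). tableau \<nu> t \<and>
     (\<forall>i j. (i, Suc j) \<in> diagram \<nu> \<longrightarrow> t (i, j) < t (i, Suc j)) \<and>
     (\<forall>i j. (Suc i, j) \<in> diagram \<nu> \<longrightarrow> t (i, j) < t (Suc i, j))}"

definition f_std :: "nat list \<Rightarrow> nat" where
  "f_std \<nu> = card (standard_tableaux \<nu>)"

definition sp2 :: "nat \<Rightarrow> nat \<Rightarrow> nat" where
  "sp2 a b = card {P. partition_on {..<a} P \<and> card P = b \<and> (\<forall>B\<in>P. 2 \<le> card B)}"

section \<open>Complex function spaces and homomorphisms of representations\<close>

definition cscale :: "complex \<Rightarrow> ('x \<Rightarrow> complex) \<Rightarrow> 'x \<Rightarrow> complex" where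
  "cscale c f = (\<lambda>x. c * f x)"

global_interpretation fn: vector_space cscale
  by unfold_locales (simp_all add: cscale_def fun_eq_iff algebra_simps)

definition map_scale :: "complex \<Rightarrow> ('v \<Rightarrow> 'x \<Rightarrow> complex) \<Rightarrow> 'v \<Rightarrow> 'x \<Rightarrow> complex" where
  "map_scale c F = (\<lambda>v. cscale c (F v))"

global_interpretation maps: vector_space map_scale
  by unfold_locales (simp_all add: map_scale_def cscale_def fun_eq_iff algebra_simps)

text \<open>An action \<open>a\<close> of permutations on points induces \<open>(p f)(x) = f (p\<^sup>-\<^sup>1 x)\<close> on functions.\<close>

definition fun_act ::
  "((nat \<Rightarrow> nat) \<Rightarrow> 'x \<Rightarrow> 'x) \<Rightarrow> (nat \<Rightarrow> nat) \<Rightarrow> ('x \<Rightarrow> complex) \<Rightarrow> 'x \<Rightarrow> complex" where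
  "fun_act a p f = (\<lambda>x. f (a (inv p) x))"

text \<open>The space of linear maps \<open>U \<rightarrow> V\<close> commuting with the symmetric group on \<open>n\<close> letters,
  acting by \<open>\<rho>\<close> on \<open>U\<close> and by \<open>\<sigma>\<close> on \<open>V\<close>. A map on the subspace \<open>U\<close> is represented by the
  total function that is \<open>0\<close> off \<open>U\<close>, so that distinct functions are distinct maps.\<close>

definition Sn_hom :: "nat \<Rightarrow> ('x \<Rightarrow> complex) set \<Rightarrow> ((nat \<Rightarrow> nat) \<Rightarrow> ('x \<Rightarrow> complex) \<Rightarrow> 'x \<Rightarrow> complex)
    \<Rightarrow> ('y \<Rightarrow> complex) set \<Rightarrow> ((nat \<Rightarrow> nat) \<Rightarrow> ('y \<Rightarrow> complex) \<Rightarrow> 'y \<Rightarrow> complex)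
    \<Rightarrow> (('x \<Rightarrow> complex) \<Rightarrow> 'y \<Rightarrow> complex) set" where
  "Sn_hom n U \<rho> V \<sigma> = {F.
     (\<forall>u\<in>U. F u \<in> V) \<and>
     (\<forall>u\<in>U. \<forall>v\<in>U. F (u + v) = F u + F v) \<and>
     (\<forall>c. \<forall>u\<in>U. F (cscale c u) = cscale c (F u)) \<and>
     (\<forall>p u. p permutes {..<n} \<longrightarrow> u \<in> U \<longrightarrow> F (\<rho> p u) = \<sigma> p (F u)) \<and>
     (\<forall>u. u \<notin> U \<longrightarrow> F u = 0)}"

section \<open>Specht modules\<close>

text \<open>The tabloid of a tableau is the list of its rows, each taken as a set of entries.\<close>

type_synonym tabloid = "nat set list"

definition tabloid_of :: "nat list \<Rightarrow> (nat \<times> nat \<Rightarrow> nat) \<Rightarrow> tabloid" where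
  "tabloid_of \<nu> t = map (\<lambda>i. t ` {c \<in> diagram \<nu>. fst c = i}) [0..<length \<nu>]"

definition tabloid_act :: "(nat \<Rightarrow> nat) \<Rightarrow> tabloid \<Rightarrow> tabloid" where
  "tabloid_act p = map ((`) p)"

definition column_stabilizer :: "nat list \<Rightarrow> (nat \<times> nat \<Rightarrow> nat) \<Rightarrow> (nat \<Rightarrow> nat) set" where
  "column_stabilizer \<nu> t = {p. p permutes {..<sum_list \<nu>} \<and>
     (\<forall>j. p ` t ` {c \<in> diagram \<nu>. snd c = j} = t ` {c \<in> diagram \<nu>. snd c = j})}"

text \<open>The polytabloid \<open>e\<^sub>t = \<Sum>p. sgn p \<cdot> {p t}\<close>, \<open>p\<close> ranging over the column stabilizer of \<open>t\<close>,
  as a complex-valued function on tabloids.\<close>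

definition polytabloid :: "nat list \<Rightarrow> (nat \<times> nat \<Rightarrow> nat) \<Rightarrow> tabloid \<Rightarrow> complex" where
  "polytabloid \<nu> t = (\<lambda>T. \<Sum>p\<in>column_stabilizer \<nu> t.
     of_int (sign p) * (if T = tabloid_of \<nu> (p \<circ> t) then 1 else 0))"

definition specht :: "nat list \<Rightarrow> (tabloid \<Rightarrow> complex) set" where
  "specht \<nu> = fn.span {polytabloid \<nu> t | t. tableau \<nu> t}"

abbreviation specht_act :: "(nat \<Rightarrow> nat) \<Rightarrow> (tabloid \<Rightarrow> complex) \<Rightarrow> tabloid \<Rightarrow> complex" where
  "specht_act \<equiv> fun_act tabloid_act"

section \<open>Tensor powers\<close>

text \<open>For a space \<open>V\<close> of functions on points, the \<open>k\<close>-th tensor power is the span, in the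
  functions on \<open>k\<close>-tuples of points, of the elementary tensors
  \<open>(w\<^sub>1 \<otimes> \<dots> \<otimes> w\<^sub>k)(x\<^sub>1, \<dots>, x\<^sub>k) = w\<^sub>1(x\<^sub>1) \<cdots> w\<^sub>k(x\<^sub>k)\<close>;
  the induced diagonal action moves all components of a tuple simultaneously.\<close>

definition elem_tensor :: "('x \<Rightarrow> complex) list \<Rightarrow> 'x list \<Rightarrow> complex" where
  "elem_tensor ws = (\<lambda>xs. if length xs = length ws then \<Prod>i<length ws. (ws ! i) (xs ! i) else 0)"

definition tensor_power :: "nat \<Rightarrow> ('x \<Rightarrow> complex) set \<Rightarrow> ('x list \<Rightarrow> complex) set" where
  "tensor_power k V = fn.span {elem_tensor ws | ws. length ws = k \<and> set ws \<subseteq> V}"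

definition diagonal_act ::
  "((nat \<Rightarrow> nat) \<Rightarrow> 'x \<Rightarrow> 'x) \<Rightarrow> (nat \<Rightarrow> nat) \<Rightarrow> ('x list \<Rightarrow> complex) \<Rightarrow> 'x list \<Rightarrow> complex" where
  "diagonal_act a = fun_act (\<lambda>p. map (a p))"

section \<open>The quasi-partition algebra\<close>

definition W_power :: "nat \<Rightarrow> nat \<Rightarrow> (tabloid list \<Rightarrow> complex) set" where
  "W_power k n = tensor_power k (specht [n - 1, 1])"

abbreviation W_power_act ::
  "(nat \<Rightarrow> nat) \<Rightarrow> (tabloid list \<Rightarrow> complex) \<Rightarrow> tabloid list \<Rightarrow> complex" where
  "W_power_act \<equiv> diagonal_act tabloid_act"

text \<open>The product of the algebra is composition.\<close>

definition QP :: "nat \<Rightarrow> nat \<Rightarrow> ((tabloid list \<Rightarrow> complex) \<Rightarrow> tabloid list \<Rightarrow> complex) set" where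
  "QP k n = Sn_hom n (W_power k n) W_power_act (W_power k n) W_power_act"

text \<open>The multiplicity space of the Specht module of \<open>\<nu>\<close> in the tensor power; the algebra acts on
  it by composition (\<open>QP_irrep_closed\<close> below).\<close>

definition QP_irrep ::
  "nat \<Rightarrow> nat \<Rightarrow> nat list \<Rightarrow> ((tabloid \<Rightarrow> complex) \<Rightarrow> tabloid list \<Rightarrow> complex) set" where
  "QP_irrep k n \<nu> = Sn_hom n (specht \<nu>) specht_act (W_power k n) W_power_act"

text \<open>The Specht module of \<open>\<nu>\<close> occurs in the tensor power: it embeds equivariantly.\<close>

definition indexes_QP_irrep :: "nat \<Rightarrow> nat \<Rightarrow> nat list \<Rightarrow> bool" where
  "indexes_QP_irrep k n \<nu> \<longleftrightarrow> (\<exists>F\<in>QP_irrep k n \<nu>. inj_on F (specht \<nu>))"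

lemma Sn_hom_zero:
  assumes "F \<in> Sn_hom n U \<rho> V \<sigma>"
  shows "F 0 = 0"
proof (cases "0 \<in> U")
  case True
  then have "F (cscale 0 0) = cscale 0 (F 0)"
    using assms unfolding Sn_hom_def by blast
  then show ?thesis by simp
next
  case False
  then show ?thesis using assms unfolding Sn_hom_def by blast
qed

lemma Sn_hom_comp:
  assumes "F \<in> Sn_hom n U \<rho> V \<sigma>" "G \<in> Sn_hom n V \<sigma> X \<tau>"
  shows "G \<circ> F \<in> Sn_hom n U \<rho> X \<tau>"
  using assms Sn_hom_zero[OF assms(2)] unfolding Sn_hom_def by simp

lemma QP_closed: "A \<in> QP k n \<Longrightarrow> B \<in> QP k n \<Longrightarrow> A \<circ> B \<in> QP k n"
  unfolding QP_def by (rule Sn_hom_comp)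

lemma QP_irrep_closed: "A \<in> QP k n \<Longrightarrow> F \<in> QP_irrep k n \<nu> \<Longrightarrow> A \<circ> F \<in> QP_irrep k n \<nu>"
  unfolding QP_def QP_irrep_def by (rule Sn_hom_comp)

lemma QP_irrep_subspace: "maps.subspace (QP_irrep k n \<nu>)"
proof -
  have sub: "fn.subspace (W_power k n)"
    unfolding W_power_def tensor_power_def by (rule fn.subspace_span)
  show ?thesis
    unfolding maps.subspace_def QP_irrep_def Sn_hom_def
    using fn.subspace_0[OF sub] fn.subspace_add[OF sub] fn.subspace_scale[OF sub]
    by (simp add: map_scale_def diagonal_act_def fun_act_def cscale_def)
      (simp add: fun_eq_iff algebra_simps)
qed

end

theory Submission
  imports Defs
begin

text \<open>
  Write \<open>W\<close> for the irreducible module of shape \<open>(n - 1, 1)\<close>. The permutation module of \<open>S\<^sub>n\<close> on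
  \<open>n\<close> points is \<open>1 \<oplus> W\<close>, so the functions on words of length \<open>k\<close> over \<open>{..<n}\<close> contain \<open>W\<close> to the
  \<open>k\<close>-th tensor power as those functions all of whose coordinate sums vanish. The multiplicity is
  therefore found by counting homomorphisms into spaces of functions on words and removing one
  coordinate at a time.

  For a finite index set \<open>I\<close>, an equivariant map from the Specht module of \<open>\<nu>\<close> to the functions on
  words indexed by \<open>I\<close> is determined by the image \<open>a\<close> of one polytabloid. Label the entry \<open>y\<close> of the
  fixed tableau by one plus the first position at which the word takes the value \<open>y\<close>, and by \<open>0\<close>
  if it never does. A word is semistandard if its labels increase strictly down columns and weakly along rows.
  Antisymmetry of the polytabloid under column permutations and the Garnir relations force \<open>a = 0\<close>
  as soon as \<open>a\<close> vanishes on semistandard words (\<open>straightening\<close>). Conversely every semistandard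
  word yields a homomorphism that sums a function on tabloids over an orbit; evaluated at
  semistandard words these homomorphisms form a triangular matrix. Hence the dimension is the number
  of semistandard words (\<open>dim_word_hom_semistandard\<close>).

  A word is the same as the set partition of \<open>I\<close> into its fibres together with an injective
  placement of the blocks in the diagram. If it is semistandard, all rows below the first are
  filled by blocks; call these blocks marked. They form a standard filling of the shape \<open>\<lambda>\<close> that
  remains when the first row is deleted. If at least \<open>\<nu>\<^sub>2\<close> entries are unused by the word, these
  occupy the beginning of the first row and protect the first row from any interaction with the
  rest, and the unmarked blocks follow them in increasing order. So there are \<open>f\<^sup>\<lambda>\<close> semistandard words
  for every set partition with \<open>|\<lambda>|\<close> marked blocks (\<open>card_semistandard\<close>).

  Finally, let \<open>J \<subseteq> I\<close> be the coordinates in which the coordinate sum is required to vanish.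
  Summing over a coordinate \<open>i\<close> splits the functions for \<open>(I, J)\<close> into those for
  \<open>(I, J \<union> {i})\<close> and those for \<open>(I - {i}, J)\<close>. The set partitions with \<open>|\<lambda>|\<close> marked blocks in which
  no unmarked block is a singleton \<open>{j}\<close> with \<open>j \<in> J\<close> satisfy the same recursion, by deleting an
  unmarked block \<open>{i}\<close>. For \<open>I = J\<close> of size \<open>k\<close> every singleton is marked; choosing the \<open>m\<^sub>1\<close>
  singletons first, then the \<open>m\<^sub>2\<close> larger blocks and the remaining \<open>|\<lambda>| - m\<^sub>1\<close> marks among them,
  gives the double sum.
\<close>

section \<open>Bases and dimensions of spaces of maps\<close>

lemma maps_sum_apply: "(\<Sum>i\<in>A. f i) e x = (\<Sum>i\<in>A. f i e x)"
  for f :: "'i \<Rightarrow> 'v \<Rightarrow> 'x \<Rightarrow> complex"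
  by (induction A rule: infinite_finite_induct) auto

text \<open>The combination of the family that agrees with a given map on all of \<open>R\<close> is found one point at a
  time in order of increasing weight: subtracting a multiple of \<open>G x\<close> only disturbs the values at
  points of larger weight, which have not been treated yet. The set \<open>S\<close> in the proof is the
  collection of points that are still to be treated.\<close>

lemma triangular_family_spans:
  fixes G :: "'x \<Rightarrow> 'v \<Rightarrow> 'x \<Rightarrow> complex" and w :: "'x \<Rightarrow> nat"
  assumes sub: "maps.subspace H" and fin: "finite R"
    and G: "\<And>x. x \<in> R \<Longrightarrow> G x \<in> H"
    and diag: "\<And>x. x \<in> R \<Longrightarrow> G x e x \<noteq> 0"
    and tri: "\<And>x y. x \<in> R \<Longrightarrow> y \<in> R \<Longrightarrow> G x e y \<noteq> 0 \<Longrightarrow> x = y \<or> w x < w y"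
    and det: "\<And>F. F \<in> H \<Longrightarrow> (\<And>x. x \<in> R \<Longrightarrow> F e x = 0) \<Longrightarrow> F = 0"
  shows "H \<subseteq> maps.span (G ` R)"
proof -
  have "F \<in> maps.span (G ` R)"
    if "F \<in> H" "S \<subseteq> R" "\<And>x y. x \<in> S \<Longrightarrow> y \<in> R \<Longrightarrow> w x < w y \<Longrightarrow> y \<in> S"
      "\<And>x. x \<in> R - S \<Longrightarrow> F e x = 0" for F S
    using that
  proof (induction "card S" arbitrary: S F)
    case 0
    then have "S = {}" using fin by (simp add: finite_subset)
    then have "F = 0" using det 0 by blast
    show ?case unfolding \<open>F = 0\<close> by (rule maps.span_zero)
  next
    case (Suc m)
    then have finS: "finite S" "S \<noteq> {}" using fin finite_subset by auto
    then obtain x0 where x0: "x0 \<in> S" "\<And>y. y \<in> S \<Longrightarrow> w x0 \<le> w y"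
      using finite_has_minimal[of "w ` S"] by (metis (no_types, lifting) arg_min_if_finite(1) arg_min_least)
    define F' where "F' = F - map_scale (F e x0 / G x0 e x0) (G x0)"
    have x0R: "x0 \<in> R" using x0 Suc.prems by auto
    have F'H: "F' \<in> H"
      unfolding F'_def using sub Suc.prems G x0R by (intro maps.subspace_diff maps.subspace_scale) auto
    have "F' \<in> maps.span (G ` R)"
    proof (rule Suc.hyps(1)[of "S - {x0}"])
      show "m = card (S - {x0})" using Suc.hyps x0 finS by simp
      show "F' \<in> H" by fact
      show "S - {x0} \<subseteq> R" using Suc.prems by auto
      show "y \<in> S - {x0}" if "x \<in> S - {x0}" "y \<in> R" "w x < w y" for x y
        using that Suc.prems(3)[of x y] x0(2)[of x] by auto
      show "F' e x = 0" if "x \<in> R - (S - {x0})" for x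
      proof (cases "x = x0")
        case True
        then show ?thesis using diag[OF x0R] by (simp add: F'_def map_scale_def cscale_def)
      next
        case False
        then have "x \<notin> S" "x \<in> R" using that by auto
        then have "G x0 e x = 0" using tri[OF x0R, of x] False Suc.prems(3)[OF x0(1)] by auto
        then show ?thesis using Suc.prems(4)[of x] \<open>x \<notin> S\<close> \<open>x \<in> R\<close>
          by (simp add: F'_def map_scale_def cscale_def)
      qed
    qed
    moreover have "map_scale (F e x0 / G x0 e x0) (G x0) \<in> maps.span (G ` R)"
      using x0R by (intro maps.span_scale maps.span_base) auto
    ultimately have "F' + map_scale (F e x0 / G x0 e x0) (G x0) \<in> maps.span (G ` R)"
      by (rule maps.span_add)
    then show ?case by (simp add: F'_def)
  qed
  from this[of _ R] show ?thesis by blast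
qed

lemma triangular_family_independent:
  fixes G :: "'x \<Rightarrow> 'v \<Rightarrow> 'x \<Rightarrow> complex" and w :: "'x \<Rightarrow> nat"
  assumes fin: "finite R"
    and diag: "\<And>x. x \<in> R \<Longrightarrow> G x e x \<noteq> 0"
    and tri: "\<And>x y. x \<in> R \<Longrightarrow> y \<in> R \<Longrightarrow> G x e y \<noteq> 0 \<Longrightarrow> x = y \<or> w x < w y"
  shows "inj_on G R" "maps.independent (G ` R)"
proof -
  show inj: "inj_on G R"
  proof (rule inj_onI, rule ccontr)
    fix x y assume xy: "x \<in> R" "y \<in> R" "G x = G y" "x \<noteq> y"
    then have "w x < w y" "w y < w x" using tri[of x y] tri[of y x] diag[of x] diag[of y] by auto
    then show False by simp
  qed
  show "maps.independent (G ` R)"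
  proof (rule maps.independent_if_scalars_zero)
    show "finite (G ` R)" using fin by simp
    fix f v assume 0: "(\<Sum>v\<in>G ` R. map_scale (f v) v) = 0" and v: "v \<in> G ` R"
    have 0: "(\<Sum>x\<in>R. map_scale (f (G x)) (G x)) = 0"
      using 0 inj by (simp add: sum.reindex)
    define S where "S = {x \<in> R. f (G x) \<noteq> 0}"
    have "S = {}"
    proof (rule ccontr)
      assume "S \<noteq> {}"
      moreover have finS: "finite S" using fin by (simp add: S_def)
      ultimately obtain y where y: "y \<in> S" "\<And>x. x \<in> S \<Longrightarrow> w y \<le> w x"
        by (metis (no_types, lifting) arg_min_if_finite(1) arg_min_least)
      have "(\<Sum>x\<in>R. f (G x) * G x e y) = (\<Sum>x\<in>R. map_scale (f (G x)) (G x)) e y"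
        unfolding maps_sum_apply by (simp add: map_scale_def cscale_def)
      also have "\<dots> = 0" using 0 by simp
      also have "(\<Sum>x\<in>R. f (G x) * G x e y) = (\<Sum>x\<in>{y}. f (G x) * G x e y)"
      proof (rule sum.mono_neutral_right)
        show "{y} \<subseteq> R" using y by (auto simp: S_def)
        show "\<forall>x\<in>R - {y}. f (G x) * G x e y = 0"
        proof
          fix x assume x: "x \<in> R - {y}"
          show "f (G x) * G x e y = 0"
            using tri[of x y] y(1) x y(2)[of x] by (fastforce simp: S_def)
        qed
      qed (use fin in auto)
      finally show False using y diag by (auto simp: S_def)
    qed
    then show "f v = 0" using v by (auto simp: S_def)
  qed
qed

text \<open>The form in which dimensions are computed below: the points of \<open>R\<close> separate the space \<open>H\<close> by
  evaluation at the fixed vector \<open>e\<close>, and a family in \<open>H\<close> indexed by \<open>R\<close> has a triangular matrix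
  of values. The finite spanning set is recorded because the dimension of an infinite-dimensional
  space is \<open>0\<close> by convention.\<close>

lemma triangular_family_basis:
  fixes G :: "'x \<Rightarrow> 'v \<Rightarrow> 'x \<Rightarrow> complex" and w :: "'x \<Rightarrow> nat"
  assumes sub: "maps.subspace H" and fin: "finite R"
    and G: "\<And>x. x \<in> R \<Longrightarrow> G x \<in> H"
    and diag: "\<And>x. x \<in> R \<Longrightarrow> G x e x \<noteq> 0"
    and tri: "\<And>x y. x \<in> R \<Longrightarrow> y \<in> R \<Longrightarrow> G x e y \<noteq> 0 \<Longrightarrow> x = y \<or> w x < w y"
    and det: "\<And>F. F \<in> H \<Longrightarrow> (\<And>x. x \<in> R \<Longrightarrow> F e x = 0) \<Longrightarrow> F = 0"
  shows "maps.dim H = card R" "\<exists>B. finite B \<and> H \<subseteq> maps.span B"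
proof -
  have span: "H \<subseteq> maps.span (G ` R)" by (rule triangular_family_spans[OF assms])
  note ind = triangular_family_independent[of R G e w, OF fin diag tri]
  show "\<exists>B. finite B \<and> H \<subseteq> maps.span B" using span fin by blast
  have "G ` R \<subseteq> H" using G by auto
  then show "maps.dim H = card R"
    using maps.dim_unique[OF _ span ind(2), of "card R"] ind(1) card_image by blast
qed

context vector_space
begin

lemma dim_direct_sum:
  assumes A: "subspace A" and B: "subspace B" and AB: "A \<inter> B = {0}"
    and V: "V = {a + b | a b. a \<in> A \<and> b \<in> B}"
    and fin: "finite S" "V \<subseteq> span S"
  shows "dim V = dim A + dim B"
proof -
  have AV: "A \<subseteq> V" "B \<subseteq> V" unfolding V
    using subspace_0[OF A] subspace_0[OF B] by (force intro: exI[of _ 0])+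
  obtain a where a: "a \<subseteq> A" "independent a" "A \<subseteq> span a" "card a = dim A" by (rule basis_exists)
  obtain b where b: "b \<subseteq> B" "independent b" "B \<subseteq> span b" "card b = dim B" by (rule basis_exists)
  have fa: "finite a" "finite b"
    using independent_span_bound[OF fin(1) a(2)] independent_span_bound[OF fin(1) b(2)]
      a(1) b(1) AV fin(2) by auto
  have sA: "span a \<subseteq> A" "span b \<subseteq> B" by (rule span_minimal[OF a(1) A], rule span_minimal[OF b(1) B])
  have disj: "a \<inter> b = {}"
  proof -
    have "a \<inter> b \<subseteq> {0}" using a b AB by auto
    moreover have "0 \<notin> a" using a(2) dependent_zero by blast
    ultimately show ?thesis by auto
  qed
  have "independent (a \<union> b)"
  proof (rule independent_if_scalars_zero)
    show "finite (a \<union> b)" using fa by simp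
    fix f x assume 0: "(\<Sum>x\<in>a \<union> b. scale (f x) x) = 0" and x: "x \<in> a \<union> b"
    let ?u = "\<Sum>x\<in>a. scale (f x) x" and ?v = "\<Sum>x\<in>b. scale (f x) x"
    have uv: "?u + ?v = 0" using 0 sum.union_disjoint[OF fa disj, of "\<lambda>x. scale (f x) x"] by simp
    have "?u \<in> span a" "?v \<in> span b" by (auto intro: span_sum span_scale span_base)
    moreover have "?u = - ?v" using uv by (simp add: eq_neg_iff_add_eq_0)
    ultimately have "?u \<in> A \<inter> B" using sA subspace_neg[OF B, of ?v] by auto
    then have u0: "?u = 0" using AB by auto
    then have v0: "?v = 0" using uv by simp
    show "f x = 0"
      using x independentD[OF a(2) fa(1) subset_refl u0] independentD[OF b(2) fa(2) subset_refl v0] by auto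
  qed
  moreover have "a \<union> b \<subseteq> V" using a b AV by auto
  moreover have "V \<subseteq> span (a \<union> b)"
    unfolding span_Un V using a(3) b(3) by blast
  ultimately have "dim V = card (a \<union> b)" using dim_unique by blast
  also have "\<dots> = dim A + dim B" using card_Un_disjoint[OF fa disj] a b by simp
  finally show ?thesis .
qed

end

text \<open>Injectivity on the subspace suffices, and neither ambient space has to be finite-dimensional.\<close>

lemma dim_injective_image:
  assumes lin: "Vector_Spaces.linear s1 s2 f" and sub: "module.subspace s1 S" and inj: "inj_on f S"
  shows "vector_space.dim s2 (f ` S) = vector_space.dim s1 S"
proof -
  interpret lf: Vector_Spaces.linear s1 s2 f by fact
  obtain B where B: "B \<subseteq> S" "lf.vs1.independent B" "S \<subseteq> lf.vs1.span B" "card B = lf.vs1.dim S"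
    by (rule lf.vs1.basis_exists)
  have span: "lf.vs1.span B = S" using B lf.vs1.span_minimal[OF B(1) sub] by auto
  have "lf.vs2.independent (f ` B)" using lf.independent_injective_image[OF B(2)] inj span by simp
  moreover have "f ` S \<subseteq> lf.vs2.span (f ` B)" using lf.span_image[of B] span by simp
  moreover have "card (f ` B) = card B" using inj_on_subset[OF inj B(1)] card_image by blast
  ultimately show ?thesis
    using lf.vs2.dim_unique[OF image_mono[OF B(1)]] B(4) by simp
qed


section \<open>Set partitions with marked blocks\<close>

text \<open>The set \<open>Q\<close> consists of the marked blocks of \<open>P\<close>. Elements of \<open>J\<close> must not form unmarked
  singletons.\<close>

definition marked_partitions :: "nat \<Rightarrow> nat set \<Rightarrow> nat set \<Rightarrow> (nat set set \<times> nat set set) set" where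
  "marked_partitions d I J = {(P, Q). partition_on I P \<and> Q \<subseteq> P \<and> card Q = d \<and>
     (\<forall>i\<in>J. {i} \<in> P \<longrightarrow> {i} \<in> Q)}"

lemma finite_marked_partitions: "finite I \<Longrightarrow> finite (marked_partitions d I J)"
  by (rule finite_subset[of _ "Pow (Pow I) \<times> Pow (Pow I)"])
    (auto simp: marked_partitions_def partition_on_def)

text \<open>The partitions counted on the left but not by the first summand on the right contain \<open>{i}\<close> as an
  unmarked block; deleting it leaves an arbitrary marked partition of \<open>I - {i}\<close>. This is the
  combinatorial twin of \<open>dim_word_hom_insert\<close>.\<close>

lemma card_marked_partitions_insert:
  assumes "finite I" "i \<in> I" "i \<notin> J"
  shows "card (marked_partitions d I J) =
    card (marked_partitions d I (insert i J)) + card (marked_partitions d (I - {i}) J)"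
proof -
  let ?S = "{(P, Q) \<in> marked_partitions d I J. {i} \<in> P \<and> {i} \<notin> Q}"
  have split: "marked_partitions d I J = marked_partitions d I (insert i J) \<union> ?S"
    by (auto simp: marked_partitions_def)
  have disj: "marked_partitions d I (insert i J) \<inter> ?S = {}"
    by (auto simp: marked_partitions_def)
  have "bij_betw (\<lambda>(P, Q). (insert {i} P, Q)) (marked_partitions d (I - {i}) J) ?S"
  proof (rule bij_betw_byWitness[where f' = "\<lambda>(P, Q). (P - {{i}}, Q)"])
    have notin: "{i} \<notin> P" if "partition_on (I - {i}) P" for P
      using that unfolding partition_on_def by auto
    show "\<forall>a\<in>marked_partitions d (I - {i}) J.
        (case case a of (P, Q) \<Rightarrow> (insert {i} P, Q) of (P, Q) \<Rightarrow> (P - {{i}}, Q)) = a"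
      using notin by (auto simp: marked_partitions_def)
    show "\<forall>a\<in>?S. (case case a of (P, Q) \<Rightarrow> (P - {{i}}, Q) of (P, Q) \<Rightarrow> (insert {i} P, Q)) = a"
      by auto
    show "(\<lambda>(P, Q). (insert {i} P, Q)) ` marked_partitions d (I - {i}) J \<subseteq> ?S"
    proof safe
      fix P Q assume PQ: "(P, Q) \<in> marked_partitions d (I - {i}) J"
      then have P: "partition_on (I - {i}) P" by (simp add: marked_partitions_def)
      have "partition_on (insert i (I - {i})) (insert {i} P)"
        using partition_on_insert[of "{i}" "P" "I"] P assms notin[OF P]
        by (auto simp: partition_on_def disjoint_def)
      then have "partition_on I (insert {i} P)" using assms by (simp add: insert_absorb)
      moreover have "{i} \<notin> Q" using PQ notin[OF P] by (auto simp: marked_partitions_def)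
      ultimately show "(insert {i} P, Q) \<in> marked_partitions d I J" "{i} \<in> Q \<Longrightarrow> False"
        using PQ assms by (auto simp: marked_partitions_def)
    qed
    show "(\<lambda>(P, Q). (P - {{i}}, Q)) ` ?S \<subseteq> marked_partitions d (I - {i}) J"
    proof safe
      fix P Q assume PQ: "(P, Q) \<in> marked_partitions d I J" "{i} \<in> P" "{i} \<notin> Q"
      have "disjnt {i} (\<Union>(P - {{i}}))"
      proof -
        have "B \<inter> {i} = {}" if "B \<in> P - {{i}}" for B
          using that PQ by (auto simp: marked_partitions_def partition_on_def disjoint_def simp del: Int_insert_right)
        then show ?thesis by (auto simp: disjnt_def)
      qed
      then have "partition_on (I - {i}) (P - {{i}})"
        using partition_on_insert[of "{i}" "P - {{i}}" I] PQ
        by (simp add: marked_partitions_def insert_absorb)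
      then show "(P - {{i}}, Q) \<in> marked_partitions d (I - {i}) J"
        using PQ by (auto simp: marked_partitions_def)
    qed
  qed
  then have "card ?S = card (marked_partitions d (I - {i}) J)" by (rule bij_betw_same_card[symmetric])
  moreover have "card (marked_partitions d I J) = card (marked_partitions d I (insert i J)) + card ?S"
    using finite_marked_partitions[OF assms(1)] disj
    by (subst split, intro card_Un_disjoint) (auto intro: finite_subset[rotated, of "marked_partitions d I J"])
  ultimately show ?thesis by simp
qed

text \<open>\<open>sp2\<close> is defined by partitions of an initial segment; a bijection carries them to any set of the
  same size.\<close>

lemma card_partitions_no_singletons:
  fixes A :: "nat set"
  assumes "finite A"
  shows "card {P. partition_on A P \<and> card P = b \<and> (\<forall>B\<in>P. 2 \<le> card B)} = sp2 (card A) b"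
proof -
  obtain h where h: "bij_betw h A {..<card A}"
    using ex_bij_betw_finite_nat[OF assms] by (auto simp: atLeast0LessThan)
  define g where "g = inv_into A h"
  have g: "bij_betw g {..<card A} A" unfolding g_def by (rule bij_betw_inv_into[OF h])
  let ?X = "\<lambda>A. {P. partition_on A P \<and> card P = b \<and> (\<forall>B\<in>P. 2 \<le> card B)}"
  have img: "(`) ((`) f) ` ?X A \<subseteq> ?X B" if f: "bij_betw f A B" for f and A B :: "nat set"
  proof safe
    fix P assume P: "partition_on A P" "b = card P" "\<forall>B\<in>P. 2 \<le> card B"
    have inj: "inj_on f A" "f ` A = B" using f by (auto simp: bij_betw_def)
    have PA: "\<Union>P = A" using P by (simp add: partition_on_def)
    have "{} \<notin> (`) f ` P" using P(1) by (auto simp: partition_on_def)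
    then show "partition_on B ((`) f ` P)"
      using partition_on_inj_image[OF P(1) inj(1)] inj(2) by simp
    have "inj_on ((`) f) P"
      using inj_on_image[of f P] inj PA by simp
    then show "card ((`) f ` P) = card P" by (rule card_image)
    fix B assume "B \<in> P"
    then have "card (f ` B) = card B" using inj PA by (intro card_image) (auto intro: inj_on_subset)
    then show "2 \<le> card (f ` B)" using P \<open>B \<in> P\<close> by auto
  qed
  have "bij_betw ((`) ((`) h)) (?X A) (?X {..<card A})"
  proof (rule bij_betw_byWitness[where f' = "(`) ((`) g)"])
    have gh: "g (h x) = x" if "x \<in> A" for x using that h unfolding g_def by (simp add: bij_betw_def)
    have hg: "h (g x) = x" if "x < card A" for x
      using that h unfolding g_def by (simp add: bij_betw_def f_inv_into_f)
    have inv: "(`) f ` (`) f' ` P = P" if "\<And>x. x \<in> C \<Longrightarrow> f (f' x) = x" "partition_on C P" for f f' P and C :: "nat set"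
    proof -
      have "f ` f' ` B = B" if "B \<in> P" for B
      proof -
        have "f ` f' ` B = (\<lambda>x. x) ` B"
          unfolding image_image using that \<open>partition_on C P\<close>
          by (intro image_cong refl \<open>\<And>x. x \<in> C \<Longrightarrow> f (f' x) = x\<close>) (auto simp: partition_on_def)
        then show ?thesis by simp
      qed
      then show ?thesis by (simp add: image_image)
    qed
    show "\<forall>P\<in>?X A. (`) g ` (`) h ` P = P" by (auto intro!: inv[of A] gh)
    show "\<forall>P\<in>?X {..<card A}. (`) h ` (`) g ` P = P" by (auto intro!: inv[of "{..<card A}"] hg)
  qed (use img[OF h] img[OF g] in auto)
  then show ?thesis unfolding sp2_def by (rule bij_betw_same_card)
qed


definition nonsingleton_partitions :: "nat set \<Rightarrow> nat set set set" where
  "nonsingleton_partitions A = {P. partition_on A P \<and> (\<forall>B\<in>P. 2 \<le> card B)}"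

lemma finite_nonsingleton_partitions: "finite A \<Longrightarrow> finite (nonsingleton_partitions A)"
  by (rule finite_subset[of _ "Pow (Pow A)"]) (auto simp: nonsingleton_partitions_def partition_on_def)

text \<open>Blocks of size at least two limit the number of blocks to half the number of points, which is
  where the upper bound of the inner sum comes from.\<close>

lemma sum_nonsingleton_partitions:
  assumes "finite A"
  shows "(\<Sum>P\<in>nonsingleton_partitions A. card P choose j) =
    (\<Sum>m = j..card A div 2. (m choose j) * sp2 (card A) m)"
proof -
  let ?N = "nonsingleton_partitions A"
  have le: "card P \<le> card A div 2" if "P \<in> ?N" for P
  proof -
    have P: "partition_on A P" "\<forall>B\<in>P. 2 \<le> card B" using that by (auto simp: nonsingleton_partitions_def)
    have "card P * 2 = (\<Sum>B\<in>P. 2)" by simp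
    also have "\<dots> \<le> (\<Sum>B\<in>P. card B)" using P by (intro sum_mono) auto
    also have "\<dots> = card (\<Union>P)"
      using P assms by (intro card_Union_disjoint[symmetric])
        (auto simp: partition_on_def intro: finite_subset)
    also have "\<Union>P = A" using P by (simp add: partition_on_def)
    finally show ?thesis by simp
  qed
  have "(\<Sum>P\<in>?N. card P choose j) =
      (\<Sum>m\<in>{..card A div 2}. \<Sum>P\<in>{P \<in> ?N. card P = m}. card P choose j)"
    using le finite_nonsingleton_partitions[OF assms] by (intro sum.group[symmetric]) auto
  also have "\<dots> = (\<Sum>m\<in>{..card A div 2}. (m choose j) * sp2 (card A) m)"
  proof (rule sum.cong[OF refl])
    fix m
    have "{P \<in> ?N. card P = m} = {P. partition_on A P \<and> card P = m \<and> (\<forall>B\<in>P. 2 \<le> card B)}"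
      by (auto simp: nonsingleton_partitions_def)
    then have "card {P \<in> ?N. card P = m} = sp2 (card A) m"
      using card_partitions_no_singletons[OF assms] by simp
    then show "(\<Sum>P\<in>{P \<in> ?N. card P = m}. card P choose j) = (m choose j) * sp2 (card A) m"
      by simp
  qed
  also have "\<dots> = (\<Sum>m = j..card A div 2. (m choose j) * sp2 (card A) m)"
    by (rule sum.mono_neutral_right) (auto simp: binomial_eq_0)
  finally show ?thesis .
qed

text \<open>When all singletons are marked, a marked partition amounts to the set \<open>A\<close> of its singletons, a
  partition of the complement into blocks of size at least two, and a choice of the
  \<open>d - card A\<close> remaining marked blocks among these.\<close>

lemma card_marked_partitions_all:
  assumes I: "finite I"
  shows "card (marked_partitions d I I) =
    (\<Sum>m1 = 0..d. (card I choose m1) *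
      (\<Sum>m2 = d - m1..(card I - m1) div 2. (m2 choose (d - m1)) * sp2 (card I - m1) m2))"
proof -
  let ?R = "\<lambda>m. \<Sum>m2 = d - m..(card I - m) div 2. (m2 choose (d - m)) * sp2 (card I - m) m2"
  let ?S = "\<lambda>A. SIGMA P:nonsingleton_partitions (I - A). {Q. Q \<subseteq> P \<and> card Q = d - card A}"
  let ?s = "\<lambda>A. (\<lambda>i. {i}) ` A"
  let ?\<A> = "{A. A \<subseteq> I \<and> card A \<le> d}"
  let ?\<Omega> = "SIGMA A:?\<A>. ?S A"
  define f where "f = (\<lambda>(A :: nat set, P, Q). (P \<union> ?s A, Q \<union> ?s A))"
  define g where "g = (\<lambda>(P, Q). ({i \<in> I. {i} \<in> P}, {B \<in> P. 2 \<le> card B}, {B \<in> Q :: nat set set. 2 \<le> card B}))"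
  have fin\<A>: "finite ?\<A>" using I by simp
  have cs: "card (?s A) = card A" for A :: "nat set" by (rule card_image) simp
  have part: "finite B" "B \<noteq> {}" if "partition_on I P" "B \<in> P" for P B
    using that I by (auto simp: partition_on_def intro: finite_subset)
  have "bij_betw f ?\<Omega> (marked_partitions d I I)"
  proof (rule bij_betw_byWitness[where f' = g])
    show "\<forall>a\<in>?\<Omega>. g (f a) = a"
    proof safe
      fix A P Q assume *: "A \<subseteq> I" "card A \<le> d" "P \<in> nonsingleton_partitions (I - A)" "Q \<subseteq> P" "card Q = d - card A"
      then have "{i} \<notin> P" for i by (force simp: nonsingleton_partitions_def)
      then have "{i \<in> I. {i} \<in> P \<union> ?s A} = A" using * by auto
      moreover have "{B \<in> P \<union> ?s A. 2 \<le> card B} = P" "{B \<in> Q \<union> ?s A. 2 \<le> card B} = Q"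
        using * by (auto simp: nonsingleton_partitions_def)
      ultimately show "g (f (A, P, Q)) = (A, P, Q)" by (simp add: f_def g_def)
    qed
    have split: "{B \<in> R. 2 \<le> card B} \<union> ?s {i \<in> I. {i} \<in> P} = R"
      if PQ: "(P, Q) \<in> marked_partitions d I I" and R: "R = P \<or> R = Q" for P Q R
    proof -
      have P: "partition_on I P" "Q \<subseteq> P" "\<And>i. i \<in> I \<Longrightarrow> {i} \<in> P \<Longrightarrow> {i} \<in> Q"
        using PQ by (auto simp: marked_partitions_def)
      have "B \<in> ?s {i \<in> I. {i} \<in> P}" if "B \<in> R" "\<not> 2 \<le> card B" for B
      proof -
        have B: "B \<in> P" using that R P by auto
        then have "card B \<noteq> 0" using part[OF P(1)] by simp
        then have "card B = 1" using that by simp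
        then obtain i where "B = {i}" by (auto simp: card_1_singleton_iff)
        then show ?thesis using B P(1) by (auto simp: partition_on_def)
      qed
      moreover have "?s {i \<in> I. {i} \<in> P} \<subseteq> R" using R P by blast
      ultimately show ?thesis by blast
    qed
    show "\<forall>a\<in>marked_partitions d I I. f (g a) = a"
    proof safe
      fix P Q assume "(P, Q) \<in> marked_partitions d I I"
      then show "f (g (P, Q)) = (P, Q)" using split[of P Q P] split[of P Q Q] by (simp add: f_def g_def)
    qed
    show "f ` ?\<Omega> \<subseteq> marked_partitions d I I"
    proof (intro image_subsetI)
      fix a assume "a \<in> ?\<Omega>"
      then obtain A P Q where a: "a = (A, P, Q)" and *: "A \<subseteq> I" "card A \<le> d" "P \<in> nonsingleton_partitions (I - A)" "Q \<subseteq> P" "card Q = d - card A" by auto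
      have ns: "{i} \<notin> P" for i using * by (force simp: nonsingleton_partitions_def)
      have P: "partition_on (I - A) P" using * by (simp add: nonsingleton_partitions_def)
      have "disjoint (P \<union> ?s A)"
        using P unfolding partition_on_def disjoint_def by blast
      then have "partition_on I (P \<union> ?s A)" using P *(1) by (auto simp: partition_on_def)
      moreover have "card (Q \<union> ?s A) = d"
      proof -
        have "finite P" using finite_elements[OF _ P] I by simp
        then have "finite Q" "finite A" using * I by (auto intro: finite_subset)
        moreover have "Q \<inter> ?s A = {}" using ns * by auto
        ultimately show ?thesis using * by (simp add: card_Un_disjoint cs)
      qed
      ultimately show "f a \<in> marked_partitions d I I"
        using * ns unfolding a marked_partitions_def f_def by auto
    qed
    show "g ` marked_partitions d I I \<subseteq> ?\<Omega>"
    proof (intro image_subsetI)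
      fix a assume a: "a \<in> marked_partitions d I I"
      obtain P Q where a_eq: "a = (P, Q)" by (cases a)
      note PQ = a[unfolded a_eq]
      let ?A = "{i \<in> I. {i} \<in> P}"
      have P: "partition_on I P" "Q \<subseteq> P" "card Q = d" using PQ by (auto simp: marked_partitions_def)
      have finP: "finite P" by (rule finite_elements[OF I P(1)])
      have Q: "card {B \<in> Q. 2 \<le> card B} + card ?A = d"
      proof -
        have "card ({B \<in> Q. 2 \<le> card B} \<union> ?s ?A) = card {B \<in> Q. 2 \<le> card B} + card (?s ?A)"
          using finP P I by (intro card_Un_disjoint) (auto intro: finite_subset)
        then show ?thesis unfolding split[OF PQ disjI2[OF refl]] cs P(3) by (rule sym)
      qed
      have un: "\<Union>P = I" using P by (simp add: partition_on_def)
      have "{B \<in> P. 2 \<le> card B} \<in> nonsingleton_partitions (I - ?A)"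
        unfolding nonsingleton_partitions_def mem_Collect_eq
      proof
        have dj: "B = {i}" if "B \<in> P" "i \<in> B" "{i} \<in> P" for B i
          using that disjointD[of P B "{i}"] P(1) unfolding partition_on_def by auto
        show "partition_on (I - ?A) {B \<in> P. 2 \<le> card B}"
          unfolding partition_on_def
        proof (intro conjI)
          show "\<Union>{B \<in> P. 2 \<le> card B} = I - ?A"
          proof (intro subset_antisym subsetI)
            fix i assume "i \<in> \<Union>{B \<in> P. 2 \<le> card B}"
            then obtain B where B: "B \<in> P" "2 \<le> card B" "i \<in> B" by auto
            then show "i \<in> I - ?A" using dj[OF B(1,3)] un by auto
          next
            fix i assume i: "i \<in> I - ?A"
            then obtain B where B: "B \<in> P" "i \<in> B" using un by auto
            then have "B \<in> {B \<in> P. 2 \<le> card B} \<union> ?s ?A" using split[OF PQ, of P] by blast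
            then show "i \<in> \<Union>{B \<in> P. 2 \<le> card B}" using B i by auto
          qed
        qed (use P(1) in \<open>auto simp: partition_on_def disjoint_def\<close>)
      qed auto
      moreover have "{B \<in> Q. 2 \<le> card B} \<subseteq> {B \<in> P. 2 \<le> card B}" using P by blast
      moreover have "card {B \<in> Q. 2 \<le> card B} = d - card ?A" "card ?A \<le> d" using Q by linarith+
      ultimately show "g a \<in> ?\<Omega>" by (simp add: g_def a_eq)
    qed
  qed
  then have "card (marked_partitions d I I) = card ?\<Omega>" by (rule bij_betw_same_card[symmetric])
  also have "\<dots> = (\<Sum>A\<in>?\<A>. card (?S A))"
  proof (rule card_SigmaI[OF fin\<A>], rule ballI, rule finite_SigmaI)
    fix A assume "A \<in> ?\<A>"
    show "finite (nonsingleton_partitions (I - A))" using I by (simp add: finite_nonsingleton_partitions)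
    fix P assume "P \<in> nonsingleton_partitions (I - A)"
    then have "finite P" using finite_elements[of "I - A" P] I by (simp add: nonsingleton_partitions_def)
    then show "finite {Q. Q \<subseteq> P \<and> card Q = d - card A}" by simp
  qed
  also have "\<dots> = (\<Sum>A\<in>?\<A>. \<Sum>P\<in>nonsingleton_partitions (I - A). card P choose (d - card A))"
  proof (rule sum.cong[OF refl])
    fix A assume "A \<in> ?\<A>"
    have fP: "finite P" if "P \<in> nonsingleton_partitions (I - A)" for P
      using that finite_elements[of "I - A" P] I by (simp add: nonsingleton_partitions_def)
    then have "card (?S A) =
        (\<Sum>P\<in>nonsingleton_partitions (I - A). card {Q. Q \<subseteq> P \<and> card Q = d - card A})"
      using finite_nonsingleton_partitions[of "I - A"] I by (intro card_SigmaI) simp_all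
    also have "\<dots> = (\<Sum>P\<in>nonsingleton_partitions (I - A). card P choose (d - card A))"
      using fP by (intro sum.cong refl n_subsets) auto
    finally show "card (?S A) =
        (\<Sum>P\<in>nonsingleton_partitions (I - A). card P choose (d - card A))" .
  qed
  also have "\<dots> = (\<Sum>A\<in>?\<A>. ?R (card A))"
  proof (rule sum.cong[OF refl])
    fix A assume "A \<in> ?\<A>"
    then have "card (I - A) = card I - card A" using I by (intro card_Diff_subset) (auto intro: finite_subset)
    then show "(\<Sum>P\<in>nonsingleton_partitions (I - A). card P choose (d - card A)) =
        ?R (card A)"
      using sum_nonsingleton_partitions[of "I - A"] I by simp
  qed
  also have "\<dots> = (\<Sum>m1\<in>{0..d}. \<Sum>A\<in>{A \<in> ?\<A>. card A = m1}. ?R (card A))"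
    using fin\<A> by (intro sum.group[symmetric]) auto
  also have "\<dots> = (\<Sum>m1 = 0..d. (card I choose m1) *
      ?R m1)"
  proof (rule sum.cong[OF refl])
    fix m1 assume "m1 \<in> {0..d}"
    then have "{A \<in> ?\<A>. card A = m1} = {A. A \<subseteq> I \<and> card A = m1}" by auto
    then have "card {A \<in> ?\<A>. card A = m1} = card I choose m1" using n_subsets[OF I] by simp
    then show "(\<Sum>A\<in>{A \<in> ?\<A>. card A = m1}. ?R (card A)) = (card I choose m1) *
      ?R m1"
      by simp
  qed
  finally show ?thesis .
qed

section \<open>Words and their tensor coordinates\<close>

lemma Sn_hom_subspace:
  assumes "fn.subspace V"
  shows "maps.subspace (Sn_hom n U \<rho> V (fun_act a))"
  unfolding maps.subspace_def Sn_hom_def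
  using fn.subspace_0[OF assms] fn.subspace_add[OF assms] fn.subspace_scale[OF assms]
  by (simp add: map_scale_def fun_act_def cscale_def) (simp add: fun_eq_iff algebra_simps)

text \<open>Words over \<open>{..<n}\<close> with positions in \<open>I\<close>. Off \<open>I\<close> they take the value \<open>n\<close>, a fixed point of every
  permutation of \<open>{..<n}\<close>, so that \<open>S\<^sub>n\<close> acts by plain composition and deleting the position \<open>i\<close> is
  the update \<open>x(i := n)\<close>.\<close>

definition words :: "nat \<Rightarrow> nat set \<Rightarrow> (nat \<Rightarrow> nat) set" where
  "words n I = {x. (\<forall>i\<in>I. x i < n) \<and> (\<forall>i. i \<notin> I \<longrightarrow> x i = n)}"

text \<open>In tensor language: the coordinates in \<open>J\<close> are taken from the sum-zero functions on points, the
  other coordinates in \<open>I\<close> from all functions on points.\<close>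

definition word_space :: "nat \<Rightarrow> nat set \<Rightarrow> nat set \<Rightarrow> ((nat \<Rightarrow> nat) \<Rightarrow> complex) set" where
  "word_space n I J = {f. (\<forall>x. x \<notin> words n I \<longrightarrow> f x = 0) \<and>
     (\<forall>i\<in>J. \<forall>x. (\<Sum>y<n. f (x(i := y))) = 0)}"

abbreviation word_act :: "(nat \<Rightarrow> nat) \<Rightarrow> ((nat \<Rightarrow> nat) \<Rightarrow> complex) \<Rightarrow> (nat \<Rightarrow> nat) \<Rightarrow> complex" where
  "word_act \<equiv> fun_act (\<circ>)"

lemma finite_words: "finite I \<Longrightarrow> finite (words n I)"
proof -
  assume "finite I"
  then have "finite (I \<rightarrow>\<^sub>E {..<n})" by (intro finite_PiE) auto
  moreover have "inj_on (\<lambda>x. restrict x I) (words n I)"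
  proof (intro inj_onI ext)
    fix x y i assume *: "x \<in> words n I" "y \<in> words n I" "restrict x I = restrict y I"
    show "x i = y i" using *(1,2) fun_cong[OF *(3), of i] by (cases "i \<in> I") (simp_all add: words_def)
  qed
  moreover have "(\<lambda>x. restrict x I) ` words n I \<subseteq> I \<rightarrow>\<^sub>E {..<n}" by (auto simp: words_def)
  ultimately show ?thesis using inj_on_finite by blast
qed

lemma permutes_word:
  assumes "p permutes {..<n}"
  shows "p \<circ> x \<in> words n I \<longleftrightarrow> x \<in> words n I"
proof -
  have "p n = n" using assms by (simp add: permutes_def)
  then have "p m = n \<longleftrightarrow> m = n" for m using permutes_inj[OF assms] by (metis injD)
  moreover have "p m < n \<longleftrightarrow> m < n" for m using permutes_in_image[OF assms, of m] by simp
  ultimately show ?thesis by (simp add: words_def)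
qed

lemma word_space_subspace: "fn.subspace (word_space n I J)"
  unfolding fn.subspace_def word_space_def
  by (auto simp: cscale_def sum.distrib sum_distrib_left[symmetric])

definition word_hom :: "nat \<Rightarrow> ('x \<Rightarrow> complex) set \<Rightarrow> ((nat \<Rightarrow> nat) \<Rightarrow> ('x \<Rightarrow> complex) \<Rightarrow> 'x \<Rightarrow> complex)
    \<Rightarrow> nat set \<Rightarrow> nat set \<Rightarrow> (('x \<Rightarrow> complex) \<Rightarrow> (nat \<Rightarrow> nat) \<Rightarrow> complex) set" where
  "word_hom n U \<rho> I J = Sn_hom n U \<rho> (word_space n I J) word_act"

lemma word_hom_subspace: "maps.subspace (word_hom n U \<rho> I J)"
  unfolding word_hom_def by (rule Sn_hom_subspace[OF word_space_subspace])

text \<open>Tensoring with the constant function \<open>1\<close> in coordinate \<open>i\<close>, and the summation over coordinate \<open>i\<close>.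
  The composite of the two is multiplication by \<open>n\<close>, which makes the first a section of the second
  up to a scalar.\<close>

definition inflate :: "nat \<Rightarrow> nat set \<Rightarrow> nat \<Rightarrow> ((nat \<Rightarrow> nat) \<Rightarrow> complex) \<Rightarrow> (nat \<Rightarrow> nat) \<Rightarrow> complex" where
  "inflate n I i f = (\<lambda>x. if x \<in> words n I then f (x(i := n)) else 0)"

definition marginal :: "nat \<Rightarrow> nat set \<Rightarrow> nat \<Rightarrow> ((nat \<Rightarrow> nat) \<Rightarrow> complex) \<Rightarrow> (nat \<Rightarrow> nat) \<Rightarrow> complex" where
  "marginal n I i f = (\<lambda>x. if x \<in> words n (I - {i}) then \<Sum>y<n. f (x(i := y)) else 0)"

lemma upd_words: "i \<in> I \<Longrightarrow> x(i := y) \<in> words n I \<longleftrightarrow> y < n \<and> x(i := n) \<in> words n (I - {i})"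
  unfolding words_def by (auto; metis)

lemma upd_self_word: "x \<in> words n (I - {i}) \<Longrightarrow> x(i := n) = x"
  by (auto simp: words_def fun_eq_iff)

lemma inflate_word_space:
  assumes "i \<in> I" "i \<notin> J" "J \<subseteq> I" "f \<in> word_space n (I - {i}) J"
  shows "inflate n I i f \<in> word_space n I J"
  unfolding word_space_def
proof (safe)
  show "inflate n I i f x = 0" if "x \<notin> words n I" for x using that by (simp add: inflate_def)
  fix j x assume j: "j \<in> J"
  have ij: "i \<noteq> j" using j assms by auto
  show "(\<Sum>y<n. inflate n I i f (x(j := y))) = 0"
  proof (cases "x i < n")
    case True
    have "inflate n I i f (x(j := y)) = f ((x(i := n))(j := y))" for y
    proof (cases "(x(j := y)) \<in> words n I")
      case True
      then show ?thesis using ij by (simp add: inflate_def fun_upd_twist)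
    next
      case False
      have "(x(j := y))(i := x i) = x(j := y)" using ij by auto
      then have "(x(j := y))(i := n) \<notin> words n (I - {i})"
        using False upd_words[OF assms(1), of "x(j := y)" "x i" n] \<open>x i < n\<close> by simp
      then have "f ((x(j := y))(i := n)) = 0" using assms(4) by (auto simp: word_space_def)
      then show ?thesis using False ij by (simp add: inflate_def fun_upd_twist)
    qed
    then show ?thesis using assms(4) j by (simp add: word_space_def)
  next
    case False
    then have "x(j := y) \<notin> words n I" for y using ij assms(1) by (auto simp: words_def)
    then show ?thesis by (simp add: inflate_def)
  qed
qed

lemma marginal_word_space:
  assumes "i \<in> I" "i \<notin> J" "J \<subseteq> I" "f \<in> word_space n I J"
  shows "marginal n I i f \<in> word_space n (I - {i}) J"
  unfolding word_space_def
proof (safe)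
  show "marginal n I i f x = 0" if "x \<notin> words n (I - {i})" for x using that by (simp add: marginal_def)
  fix j x assume j: "j \<in> J"
  have ij: "i \<noteq> j" using j assms by auto
  show "(\<Sum>y<n. marginal n I i f (x(j := y))) = 0"
  proof (cases "x i = n")
    case True
    have *: "marginal n I i f (x(j := y)) = (\<Sum>z<n. f ((x(i := z))(j := y)))" for y
    proof (cases "(x(j := y)) \<in> words n (I - {i})")
      case True
      then show ?thesis using ij by (simp add: marginal_def fun_upd_twist)
    next
      case False
      have "(x(j := y))(i := n) = x(j := y)" using ij True by auto
      then have "(x(j := y))(i := z) \<notin> words n I" for z
        using False upd_words[OF assms(1), of "x(j := y)" z n] by simp
      then have "f ((x(j := y))(i := z)) = 0" for z using assms(4) by (auto simp: word_space_def)
      then show ?thesis using False ij by (simp add: marginal_def fun_upd_twist)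
    qed
    have "(\<Sum>y<n. marginal n I i f (x(j := y))) = (\<Sum>z<n. \<Sum>y<n. f ((x(i := z))(j := y)))"
      unfolding * by (rule sum.swap)
    then show ?thesis using assms(4) j by (simp add: word_space_def)
  next
    case False
    then have "x(j := y) \<notin> words n (I - {i})" for y using ij by (auto simp: words_def)
    then show ?thesis by (simp add: marginal_def)
  qed
qed

lemma marginal_inflate:
  assumes "i \<in> I" "f \<in> word_space n (I - {i}) J"
  shows "marginal n I i (inflate n I i f) = cscale (of_nat n) f"
proof
  fix x
  show "marginal n I i (inflate n I i f) x = cscale (of_nat n) f x"
  proof (cases "x \<in> words n (I - {i})")
    case True
    then have "inflate n I i f (x(i := y)) = f x" if "y < n" for y
      using that upd_words[OF assms(1), of x y n] upd_self_word[OF True] by (simp add: inflate_def)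
    then show ?thesis using True by (simp add: marginal_def cscale_def)
  next
    case False
    then show ?thesis using assms(2) by (simp add: marginal_def word_space_def cscale_def)
  qed
qed

lemma word_space_insert:
  assumes "i \<in> I"
  shows "word_space n I (insert i J) = {f \<in> word_space n I J. marginal n I i f = 0}"
proof -
  have "marginal n I i f = 0 \<longleftrightarrow> (\<forall>x. (\<Sum>y<n. f (x(i := y))) = 0)" if "f \<in> word_space n I J" for f
  proof
    assume m: "marginal n I i f = 0"
    show "\<forall>x. (\<Sum>y<n. f (x(i := y))) = 0"
    proof
      fix x
      show "(\<Sum>y<n. f (x(i := y))) = 0"
      proof (cases "x(i := n) \<in> words n (I - {i})")
        case True
        then show ?thesis using fun_cong[OF m, of "x(i := n)"] by (simp add: marginal_def)
      next
        case False
        then have "x(i := y) \<notin> words n I" for y using upd_words[OF assms] by blast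
        then show ?thesis using that by (simp add: word_space_def)
      qed
    qed
  qed (simp add: marginal_def fun_eq_iff)
  then show ?thesis by (auto simp: word_space_def)
qed

lemma inflate_equivariant:
  assumes "p permutes {..<n}"
  shows "inflate n I i (word_act p f) = word_act p (inflate n I i f)"
proof
  fix x
  have p: "inv p permutes {..<n}" using assms by (rule permutes_inv)
  then have "inv p n = n" by (simp add: permutes_def)
  then have "inv p \<circ> x(i := n) = (inv p \<circ> x)(i := n)" by auto
  then show "inflate n I i (word_act p f) x = word_act p (inflate n I i f) x"
    by (simp add: inflate_def fun_act_def permutes_word[OF p])
qed

lemma marginal_equivariant:
  assumes "p permutes {..<n}"
  shows "marginal n I i (word_act p f) = word_act p (marginal n I i f)"
proof
  fix x
  have p: "inv p permutes {..<n}" using assms by (rule permutes_inv)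
  have "(\<Sum>y<n. f (inv p \<circ> x(i := y))) = (\<Sum>y<n. f ((inv p \<circ> x)(i := inv p y)))"
    by (intro sum.cong arg_cong[of _ _ f]) auto
  also have "\<dots> = (\<Sum>y<n. f ((inv p \<circ> x)(i := y)))"
    using sum.permute[OF p, of "\<lambda>y. f ((inv p \<circ> x)(i := y))"] by (simp add: comp_def)
  finally show "marginal n I i (word_act p f) x = word_act p (marginal n I i f) x"
    by (simp add: marginal_def fun_act_def permutes_word[OF p])
qed

lemma inflate_add: "inflate n I i (f + g) = inflate n I i f + inflate n I i g"
  and inflate_scale: "inflate n I i (cscale c f) = cscale c (inflate n I i f)"
  and inflate_zero: "inflate n I i 0 = 0"
  by (auto simp: inflate_def cscale_def fun_eq_iff)

lemma marginal_add: "marginal n I i (f + g) = marginal n I i f + marginal n I i g"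
  and marginal_scale: "marginal n I i (cscale c f) = cscale c (marginal n I i f)"
  and marginal_zero: "marginal n I i 0 = 0"
  by (auto simp: marginal_def cscale_def fun_eq_iff sum.distrib sum_distrib_left)

lemma Sn_hom_post_compose:
  assumes F: "F \<in> Sn_hom n U \<rho> V \<sigma>"
    and "\<And>v. v \<in> V \<Longrightarrow> L v \<in> X"
    and "\<And>v w. L (v + w) = L v + L w" "\<And>c v. L (cscale c v) = cscale c (L v)"
    and "\<And>p v. p permutes {..<n} \<Longrightarrow> L (\<sigma> p v) = \<tau> p (L v)" 
  shows "(\<lambda>u. L (F u)) \<in> Sn_hom n U \<rho> X \<tau>"
proof -
  have "L 0 = 0" using assms(4)[of 0 0] by simp
  then show ?thesis using assms unfolding Sn_hom_def by simp
qed

lemma word_hom_marginal: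
  assumes "i \<in> I" "i \<notin> J" "J \<subseteq> I" "F \<in> word_hom n U \<rho> I J"
  shows "(\<lambda>u. marginal n I i (F u)) \<in> word_hom n U \<rho> (I - {i}) J"
  unfolding word_hom_def
  by (rule Sn_hom_post_compose[OF assms(4)[unfolded word_hom_def]])
    (blast intro: marginal_word_space[OF assms(1-3)] marginal_equivariant marginal_scale marginal_add)+

lemma word_hom_inflate:
  assumes "i \<in> I" "i \<notin> J" "J \<subseteq> I" "F \<in> word_hom n U \<rho> (I - {i}) J"
  shows "(\<lambda>u. inflate n I i (F u)) \<in> word_hom n U \<rho> I J"
  unfolding word_hom_def
  by (rule Sn_hom_post_compose[OF assms(4)[unfolded word_hom_def]])
    (blast intro: inflate_word_space[OF assms(1-3)] inflate_equivariant inflate_scale inflate_add)+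

text \<open>The summation over coordinate \<open>i\<close> is an equivariant surjection that is split by \<open>inflate\<close>, and its
  kernel consists of the maps with vanishing coordinate sum at \<open>i\<close>.\<close>

lemma dim_word_hom_insert:
  assumes n: "n > 0" and iIJ: "i \<in> I" "i \<notin> J" "J \<subseteq> I"
    and fin: "finite S" "word_hom n U \<rho> I J \<subseteq> maps.span S"
  shows "maps.dim (word_hom n U \<rho> I J) =
    maps.dim (word_hom n U \<rho> I (insert i J)) + maps.dim (word_hom n U \<rho> (I - {i}) J)"
proof -
  let ?H = "word_hom n U \<rho> I J" and ?A = "word_hom n U \<rho> I (insert i J)"
    and ?H' = "word_hom n U \<rho> (I - {i}) J"
  define \<iota> :: "(('a \<Rightarrow> complex) \<Rightarrow> (nat \<Rightarrow> nat) \<Rightarrow> complex) \<Rightarrow> _" where "\<iota> F = (\<lambda>u. inflate n I i (F u))" for F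
  define \<mu> :: "(('a \<Rightarrow> complex) \<Rightarrow> (nat \<Rightarrow> nat) \<Rightarrow> complex) \<Rightarrow> _" where "\<mu> F = (\<lambda>u. marginal n I i (F u))" for F
  have lin: "Vector_Spaces.linear map_scale map_scale \<iota>"
    unfolding Vector_Spaces.linear_iff
    by (intro conjI maps.vector_space_axioms) (auto simp: \<iota>_def inflate_add inflate_scale map_scale_def fun_eq_iff)
  have mi: "\<mu> (\<iota> F) = map_scale (of_nat n) F" if F: "F \<in> ?H'" for F
  proof
    fix u
    have "F u \<in> word_space n (I - {i}) J"
    proof (cases "u \<in> U")
      case False
      then have "F u = 0" using F by (simp add: word_hom_def Sn_hom_def)
      then show ?thesis using fn.subspace_0[OF word_space_subspace] by simp
    qed (use F in \<open>simp add: word_hom_def Sn_hom_def\<close>)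
    then show "\<mu> (\<iota> F) u = map_scale (of_nat n) F u"
      using marginal_inflate[OF iIJ(1)] by (simp add: \<mu>_def \<iota>_def map_scale_def)
  qed
  have inj: "inj_on \<iota> ?H'"
  proof (rule inj_onI)
    fix F G assume "F \<in> ?H'" "G \<in> ?H'" "\<iota> F = \<iota> G"
    then have "map_scale (of_nat n) F = map_scale (of_nat n) G" using mi by metis
    then show "F = G" using n by simp
  qed
  have A: "F \<in> ?A \<longleftrightarrow> F \<in> ?H \<and> \<mu> F = 0" for F
  proof
    assume F: "F \<in> ?A"
    then have "\<mu> F u = 0" for u
      unfolding word_hom_def Sn_hom_def \<mu>_def word_space_insert[OF iIJ(1)]
      by (cases "u \<in> U") (simp_all add: marginal_zero)
    then show "F \<in> ?H \<and> \<mu> F = 0" using F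
      unfolding word_hom_def Sn_hom_def word_space_insert[OF iIJ(1)] by (simp add: fun_eq_iff)
  next
    assume "F \<in> ?H \<and> \<mu> F = 0"
    then show "F \<in> ?A"
      unfolding word_hom_def Sn_hom_def word_space_insert[OF iIJ(1)] \<mu>_def by (auto dest: fun_cong)
  qed
  have \<iota>H: "\<iota> F \<in> ?H" if "F \<in> ?H'" for F
    using word_hom_inflate[OF iIJ that] by (simp add: \<iota>_def)
  have subB: "maps.subspace (\<iota> ` ?H')"
    using Vector_Spaces.linear.axioms(3)[OF lin] word_hom_subspace by (rule module_hom.subspace_image)
  have inter: "?A \<inter> \<iota> ` ?H' = {0}"
  proof (intro subset_antisym subsetI)
    fix F assume "F \<in> ?A \<inter> \<iota> ` ?H'"
    then obtain G where G: "G \<in> ?H'" "F = \<iota> G" "\<mu> F = 0" using A by auto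
    then have "G = 0" using mi[OF G(1)] n by simp
    then show "F \<in> {0}" using G by (simp add: \<iota>_def inflate_zero fun_eq_iff) (simp add: inflate_def)
  next
    fix F :: "('a \<Rightarrow> complex) \<Rightarrow> (nat \<Rightarrow> nat) \<Rightarrow> complex" assume "F \<in> {0}"
    then show "F \<in> ?A \<inter> \<iota> ` ?H'"
      using maps.subspace_0[OF subB] maps.subspace_0[OF word_hom_subspace] by auto
  qed
  have sum: "?H = {a + b | a b. a \<in> ?A \<and> b \<in> \<iota> ` ?H'}"
  proof (intro subset_antisym subsetI)
    fix F assume F: "F \<in> ?H"
    define G where "G = map_scale (inverse (of_nat n)) (\<mu> F)"
    have G: "G \<in> ?H'" unfolding G_def \<mu>_def
      using word_hom_marginal[OF iIJ F] by (rule maps.subspace_scale[OF word_hom_subspace])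
    have "\<mu> (F - \<iota> G) = \<mu> F - \<mu> (\<iota> G)"
    proof -
      have "\<mu> (X + Y) = \<mu> X + \<mu> Y" for X Y by (simp add: \<mu>_def marginal_add fun_eq_iff)
      from this[of "F - \<iota> G" "\<iota> G"] show ?thesis by (simp add: algebra_simps)
    qed
    also have "\<dots> = 0" using mi[OF G] n by (simp add: G_def)
    finally have "F - \<iota> G \<in> ?A"
      using A maps.subspace_diff[OF word_hom_subspace F \<iota>H[OF G]] by blast
    then show "F \<in> {a + b | a b. a \<in> ?A \<and> b \<in> \<iota> ` ?H'}"
      using imageI[OF G, of \<iota>] by (intro CollectI exI[of _ "F - \<iota> G"] exI[of _ "\<iota> G"]) simp
  next
    fix F assume "F \<in> {a + b | a b. a \<in> ?A \<and> b \<in> \<iota> ` ?H'}"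
    then obtain a b where "F = a + b" "a \<in> ?H" "b \<in> ?H" using A \<iota>H by auto
    then show "F \<in> ?H" using maps.subspace_add[OF word_hom_subspace] by blast
  qed
  have "maps.dim ?H = maps.dim ?A + maps.dim (\<iota> ` ?H')"
    using maps.dim_direct_sum[OF word_hom_subspace subB inter sum fin] .
  also have "maps.dim (\<iota> ` ?H') = maps.dim ?H'"
    by (rule dim_injective_image[OF lin word_hom_subspace inj])
  finally show ?thesis .
qed

section \<open>Polytabloids and the Garnir relations\<close>

lemma of_int_sign_mult_self: "of_int (sign p) * of_int (sign p) = (1 :: complex)"
  by (metis of_int_1 of_int_mult sign_idempotent)

lemma permutation_of_permutes: "p permutes {..<n} \<Longrightarrow> permutation p" for n :: nat
  by (rule permutes_imp_permutation) auto

lemma tabloid_act_tabloid_of: "tabloid_act q (tabloid_of \<nu> s) = tabloid_of \<nu> (q \<circ> s)"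
  by (simp add: tabloid_act_def tabloid_of_def image_comp)

lemma tabloid_act_inv_eq_iff:
  assumes "q permutes A"
  shows "tabloid_act (inv q) T = T' \<longleftrightarrow> T = tabloid_act q T'"
proof -
  have "q ` inv q ` X = X" "inv q ` q ` X = X" for X
    using permutes_inverses[OF assms] by (simp_all add: image_image)
  then have "map ((`) q \<circ> (`) (inv q)) T = T" "map ((`) (inv q) \<circ> (`) q) T' = T'"
    by (simp_all add: comp_def)
  then show ?thesis unfolding tabloid_act_def by (metis map_map)
qed

lemma sum_fun_apply: "(\<Sum>i\<in>A. f i) x = (\<Sum>i\<in>A. f i x)"
  for f :: "'i \<Rightarrow> 'x \<Rightarrow> 'b :: comm_monoid_add"
  by (induction A rule: infinite_finite_induct) auto

text \<open>One tableau \<open>t\<close> is fixed throughout. It identifies the points of \<open>{..<n}\<close> with the cells of the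
  diagram, so that tabloids, column permutations and labellings are all expressed through the row
  and the column of a point.\<close>

locale numbered_diagram =
  fixes \<nu> :: "nat list" and n :: nat and t :: "nat \<times> nat \<Rightarrow> nat"
  assumes part: "partition_of \<nu> n" and tab: "tableau \<nu> t"
begin

definition row :: "nat \<Rightarrow> nat" where "row y = fst (inv_into (diagram \<nu>) t y)"
definition col :: "nat \<Rightarrow> nat" where "col y = snd (inv_into (diagram \<nu>) t y)"

abbreviation C :: "(nat \<Rightarrow> nat) set" where "C \<equiv> column_stabilizer \<nu> t"
abbreviation e :: "tabloid \<Rightarrow> complex" where "e \<equiv> polytabloid \<nu> t"

lemma size_eq [simp]: "sum_list \<nu> = n"
  using part by (simp add: partition_of_def)

lemma tab_bij: "bij_betw t (diagram \<nu>) {..<n}"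
  using tab by (simp add: tableau_def)

lemma cell_of: "y < n \<Longrightarrow> (row y, col y) \<in> diagram \<nu>" "y < n \<Longrightarrow> t (row y, col y) = y"
proof -
  assume "y < n"
  then have "y \<in> t ` diagram \<nu>" using tab_bij by (simp add: bij_betw_def)
  then show "(row y, col y) \<in> diagram \<nu>" "t (row y, col y) = y"
    unfolding row_def col_def prod.collapse by (rule inv_into_into, rule f_inv_into_f)
qed

lemma entry: "(r, c) \<in> diagram \<nu> \<Longrightarrow> t (r, c) < n" "(r, c) \<in> diagram \<nu> \<Longrightarrow> row (t (r, c)) = r"
  "(r, c) \<in> diagram \<nu> \<Longrightarrow> col (t (r, c)) = c"
  using tab_bij by (auto simp: row_def col_def bij_betw_def)

lemma cell_inj: "y < n \<Longrightarrow> z < n \<Longrightarrow> row y = row z \<Longrightarrow> col y = col z \<Longrightarrow> y = z"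
  using cell_of(2) by metis

lemma row_less_length: "y < n \<Longrightarrow> row y < length \<nu>"
  using cell_of(1)[of y] by (simp add: diagram_def)

lemma diagram_down_closed: "(r, c) \<in> diagram \<nu> \<Longrightarrow> r' \<le> r \<Longrightarrow> c' \<le> c \<Longrightarrow> (r', c') \<in> diagram \<nu>"
proof -
  assume *: "(r, c) \<in> diagram \<nu>" "r' \<le> r" "c' \<le> c"
  then have r: "r < length \<nu>" "c < \<nu> ! r" by (auto simp: diagram_def)
  have "\<nu> ! r \<le> \<nu> ! r'"
    using part r(1) * sorted_wrt_nth_less[of "(\<ge>)" \<nu> r' r] by (cases "r' = r") (auto simp: partition_of_def)
  then show ?thesis using * r by (auto simp: diagram_def)
qed

lemma column_entries: "t ` {c \<in> diagram \<nu>. snd c = j} = {y. y < n \<and> col y = j}"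
proof (intro subset_antisym subsetI)
  fix y assume "y \<in> {y. y < n \<and> col y = j}"
  then show "y \<in> t ` {c \<in> diagram \<nu>. snd c = j}"
    using cell_of[of y] by (intro image_eqI[of _ _ "(row y, col y)"]) auto
qed (use entry in auto)

lemma row_entries: "t ` {c \<in> diagram \<nu>. fst c = i} = {y. y < n \<and> row y = i}"
proof (intro subset_antisym subsetI)
  fix y assume "y \<in> {y. y < n \<and> row y = i}"
  then show "y \<in> t ` {c \<in> diagram \<nu>. fst c = i}"
    using cell_of[of y] by (intro image_eqI[of _ _ "(row y, col y)"]) auto
qed (use entry in auto)

lemma column_stabilizer_iff: "p \<in> C \<longleftrightarrow> p permutes {..<n} \<and> (\<forall>y<n. col (p y) = col y)"
proof
  assume p: "p \<in> C"
  then have "p ` {y. y < n \<and> col y = j} = {y. y < n \<and> col y = j}" for j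
    unfolding column_stabilizer_def column_entries by simp
  then show "p permutes {..<n} \<and> (\<forall>y<n. col (p y) = col y)"
    using p unfolding column_stabilizer_def by auto
next
  assume *: "p permutes {..<n} \<and> (\<forall>y<n. col (p y) = col y)"
  then have p: "p permutes {..<n}" by simp
  have pn: "p y < n \<longleftrightarrow> y < n" for y using permutes_in_image[OF p, of y] by simp
  have "p ` {y. y < n \<and> col y = j} = {y. y < n \<and> col y = j}" for j
  proof (rule card_subset_eq)
    show "p ` {y. y < n \<and> col y = j} \<subseteq> {y. y < n \<and> col y = j}" using * pn by auto
    show "card (p ` {y. y < n \<and> col y = j}) = card {y. y < n \<and> col y = j}"
      by (intro card_image permutes_inj_on[OF p])
  qed simp
  then show "p \<in> C" unfolding column_stabilizer_def column_entries using p by simp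
qed

lemma column_stabilizer_permutes: "p \<in> C \<Longrightarrow> p permutes {..<n}"
  by (simp add: column_stabilizer_iff)

lemma column_stabilizer_inv: assumes "p \<in> C" shows "inv p \<in> C"
proof -
  have p: "p permutes {..<n}" using assms by (rule column_stabilizer_permutes)
  have "inv p y < n" if "y < n" for y using that permutes_in_image[OF permutes_inv[OF p], of y] by simp
  then have "col (inv p y) = col y" if "y < n" for y
    using that assms permutes_inverses(1)[OF p, of y] by (metis column_stabilizer_iff)
  then show ?thesis using permutes_inv[OF p] by (simp add: column_stabilizer_iff)
qed

lemma column_stabilizer_comp: assumes "p \<in> C" "q \<in> C" shows "p \<circ> q \<in> C"
proof -
  have p: "p permutes {..<n}" and q: "q permutes {..<n}" using assms column_stabilizer_permutes by auto
  have "q y < n" if "y < n" for y using that permutes_in_image[OF q, of y] by simp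
  then show ?thesis using assms permutes_compose[OF q p] by (simp add: column_stabilizer_iff)
qed

lemma column_swap: "y < n \<Longrightarrow> z < n \<Longrightarrow> col y = col z \<Longrightarrow> transpose y z \<in> C"
  unfolding column_stabilizer_iff
  by (auto simp: permutes_swap_id transpose_def)

lemma finite_column_stabilizer: "finite C"
  by (rule finite_subset[OF _ finite_permutations[of "{..<n}"]]) (auto simp: column_stabilizer_permutes)

lemma tabloid_of_comp: "tabloid_of \<nu> (p \<circ> t) = map (\<lambda>i. p ` {y. y < n \<and> row y = i}) [0..<length \<nu>]"
  unfolding tabloid_of_def image_comp[symmetric] row_entries ..

text \<open>After moving \<open>t\<close> by \<open>p\<close>, the point \<open>y\<close> sits in the cell that \<open>inv p y\<close> occupied before.\<close>

lemma tabloid_of_eq_iff: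
  assumes p: "p permutes {..<n}" and q: "q permutes {..<n}"
  shows "tabloid_of \<nu> (p \<circ> t) = tabloid_of \<nu> (q \<circ> t) \<longleftrightarrow> (\<forall>y<n. row (inv p y) = row (inv q y))"
proof -
  have img: "p ` {y. y < n \<and> row y = i} = {y. y < n \<and> row (inv p y) = i}" if p: "p permutes {..<n}" for p i
  proof (intro subset_antisym subsetI)
    fix y assume "y \<in> {y. y < n \<and> row (inv p y) = i}"
    then show "y \<in> p ` {y. y < n \<and> row y = i}"
      using permutes_in_image[OF permutes_inv[OF p], of y] permutes_inverses(1)[OF p]
      by (intro image_eqI[of _ _ "inv p y"]) auto
  qed (use permutes_in_image[OF p] permutes_inverses(2)[OF p] in auto)
  have lt: "row (inv p y) < length \<nu>" if "y < n" for y
    using that permutes_in_image[OF permutes_inv[OF p], of y] by (simp add: row_less_length)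
  have "tabloid_of \<nu> (p \<circ> t) = tabloid_of \<nu> (q \<circ> t) \<longleftrightarrow>
      (\<forall>i<length \<nu>. {y. y < n \<and> row (inv p y) = i} = {y. y < n \<and> row (inv q y) = i})"
    unfolding tabloid_of_comp img[OF p] img[OF q] by (simp add: Ball_def)
  also have "\<dots> \<longleftrightarrow> (\<forall>y<n. row (inv p y) = row (inv q y))"
  proof (intro iffI allI impI)
    fix y assume *: "\<forall>i<length \<nu>. {y. y < n \<and> row (inv p y) = i} = {y. y < n \<and> row (inv q y) = i}" and y: "y < n"
    have "y \<in> {z. z < n \<and> row (inv p z) = row (inv p y)}" using y by simp
    also have "\<dots> = {z. z < n \<and> row (inv q z) = row (inv p y)}" using * lt[OF y] by blast
    finally show "row (inv p y) = row (inv q y)" by simp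
  qed auto
  finally show ?thesis .
qed

lemma polytabloid_shift:
  assumes q: "q permutes {..<n}"
  shows "polytabloid \<nu> (q \<circ> t) = specht_act q e"
proof
  fix T
  let ?\<delta> = "\<lambda>p. if T = tabloid_of \<nu> (p \<circ> (q \<circ> t)) then 1 else (0 :: complex)"
  have conj: "bij_betw (\<lambda>p. q \<circ> p \<circ> inv q) C (column_stabilizer \<nu> (q \<circ> t))"
  proof (rule bij_betw_byWitness[where f' = "\<lambda>p. inv q \<circ> p \<circ> q"])
    have qq: "q (inv q y) = y" "inv q (q y) = y" for y using permutes_inverses[OF q] by auto
    show "\<forall>p\<in>C. inv q \<circ> (q \<circ> p \<circ> inv q) \<circ> q = p"
      "\<forall>p\<in>column_stabilizer \<nu> (q \<circ> t). q \<circ> (inv q \<circ> p \<circ> q) \<circ> inv q = p"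
      by (auto simp: qq fun_eq_iff)
    have im: "q ` inv q ` X = X" "inv q ` q ` X = X" for X by (simp_all add: image_image qq)
    have conj_image: "(q \<circ> p \<circ> inv q) ` (q \<circ> t) ` X = q ` p ` t ` X"
      "(inv q \<circ> p \<circ> q) ` t ` X = inv q ` p ` (q \<circ> t) ` X" for p X
      unfolding image_comp[symmetric] im by (rule refl)+
    have inv_image: "inv q ` (q \<circ> t) ` X = t ` X" for X unfolding image_comp[symmetric] im ..
    show "(\<lambda>p. q \<circ> p \<circ> inv q) ` C \<subseteq> column_stabilizer \<nu> (q \<circ> t)"
    proof (rule image_subsetI)
      fix p assume "p \<in> C"
      then show "q \<circ> p \<circ> inv q \<in> column_stabilizer \<nu> (q \<circ> t)"
        unfolding column_stabilizer_def mem_Collect_eq conj_image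
        using q by (auto simp: image_comp[symmetric, of q t] intro: permutes_compose permutes_inv)
    qed
    show "(\<lambda>p. inv q \<circ> p \<circ> q) ` column_stabilizer \<nu> (q \<circ> t) \<subseteq> C"
    proof (rule image_subsetI)
      fix p assume "p \<in> column_stabilizer \<nu> (q \<circ> t)"
      then show "inv q \<circ> p \<circ> q \<in> C"
        unfolding column_stabilizer_def mem_Collect_eq conj_image
        using q by (intro conjI permutes_compose permutes_inv) (simp_all only: inv_image simp_thms size_eq)
    qed
  qed
  have sgn: "sign (q \<circ> p \<circ> inv q) = sign p" if "p \<in> C" for p
  proof -
    have "permutation q" "permutation p" using q column_stabilizer_permutes[OF that] permutation_of_permutes by auto
    then show ?thesis
      by (simp add: sign_compose permutation_compose permutation_inverse sign_inverse)
  qed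
  have "polytabloid \<nu> (q \<circ> t) T = (\<Sum>p\<in>C. of_int (sign (q \<circ> p \<circ> inv q)) * ?\<delta> (q \<circ> p \<circ> inv q))"
    unfolding polytabloid_def by (rule sum.reindex_bij_betw[OF conj, symmetric])
  also have "\<dots> = (\<Sum>p\<in>C. of_int (sign p) * (if tabloid_act (inv q) T = tabloid_of \<nu> (p \<circ> t) then 1 else 0))"
  proof (rule sum.cong[OF refl])
    fix p assume p: "p \<in> C"
    have "(q \<circ> p \<circ> inv q) \<circ> (q \<circ> t) = q \<circ> (p \<circ> t)"
      using permutes_inverses(2)[OF q] by (simp add: fun_eq_iff)
    then show "of_int (sign (q \<circ> p \<circ> inv q)) * ?\<delta> (q \<circ> p \<circ> inv q) =
      of_int (sign p) * (if tabloid_act (inv q) T = tabloid_of \<nu> (p \<circ> t) then 1 else 0)"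
      unfolding sgn[OF p] tabloid_act_inv_eq_iff[OF q] tabloid_act_tabloid_of by simp
  qed
  finally show "polytabloid \<nu> (q \<circ> t) T = specht_act q e T"
    by (simp add: fun_act_def polytabloid_def)
qed

lemma specht_act_polytabloid:
  assumes q: "q permutes {..<n}"
  shows "specht_act q e T = (\<Sum>p\<in>C. of_int (sign p) * (if T = tabloid_of \<nu> (q \<circ> p \<circ> t) then 1 else 0))"
  unfolding fun_act_def polytabloid_def tabloid_act_inv_eq_iff[OF q] tabloid_act_tabloid_of comp_assoc ..

lemma polytabloid_antisymmetric:
  assumes q: "q \<in> C"
  shows "specht_act q e = cscale (of_int (sign q)) e"
proof
  fix T
  let ?\<delta> = "\<lambda>p. if T = tabloid_of \<nu> (p \<circ> t) then 1 else (0 :: complex)"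
  have qp: "q permutes {..<n}" by (rule column_stabilizer_permutes[OF q])
  have "cscale (of_int (sign q)) e T = (\<Sum>p\<in>C. of_int (sign q) * (of_int (sign p) * ?\<delta> p))"
    by (simp add: cscale_def polytabloid_def sum_distrib_left)
  also have "\<dots> = (\<Sum>p\<in>C. of_int (sign q) * (of_int (sign (q \<circ> p)) * ?\<delta> (q \<circ> p)))"
  proof (rule sum.reindex_bij_betw[symmetric])
    show "bij_betw ((\<circ>) q) C C"
      using q permutes_inverses[OF qp]
      by (intro bij_betw_byWitness[where f' = "(\<circ>) (inv q)"])
        (auto simp: fun_eq_iff column_stabilizer_comp column_stabilizer_inv)
  qed
  also have "\<dots> = (\<Sum>p\<in>C. of_int (sign p) * ?\<delta> (q \<circ> p))"
  proof (rule sum.cong[OF refl])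
    fix p assume "p \<in> C"
    then have "sign (q \<circ> p) = sign q * sign p"
      using qp column_stabilizer_permutes by (intro sign_compose permutation_of_permutes)
    then show "of_int (sign q) * (of_int (sign (q \<circ> p)) * ?\<delta> (q \<circ> p)) =
        of_int (sign p) * ?\<delta> (q \<circ> p)"
      using of_int_sign_mult_self[of q] by (simp add: mult.assoc[symmetric])
  qed
  finally show "specht_act q e T = cscale (of_int (sign q)) e T"
    by (simp add: specht_act_polytabloid[OF qp])
qed

text \<open>A column permutation keeps the points of \<open>Y\<close> inside the two columns. Since columns of a diagram do
  not get longer to the right, there are only as many rows available as the left column has cells,
  and two points of \<open>Y\<close> share a row.\<close>

lemma permuted_cells_in_column:
  assumes p: "p \<in> C" and jj: "j < j'" and Y: "Y \<subseteq> {y. y < n \<and> (col y = j \<or> col y = j')}"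
    and card: "card {y. y < n \<and> col y = j} < card Y"
  obtains y z where "y \<in> Y" "z \<in> Y" "y \<noteq> z" "row (inv p y) = row (inv p z)"
proof -
  have ip: "inv p \<in> C" by (rule column_stabilizer_inv[OF p])
  have lt: "inv p y < n" if "y < n" for y
    using that permutes_in_image[OF column_stabilizer_permutes[OF ip], of y] by simp
  have "(\<lambda>y. row (inv p y)) ` Y \<subseteq> row ` {y. y < n \<and> col y = j}"
  proof (rule image_subsetI)
    fix y assume "y \<in> Y"
    then have y: "y < n" "col (inv p y) = j \<or> col (inv p y) = j'"
      using Y ip by (auto simp: column_stabilizer_iff)
    then have "(row (inv p y), j) \<in> diagram \<nu>"
      using cell_of(1)[OF lt[OF y(1)]] diagram_down_closed[of "row (inv p y)" "col (inv p y)"] jj by auto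
    then show "row (inv p y) \<in> row ` {y. y < n \<and> col y = j}"
      using entry by (intro image_eqI[of _ _ "t (row (inv p y), j)"]) auto
  qed
  then have "card ((\<lambda>y. row (inv p y)) ` Y) \<le> card (row ` {y. y < n \<and> col y = j})"
    by (intro card_mono) auto
  also have "\<dots> \<le> card {y. y < n \<and> col y = j}" by (rule card_image_le) simp
  finally have "\<not> inj_on (\<lambda>y. row (inv p y)) Y" using card card_image by fastforce
  then show ?thesis using that by (auto simp: inj_on_def)
qed

text \<open>Expand the polytabloid into tabloids. By \<open>permuted_cells_in_column\<close> every tabloid that occurs is
  fixed by a transposition of two points of \<open>Y\<close>, and the alternating sum over the permutations of
  \<open>Y\<close> annihilates such a tabloid. The two columns need not be adjacent.\<close>

lemma garnir_relation:
  assumes jj: "j < j'" and Y: "Y \<subseteq> {y. y < n \<and> (col y = j \<or> col y = j')}"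
    and card: "card {y. y < n \<and> col y = j} < card Y"
  shows "(\<Sum>q | q permutes Y. cscale (of_int (sign q)) (specht_act q e)) = 0"
proof
  fix T
  let ?\<delta> = "\<lambda>p. if T = tabloid_of \<nu> (p \<circ> t) then 1 else (0 :: complex)"
  have fY: "finite Y" using Y by (rule finite_subset) auto
  have sub: "q permutes {..<n}" if "q permutes Y" for q using that
    by (rule permutes_subset) (use Y in auto)
  have inner: "(\<Sum>q | q permutes Y. of_int (sign q) * ?\<delta> (q \<circ> p)) = (0 :: complex)"
    (is "sum ?f _ = 0") if p: "p \<in> C" for p
  proof -
    obtain y z where yz: "y \<in> Y" "z \<in> Y" "y \<noteq> z" "row (inv p y) = row (inv p z)"
      using permuted_cells_in_column[OF p assms] .
    let ?\<tau> = "transpose y z"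
    have \<tau>Y: "?\<tau> permutes Y" using yz by (simp add: permutes_swap_id)
    have pp: "p permutes {..<n}" by (rule column_stabilizer_permutes[OF p])
    have "inv (?\<tau> \<circ> p) = inv p \<circ> ?\<tau>"
      using permutes_bij[OF \<tau>Y] permutes_bij[OF pp] by (simp add: o_inv_distrib)
    then have "tabloid_of \<nu> (?\<tau> \<circ> p \<circ> t) = tabloid_of \<nu> (p \<circ> t)"
      using yz by (subst tabloid_of_eq_iff[OF permutes_compose[OF pp sub[OF \<tau>Y]] pp])
        (auto simp: transpose_def)
    then have same: "tabloid_of \<nu> (q \<circ> ?\<tau> \<circ> p \<circ> t) = tabloid_of \<nu> (q \<circ> p \<circ> t)" for q
      by (metis comp_assoc tabloid_act_tabloid_of)
    have "sum ?f {q. q permutes Y} = (\<Sum>q | q permutes Y. ?f (q \<circ> ?\<tau>))"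
      by (rule sum_permutations_compose_right[OF \<tau>Y])
    also have "\<dots> = (\<Sum>q | q permutes Y. - ?f q)"
    proof (rule sum.cong[OF refl])
      fix q assume "q \<in> {q. q permutes Y}"
      then have "sign (q \<circ> ?\<tau>) = - sign q"
        using yz(3) fY by (simp add: sign_compose permutes_imp_permutation permutation_swap_id sign_swap_id)
      then show "?f (q \<circ> ?\<tau>) = - ?f q" using same by simp
    qed
    finally show ?thesis by (simp add: sum_negf)
  qed
  have "(\<Sum>q | q permutes Y. cscale (of_int (sign q)) (specht_act q e)) T =
      (\<Sum>q | q permutes Y. of_int (sign q) * specht_act q e T)"
    unfolding sum_fun_apply by (simp add: cscale_def)
  also have "\<dots> = (\<Sum>q | q permutes Y. \<Sum>p\<in>C. of_int (sign p) * (of_int (sign q) * ?\<delta> (q \<circ> p)))"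
    by (intro sum.cong refl) (simp add: specht_act_polytabloid sub sum_distrib_left mult_ac)
  also have "\<dots> = (\<Sum>p\<in>C. of_int (sign p) * (\<Sum>q | q permutes Y. of_int (sign q) * ?\<delta> (q \<circ> p)))"
    by (subst sum.swap) (simp add: sum_distrib_left)
  also have "\<dots> = 0" using inner by simp
  finally show "(\<Sum>q | q permutes Y. cscale (of_int (sign q)) (specht_act q e)) T = 0 T" by simp
qed

lemma polytabloid_specht: "e \<in> specht \<nu>"
  unfolding specht_def using tab by (intro fn.span_base) auto

abbreviation shifts :: "(tabloid \<Rightarrow> complex) set" where
  "shifts \<equiv> {specht_act q e | q. q permutes {..<n}}"

text \<open>Every tableau is a permutation of \<open>t\<close>, so the Specht module is generated by a single polytabloid
  and a homomorphism is determined by its value there.\<close>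

lemma specht_span: "specht \<nu> = fn.span shifts"
proof -
  have "{polytabloid \<nu> s | s. tableau \<nu> s} = shifts"
  proof (intro subset_antisym subsetI)
    fix v assume "v \<in> {polytabloid \<nu> s | s. tableau \<nu> s}"
    then obtain s where s: "tableau \<nu> s" "v = polytabloid \<nu> s" by auto
    define q where "q y = (if y < n then s (row y, col y) else y)" for y
    have sb: "bij_betw s (diagram \<nu>) {..<n}" using s by (simp add: tableau_def)
    have "bij_betw (inv_into (diagram \<nu>) t) {..<n} (diagram \<nu>)" by (rule bij_betw_inv_into[OF tab_bij])
    then have "bij_betw (s \<circ> inv_into (diagram \<nu>) t) {..<n} {..<n}" using sb by (rule bij_betw_trans)
    then have "bij_betw q {..<n} {..<n}"
      by (rule bij_betw_cong[THEN iffD1, rotated]) (simp add: q_def row_def col_def)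
    then have q: "q permutes {..<n}" by (rule bij_imp_permutes) (simp add: q_def)
    have agree: "s c = (q \<circ> t) c" if "c \<in> diagram \<nu>" for c
      using that entry[of "fst c" "snd c"] by (simp add: q_def)
    have im: "s ` {c \<in> diagram \<nu>. P c} = (q \<circ> t) ` {c \<in> diagram \<nu>. P c}" for P
      by (rule image_cong) (use agree in auto)
    have "tabloid_of \<nu> (p \<circ> s) = tabloid_of \<nu> (p \<circ> (q \<circ> t))" for p
      unfolding tabloid_of_def image_comp[symmetric, of p] im ..
    then have "polytabloid \<nu> s = polytabloid \<nu> (q \<circ> t)"
      unfolding polytabloid_def column_stabilizer_def im by simp
    then show "v \<in> shifts" using s q polytabloid_shift by auto
  next
    fix v assume "v \<in> shifts"
    then obtain q where q: "q permutes {..<n}" "v = specht_act q e" by auto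
    have "bij_betw (q \<circ> t) (diagram \<nu>) {..<n}"
      using bij_betw_trans[OF tab_bij permutes_imp_bij[OF q(1)]] .
    then show "v \<in> {polytabloid \<nu> s | s. tableau \<nu> s}"
      using q polytabloid_shift[OF q(1)] by (auto simp: tableau_def intro!: exI[of _ "q \<circ> t"])
  qed
  then show ?thesis unfolding specht_def by simp
qed

lemma specht_act_mem: "q permutes {..<n} \<Longrightarrow> specht_act q e \<in> specht \<nu>"
  unfolding specht_span by (rule fn.span_base) auto

lemma Sn_hom_eq_0_if_polytabloid:
  assumes F: "F \<in> Sn_hom n (specht \<nu>) specht_act V (fun_act a)" and Fe: "F e = 0"
  shows "F = 0"
proof
  fix u
  have add: "F (u + v) = F u + F v" and sc: "F (cscale c u) = cscale c (F u)"
    if "u \<in> specht \<nu>" "v \<in> specht \<nu>" for u v c using F that by (auto simp: Sn_hom_def)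
  show "F u = 0 u"
  proof (cases "u \<in> specht \<nu>")
    case True
    have "u \<in> specht \<nu> \<and> F u = 0" using True unfolding specht_span
    proof (induction rule: fn.span_induct_alt)
      case base
      show ?case by (intro conjI fn.span_zero Sn_hom_zero[OF F])
    next
      case (step c x y)
      then obtain q where q: "q permutes {..<n}" "x = specht_act q e" by auto
      have xs: "x \<in> specht \<nu>" using q specht_act_mem by simp
      have ys: "y \<in> specht \<nu>" using step specht_span by simp
      have "F x = fun_act a q (F e)" using F q polytabloid_specht by (simp add: Sn_hom_def)
      then have "F x = 0" using Fe by (simp add: fun_act_def fun_eq_iff)
      moreover have cs: "cscale c x \<in> specht \<nu>" using xs unfolding specht_def by (rule fn.span_scale)
      moreover have "cscale c x + y \<in> specht \<nu>" using cs ys unfolding specht_def by (rule fn.span_add)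
      moreover have "F (cscale c x + y) = 0"
        using add[OF cs ys] sc[OF xs xs] step \<open>F x = 0\<close> by (simp add: fun_eq_iff)
      ultimately show ?case unfolding specht_span by blast
    qed
    then show ?thesis by simp
  qed (use F in \<open>simp add: Sn_hom_def\<close>)
qed

lemma specht_act_closed:
  assumes q: "q permutes {..<n}" and v: "v \<in> specht \<nu>"
  shows "specht_act q v \<in> specht \<nu>"
  using v unfolding specht_span
proof (induction rule: fn.span_induct_alt)
  case base
  have "specht_act q 0 = 0" by (simp add: fun_act_def fun_eq_iff)
  then show ?case by (metis fn.span_zero)
next
  case (step c x y)
  then obtain p where p: "p permutes {..<n}" "x = specht_act p e" by auto
  have "specht_act q x = specht_act (q \<circ> p) e"
  proof
    fix T
    have "inv (q \<circ> p) = inv p \<circ> inv q"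
      using permutes_bij[OF q] permutes_bij[OF p(1)] by (simp add: o_inv_distrib)
    then show "specht_act q x T = specht_act (q \<circ> p) e T"
      using p by (simp add: fun_act_def tabloid_act_def image_comp comp_def)
  qed
  then have "specht_act q x \<in> fn.span shifts"
    using permutes_compose[OF p(1) q] by (auto intro: fn.span_base)
  then have "cscale c (specht_act q x) + specht_act q y \<in> fn.span shifts"
    using step by (intro fn.span_add fn.span_scale)
  moreover have "specht_act q (cscale c x + y) = cscale c (specht_act q x) + specht_act q y"
    by (simp add: fun_act_def cscale_def fun_eq_iff)
  ultimately show ?case by metis
qed

end

section \<open>Straightening\<close>

text \<open>Distinct values of a word receive distinct positive labels, which move along with the values under
  a permutation; unused points are labelled \<open>0\<close>.\<close>

definition label :: "nat set \<Rightarrow> (nat \<Rightarrow> nat) \<Rightarrow> nat \<Rightarrow> nat" where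
  "label I x y = (if \<exists>i\<in>I. x i = y then Suc (Min {i \<in> I. x i = y}) else 0)"

lemma label_pos_iff: "label I x y > 0 \<longleftrightarrow> (\<exists>i\<in>I. x i = y)"
  by (simp add: label_def)

lemma label_witness:
  assumes "finite I" "label I x y = Suc m"
  shows "m \<in> I" "x m = y"
proof -
  have "\<exists>i\<in>I. x i = y" using assms label_pos_iff[of I x y] by simp
  then have "{i \<in> I. x i = y} \<noteq> {}" by blast
  moreover have "m = Min {i \<in> I. x i = y}" using assms by (auto simp: label_def split: if_splits)
  ultimately have "m \<in> {i \<in> I. x i = y}" using Min_in[of "{i \<in> I. x i = y}"] assms(1) by simp
  then show "m \<in> I" "x m = y" by auto
qed

lemma label_inj: "finite I \<Longrightarrow> label I x y = label I x z \<Longrightarrow> label I x y > 0 \<Longrightarrow> y = z"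
  using label_witness[of I x y "label I x y - 1"] label_witness[of I x z "label I x z - 1"] by simp

lemma label_comp: "inj q \<Longrightarrow> label I (q \<circ> x) (q y) = label I x y"
  by (simp add: label_def inj_eq)

text \<open>Why an antisymmetric function on words vanishes if two unused points lie in the same column.\<close>

lemma swap_unlabelled:
  assumes "label I x y = 0" "label I x z = 0" "x \<in> words n I" "y < n" "z < n"
  shows "transpose y z \<circ> x = x"
proof
  fix i
  show "(transpose y z \<circ> x) i = x i"
  proof (cases "i \<in> I")
    case True
    then have "label I x (x i) \<noteq> 0" using label_pos_iff[of I x "x i"] by auto
    then have "x i \<noteq> y" "x i \<noteq> z" using assms by auto
    then show ?thesis by simp
  next
    case False
    then show ?thesis using assms by (simp add: words_def)
  qed
qed

lemma finite_maximizer: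
  fixes h :: "'a \<Rightarrow> int"
  assumes "finite A" "A \<noteq> {}"
  shows "\<exists>z\<in>A. \<forall>y\<in>A. h y \<le> h z"
proof -
  have "Max (h ` A) \<in> h ` A" using assms by (intro Max_in) auto
  then obtain z where "z \<in> A" "Max (h ` A) = h z" by auto
  then show ?thesis using assms(1) Max_ge[of "h ` A"] by (intro bexI[of _ z] ballI) simp_all
qed

lemma mult_add_less_if_sorted:
  fixes a b :: int
  assumes "a < b" "c < d" shows "a * c + b * d > a * d + b * c"
proof -
  have "(b - a) * (d - c) > 0" using assms by simp
  then show ?thesis by (simp add: algebra_simps)
qed

context numbered_diagram
begin

definition semistandard :: "nat set \<Rightarrow> (nat \<Rightarrow> nat) \<Rightarrow> bool" where
  "semistandard I x \<longleftrightarrow> x \<in> words n I \<and>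
     (\<forall>y<n. \<forall>z<n. col y = col z \<longrightarrow> row y < row z \<longrightarrow> label I x y < label I x z) \<and>
     (\<forall>y<n. \<forall>z<n. row y = row z \<longrightarrow> col y < col z \<longrightarrow> label I x y \<le> label I x z)"

lemma semistandard_column: "semistandard I x \<Longrightarrow> y < n \<Longrightarrow> z < n \<Longrightarrow> col y = col z \<Longrightarrow> row y < row z \<Longrightarrow>
    label I x y < label I x z"
  and semistandard_row: "semistandard I x \<Longrightarrow> y < n \<Longrightarrow> z < n \<Longrightarrow> row y = row z \<Longrightarrow> col y < col z \<Longrightarrow>
    label I x y \<le> label I x z"
  and semistandard_word: "semistandard I x \<Longrightarrow> x \<in> words n I"
  by (auto simp: semistandard_def)

definition moment :: "(nat \<Rightarrow> nat) \<Rightarrow> nat set \<Rightarrow> (nat \<Rightarrow> nat) \<Rightarrow> int" where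
  "moment h I x = (\<Sum>y<n. int (h y) * int (label I x y))"

lemma moment_comp:
  assumes q: "q permutes {..<n}"
  shows "moment h I (q \<circ> x) = (\<Sum>y<n. int (h (q y)) * int (label I x y))"
proof -
  have "moment h I (q \<circ> x) = (\<Sum>y<n. int (h (q y)) * int (label I (q \<circ> x) (q y)))"
    unfolding moment_def using sum.permute[OF q, of "\<lambda>y. int (h y) * int (label I (q \<circ> x) y)"]
    by (simp add: comp_def)
  then show ?thesis by (simp add: label_comp permutes_inj[OF q])
qed

text \<open>Among the words at which \<open>a\<close> does not vanish, choose one with the largest sum of
  column \<open>\<times>\<close> label and, among those, one with the largest sum of row \<open>\<times>\<close> label. If two cells of a
  column had labels in the wrong order, swapping them would increase the second sum; equal labels
  are both \<open>0\<close> and make \<open>a\<close> vanish. If two cells \<open>y\<close>, \<open>z\<close> of a row had labels in the wrong order,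
  take for \<open>Y\<close> the cells of the left column from \<open>y\<close> downwards and the cells of the right column
  from \<open>z\<close> upwards. All labels in the first group exceed all labels in the second, so every
  permutation of \<open>Y\<close> that is not a column permutation increases the first sum and contributes
  nothing to the Garnir relation. The column permutations all contribute the same value, which must
  therefore be \<open>0\<close>. So the chosen word is semistandard.\<close>

lemma straightening:
  assumes I: "finite I" and supp: "\<And>x. x \<notin> words n I \<Longrightarrow> a x = 0"
    and anti: "\<And>p x. p \<in> C \<Longrightarrow> a (p \<circ> x) = of_int (sign p) * a x"
    and garnir: "\<And>j j' Y x. j < j' \<Longrightarrow> Y \<subseteq> {y. y < n \<and> (col y = j \<or> col y = j')} \<Longrightarrow>
        card {y. y < n \<and> col y = j} < card Y \<Longrightarrow>
        (\<Sum>q | q permutes Y. of_int (sign q) * a (q \<circ> x)) = 0"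
    and ss: "\<And>x. semistandard I x \<Longrightarrow> a x = 0"
  shows "a x = (0 :: complex)"
proof (rule ccontr)
  assume "a x \<noteq> 0"
  define S where "S = {x. a x \<noteq> 0}"
  have "S \<subseteq> words n I" using supp by (auto simp: S_def)
  then have finS: "finite S" using finite_words[OF I] finite_subset by blast
  have "S \<noteq> {}" using \<open>a x \<noteq> 0\<close> by (auto simp: S_def)
  then obtain x1 where x1: "x1 \<in> S" "\<And>z. z \<in> S \<Longrightarrow> moment col I z \<le> moment col I x1"
    using finite_maximizer[OF finS, of "moment col I"] by auto
  define S1 where "S1 = {z \<in> S. moment col I z = moment col I x1}"
  have "finite S1" "S1 \<noteq> {}" using finS x1 by (auto simp: S1_def)
  then obtain x2 where x2: "x2 \<in> S1" "\<And>z. z \<in> S1 \<Longrightarrow> moment row I z \<le> moment row I x2"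
    using finite_maximizer[of S1 "moment row I"] by auto
  have ax: "a x2 \<noteq> 0" and mc: "moment col I x2 = moment col I x1" using x2 by (auto simp: S1_def S_def)
  have word: "x2 \<in> words n I" using ax supp by auto
  have max_col: "moment col I z \<le> moment col I x2" if "a z \<noteq> 0" for z
    using x1(2)[of z] that mc by (simp add: S_def)
  have max_row: "moment row I z \<le> moment row I x2" if "a z \<noteq> 0" "moment col I z = moment col I x2" for z
    using x2(2)[of z] that mc by (simp add: S_def S1_def)
  have column: "label I x2 y < label I x2 z" if yz: "y < n" "z < n" "col y = col z" "row y < row z" for y z
  proof (rule ccontr)
    assume "\<not> label I x2 y < label I x2 z"
    then consider "label I x2 y = label I x2 z" | "label I x2 z < label I x2 y" by linarith
    then show False
    proof cases
      case 1
      have "y \<noteq> z" using yz by auto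
      then have 0: "label I x2 y = 0" using label_inj[OF I 1] by auto
      have "a x2 = a (transpose y z \<circ> x2)" using swap_unlabelled[OF 0 _ word] 1 0 yz by simp
      also have "\<dots> = - a x2" using anti[OF column_swap[OF yz(1-3)]] \<open>y \<noteq> z\<close> by (simp add: sign_swap_id)
      finally show False using ax by simp
    next
      case 2
      let ?\<tau> = "transpose y z"
      have \<tau>: "?\<tau> permutes {..<n}" "?\<tau> \<in> C" using yz column_swap by (simp_all add: permutes_swap_id)
      have "a (?\<tau> \<circ> x2) \<noteq> 0" using anti[OF \<tau>(2)] ax by simp
      moreover have "moment col I (?\<tau> \<circ> x2) = moment col I x2"
        unfolding moment_comp[OF \<tau>(1)] unfolding moment_def
        using \<tau>(2) by (intro sum.cong refl) (simp add: column_stabilizer_iff)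
      ultimately have "moment row I (?\<tau> \<circ> x2) \<le> moment row I x2" by (rule max_row)
      moreover have "moment row I (?\<tau> \<circ> x2) > moment row I x2"
      proof -
        let ?f = "\<lambda>w. int (row w) * int (label I x2 w)" and ?g = "\<lambda>w. int (row (?\<tau> w)) * int (label I x2 w)"
        have "y \<noteq> z" using yz by auto
        have split: "{..<n} = {y, z} \<union> ({..<n} - {y, z})" using yz by auto
        have s: "sum h {..<n} = h y + h z + sum h ({..<n} - {y, z})" for h :: "nat \<Rightarrow> int"
          using \<open>y \<noteq> z\<close> by (subst split, subst sum.union_disjoint) auto
        have "sum ?f ({..<n} - {y, z}) = sum ?g ({..<n} - {y, z})"
          by (intro sum.cong refl) auto
        moreover have "?f y + ?f z < ?g y + ?g z"
          using mult_add_less_if_sorted[of "int (row y)" "int (row z)" "int (label I x2 z)" "int (label I x2 y)"] 2 yz by simp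
        ultimately show ?thesis unfolding moment_comp[OF \<tau>(1)] unfolding moment_def s[of ?f] s[of ?g] by simp
      qed
      ultimately show False by simp
    qed
  qed
  have rows: "label I x2 y \<le> label I x2 z" if yz: "y < n" "z < n" "row y = row z" "col y < col z" for y z
  proof (rule ccontr)
    assume viol: "\<not> label I x2 y \<le> label I x2 z"
    define A where "A = {u. u < n \<and> col u = col y \<and> row y \<le> row u}"
    define B where "B = {u. u < n \<and> col u = col z \<and> row u \<le> row z}"
    define Y where "Y = A \<union> B"
    let ?\<beta> = "label I x2 z"
    have AB: "A \<inter> B = {}" "finite A" "finite B" using yz by (auto simp: A_def B_def)
    have A_lab: "label I x2 u > ?\<beta>" if "u \<in> A" for u
    proof -
      have u: "u < n" "col y = col u" "row y \<le> row u" using that by (simp_all add: A_def)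
      have "label I x2 y \<le> label I x2 u"
      proof (cases "row y = row u")
        case True
        then show ?thesis using cell_inj[OF yz(1) u(1)] u(2) by simp
      next
        case False
        then show ?thesis using column[OF yz(1) u(1,2)] u(3) by simp
      qed
      then show ?thesis using viol by simp
    qed
    have B_lab: "label I x2 u \<le> ?\<beta>" if "u \<in> B" for u
    proof -
      have u: "u < n" "col u = col z" "row u \<le> row z" using that by (simp_all add: B_def)
      show ?thesis
      proof (cases "row u = row z")
        case True
        then show ?thesis using cell_inj[OF u(1) yz(2)] u(2) by simp
      next
        case False
        then show ?thesis using column[OF u(1) yz(2) u(2)] u(3) by simp
      qed
    qed
    have Y: "Y \<subseteq> {u. u < n \<and> (col u = col y \<or> col u = col z)}" by (auto simp: Y_def A_def B_def)
    have card: "card {u. u < n \<and> col u = col y} < card Y"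
    proof -
      let ?A' = "{u. u < n \<and> col u = col y \<and> row u < row y}"
      have "card {u. u < n \<and> col u = col y} = card (?A' \<union> A)" by (rule arg_cong[of _ _ card]) (auto simp: A_def)
      also have "\<dots> = card ?A' + card A" using AB by (intro card_Un_disjoint) (auto simp: A_def)
      finally have "card {u. u < n \<and> col u = col y} = card ?A' + card A" .
      moreover have "card ?A' \<le> card {..<row y}"
        using cell_inj by (intro card_inj_on_le[of row]) (auto simp: inj_on_def)
      moreover have "card {..row y} \<le> card B"
      proof (rule card_inj_on_le[of "\<lambda>r. t (r, col z)"])
        have d: "(r, col z) \<in> diagram \<nu>" if "r \<le> row y" for r
          using cell_of(1)[OF yz(2)] diagram_down_closed[of "row z" "col z" r "col z"] that yz by simp
        show "inj_on (\<lambda>r. t (r, col z)) {..row y}" using entry(2)[OF d] by (intro inj_onI) (metis atMost_iff)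
        show "(\<lambda>r. t (r, col z)) ` {..row y} \<subseteq> B" using entry[OF d] yz by (auto simp: B_def)
      qed (use AB in auto)
      moreover have "card Y = card A + card B" unfolding Y_def using AB by (intro card_Un_disjoint)
      ultimately show ?thesis by simp
    qed
    have fY: "finite Y" using AB by (simp add: Y_def)
    have perm: "q permutes {..<n}" if "q permutes Y" for q
      using that by (rule permutes_subset) (use Y in auto)
    have summand: "of_int (sign q) * a (q \<circ> x2) = (if q \<in> C then a x2 else 0)" if q: "q permutes Y" for q
    proof (cases "q \<in> C")
      case True
      then show ?thesis using anti[OF True] of_int_sign_mult_self[of q] by (simp add: mult.assoc[symmetric])
    next
      case False
      let ?d = "\<lambda>u. (int (col (q u)) - int (col u)) * (int (label I x2 u) - int ?\<beta>)"
      have qY: "q u \<in> Y" if "u \<in> Y" for u using that permutes_in_image[OF q] by simp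
      have colY: "col u = col y \<or> col u = col z" if "u \<in> Y" for u using that Y by auto
      have nonneg: "?d u \<ge> 0" if "u \<in> Y" for u
      proof (cases "u \<in> A")
        case True
        then show ?thesis using A_lab[OF True] colY[OF qY[OF that]] yz(4) by (auto simp: A_def)
      next
        case False
        then have "u \<in> B" using that by (simp add: Y_def)
        then show ?thesis using B_lab[of u] colY[OF qY[OF that]] yz(4) by (auto simp: B_def intro!: mult_nonpos_nonpos)
      qed
      \<comment> \<open>A permutation of \<open>Y\<close> that fixes the column of every point of \<open>A\<close> also fixes the columns of the points of \<open>B\<close>.\<close>
      have "\<exists>u\<in>A. col (q u) \<noteq> col u"
      proof (rule ccontr)
        assume "\<not> ?thesis"
        then have fixA: "col (q u) = col u" if "u \<in> A" for u using that by auto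
        have "q ` A \<subseteq> A"
        proof (rule image_subsetI)
          fix u assume u: "u \<in> A"
          then have "q u \<in> Y" "col (q u) = col y" using qY fixA by (auto simp: Y_def A_def)
          then show "q u \<in> A" using yz(4) by (auto simp: Y_def B_def)
        qed
        then have qA: "q ` A = A"
          using AB permutes_inj_on[OF q] by (intro card_subset_eq) (auto simp: card_image)
        have fixB: "col (q u) = col u" if "u \<in> B" for u
        proof -
          have "q u \<notin> A" using qA that AB permutes_inj[OF q] by (metis disjoint_iff imageE injD)
          then have "q u \<in> B" using qY[of u] that by (auto simp: Y_def)
          then show ?thesis using that by (simp add: B_def)
        qed
        have "col (q u) = col u" for u
          using fixA fixB permutes_not_in[OF q, of u] by (cases "u \<in> Y") (auto simp: Y_def)
        then have "q \<in> C" using perm[OF q] by (simp add: column_stabilizer_iff)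
        then show False using False by simp
      qed
      then obtain u where u: "u \<in> A" "col (q u) \<noteq> col u" by blast
      have "u \<in> Y" using u by (simp add: Y_def)
      moreover have "?d u \<noteq> 0" using u(2) A_lab[OF u(1)] by simp
      ultimately have pos: "?d u > 0" using nonneg[of u] by (simp only: less_le) auto
      have sumcol: "(\<Sum>u\<in>Y. int (col (q u)) - int (col u)) = 0"
        using sum.permute[OF q, of "\<lambda>u. int (col u)"] by (simp add: sum_subtractf comp_def)
      have "moment col I (q \<circ> x2) - moment col I x2 =
          (\<Sum>u<n. (int (col (q u)) - int (col u)) * int (label I x2 u))"
        unfolding moment_comp[OF perm[OF q]] unfolding moment_def
        by (simp add: sum_subtractf left_diff_distrib)
      also have "\<dots> = (\<Sum>u\<in>Y. (int (col (q u)) - int (col u)) * int (label I x2 u))"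
        using Y permutes_not_in[OF q] by (intro sum.mono_neutral_right) auto
      \<comment> \<open>As \<open>q\<close> permutes \<open>Y\<close>, all labels may be lowered by \<open>?\<beta>\<close>; then every summand is nonnegative.\<close>
      also have "\<dots> = sum ?d Y + (\<Sum>u\<in>Y. int (col (q u)) - int (col u)) * int ?\<beta>"
        unfolding sum_distrib_right sum.distrib[symmetric]
        by (intro sum.cong refl) (simp add: algebra_simps)
      also have "\<dots> = sum ?d Y" by (simp only: sumcol mult_zero_left add_0_right)
      also have "\<dots> > 0" using fY \<open>u \<in> Y\<close> pos by (rule sum_pos2) (rule nonneg)
      finally have "a (q \<circ> x2) = 0" using max_col[of "q \<circ> x2"] by linarith
      then show ?thesis using False by simp
    qed
    have "(\<Sum>q | q permutes Y. of_int (sign q) * a (q \<circ> x2)) = (\<Sum>q | q permutes Y. if q \<in> C then a x2 else 0)"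
      by (intro sum.cong refl summand) simp
    also have "\<dots> = of_nat (card {q. q permutes Y \<and> q \<in> C}) * a x2"
      using finite_permutations[OF fY] by (subst sum.inter_filter[symmetric]) auto
    finally have "of_nat (card {q. q permutes Y \<and> q \<in> C}) * a x2 = 0"
      using garnir[OF yz(4) Y card] by simp
    then have "card {q. q permutes Y \<and> q \<in> C} = 0" using ax by simp
    moreover have "id \<in> {q. q permutes Y \<and> q \<in> C}" by (simp add: column_stabilizer_iff)
    ultimately show False using finite_permutations[OF fY] by (simp add: card_eq_0_iff)
  qed
  have "semistandard I x2" using word column rows by (simp add: semistandard_def)
  then show False using ss ax by simp
qed

end

section \<open>Semistandard words index a basis of homomorphisms\<close>

context numbered_diagram
begin

text \<open>The base is so large that the weight compares words by the rows of their largest labels first.\<close>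

definition word_weight :: "nat set \<Rightarrow> (nat \<Rightarrow> nat) \<Rightarrow> nat" where
  "word_weight I x = (\<Sum>y<n. row y * Suc (n * length \<nu>) ^ label I x y)"

text \<open>The largest label \<open>v\<close> that is moved at all has to move up, because the larger labels below it in
  its column stay in place. The loss of at least one power of \<open>v\<close> outweighs all that the smaller
  labels can gain.\<close>

lemma word_weight_column_permutation:
  assumes x: "semistandard I x" and q: "q \<in> C" "q \<noteq> id"
  shows "(\<Sum>y<n. row (q y) * Suc (n * length \<nu>) ^ label I x y) < word_weight I x"
proof -
  let ?B = "Suc (n * length \<nu>)" and ?l = "label I x"
  have qp: "q permutes {..<n}" by (rule column_stabilizer_permutes[OF q(1)])
  have qn: "q y < n \<longleftrightarrow> y < n" for y using permutes_in_image[OF qp, of y] by simp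
  define D where "D = {y. y < n \<and> q y \<noteq> y}"
  have "D \<noteq> {}"
  proof
    assume "D = {}"
    then have "q y = y" for y using permutes_not_in[OF qp, of y] by (auto simp: D_def)
    then show False using q(2) by auto
  qed
  have finD: "finite D" "D \<subseteq> {..<n}" by (auto simp: D_def)
  define v where "v = Max (?l ` D)"
  have "v \<in> ?l ` D" unfolding v_def using finD \<open>D \<noteq> {}\<close> by (intro Max_in) auto
  then obtain y0 where y0: "y0 \<in> D" "?l y0 = v" by auto
  have le: "?l y \<le> v" if "y \<in> D" for y unfolding v_def using finD that by simp
  have up: "row (q y) < row y \<and> ?l (q y) < v" if y: "y \<in> D" "?l y = v" for y
  proof -
    have *: "y < n" "q y < n" "col (q y) = col y" "q y \<noteq> y"
      using y q(1) qn by (auto simp: D_def column_stabilizer_iff)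
    have "q y \<in> D" using * permutes_inj[OF qp] by (auto simp: D_def dest: injD)
    then have "\<not> ?l y < ?l (q y)" using le y(2) by fastforce
    then have "\<not> row y < row (q y)" using semistandard_column[OF x *(1,2)] * by auto
    moreover have "row y \<noteq> row (q y)" using cell_inj[OF *(1,2)] * by auto
    ultimately have r: "row (q y) < row y" by simp
    then show ?thesis using semistandard_column[OF x *(2,1,3)] y(2) by simp
  qed
  have v0: "v > 0" using up[OF y0] by simp
  define D1 where "D1 = {y \<in> D. ?l y = v}"
  define D2 where "D2 = {y \<in> D. ?l y < v}"
  have D12: "D = D1 \<union> D2" "D1 \<inter> D2 = {}" "finite D1" "finite D2" "D2 \<subseteq> {..<n}"
    using finD le by (force simp: D1_def D2_def)+
  have s1: "(\<Sum>y\<in>D1. row (q y) * ?B ^ ?l y) + ?B ^ v \<le> (\<Sum>y\<in>D1. row y * ?B ^ ?l y)"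
  proof -
    have "y0 \<in> D1" using y0 by (simp add: D1_def)
    then have "card D1 > 0" using D12(3) by (auto simp: card_gt_0_iff)
    then have "1 * ?B ^ v \<le> card D1 * ?B ^ v" by (intro mult_le_mono1) simp
    then have "?B ^ v \<le> (\<Sum>y\<in>D1. ?B ^ v)" by (simp only: sum_constant of_nat_id mult_1_left)
    then have "(\<Sum>y\<in>D1. row (q y) * ?B ^ ?l y) + ?B ^ v \<le> (\<Sum>y\<in>D1. row (q y) * ?B ^ ?l y + ?B ^ v)"
      by (simp only: sum.distrib add_le_cancel_left)
    also have "\<dots> \<le> (\<Sum>y\<in>D1. row y * ?B ^ ?l y)"
    proof (rule sum_mono)
      fix y assume "y \<in> D1"
      then have "Suc (row (q y)) \<le> row y" "?l y = v" using up[of y] by (auto simp: D1_def)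
      then have "Suc (row (q y)) * ?B ^ v \<le> row y * ?B ^ v" by (intro mult_le_mono1)
      then show "row (q y) * ?B ^ ?l y + ?B ^ v \<le> row y * ?B ^ ?l y"
        by (simp only: \<open>?l y = v\<close> mult_Suc add.commute)
    qed
    finally show ?thesis .
  qed
  have s2: "(\<Sum>y\<in>D2. row (q y) * ?B ^ ?l y) < ?B ^ v"
  proof -
    have "(\<Sum>y\<in>D2. row (q y) * ?B ^ ?l y) \<le> (\<Sum>y\<in>D2. length \<nu> * ?B ^ (v - 1))"
    proof (rule sum_mono)
      fix y assume y: "y \<in> D2"
      then have "row (q y) \<le> length \<nu>" using D12(5) qn row_less_length[of "q y"] by auto
      moreover have "?B ^ ?l y \<le> ?B ^ (v - 1)" using y by (intro power_increasing) (auto simp: D2_def)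
      ultimately show "row (q y) * ?B ^ ?l y \<le> length \<nu> * ?B ^ (v - 1)" by (rule mult_le_mono)
    qed
    also have "\<dots> = card D2 * (length \<nu> * ?B ^ (v - 1))" by simp
    also have "\<dots> \<le> n * (length \<nu> * ?B ^ (v - 1))"
      using card_mono[OF _ D12(5)] by (intro mult_le_mono1) simp
    also have "\<dots> < ?B * ?B ^ (v - 1)" by (simp only: mult.assoc[symmetric] mult_Suc) simp
    also have "\<dots> = ?B ^ v" by (simp only: power_Suc[symmetric] Suc_diff_1[OF v0])
    finally show ?thesis .
  qed
  have sD: "sum h D = sum h D1 + sum h D2" for h :: "nat \<Rightarrow> nat"
    unfolding D12(1) using D12 by (intro sum.union_disjoint)
  have "(\<Sum>y\<in>D. row (q y) * ?B ^ ?l y) < (\<Sum>y\<in>D. row y * ?B ^ ?l y)"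
    unfolding sD using s1 s2 by linarith
  moreover have "sum h {..<n} = sum h D + sum h ({..<n} - D)" for h :: "nat \<Rightarrow> nat"
    using sum.subset_diff[OF finD(2), of h] by simp
  moreover have "(\<Sum>y\<in>{..<n} - D. row (q y) * ?B ^ ?l y) = (\<Sum>y\<in>{..<n} - D. row y * ?B ^ ?l y)"
    by (intro sum.cong refl) (auto simp: D_def)
  ultimately show ?thesis unfolding word_weight_def by simp
qed

text \<open>In a semistandard word the cells left of a labelled cell are those with smaller labels in its row.
  Thus the contents of a row determine the order of its labels.\<close>

lemma semistandard_col_eq_rank:
  assumes I: "finite I" and x: "semistandard I x" and y: "y < n" and pos: "label I x y > 0"
  shows "col y = card {z. z < n \<and> row z = row y \<and> label I x z < label I x y}"
proof -
  have "{z. z < n \<and> row z = row y \<and> label I x z < label I x y} = {z. z < n \<and> row z = row y \<and> col z < col y}"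
  proof (intro Collect_cong conj_cong refl iffI)
    fix z assume z: "z < n" "row z = row y" "label I x z < label I x y"
    have "\<not> col y < col z" using semistandard_row[OF x y z(1) z(2)[symmetric]] z(3) by auto
    moreover have "col y \<noteq> col z" using cell_inj[OF z(1) y z(2)] z(3) by auto
    ultimately show "col z < col y" by simp
  next
    fix z assume z: "z < n" "row z = row y" "col z < col y"
    have "label I x z \<noteq> label I x y"
    proof
      assume "label I x z = label I x y"
      then have "y = z" using label_inj[OF I _ pos] by metis
      then show False using z(3) by simp
    qed
    then show "label I x z < label I x y" using semistandard_row[OF x z(1) y z(2,3)] by simp
  qed
  also have "\<dots> = (\<lambda>c. t (row y, c)) ` {..<col y}"
  proof (intro subset_antisym subsetI)
    fix z assume "z \<in> {z. z < n \<and> row z = row y \<and> col z < col y}"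
    then show "z \<in> (\<lambda>c. t (row y, c)) ` {..<col y}"
      using cell_of(2)[of z] by (intro image_eqI[of _ _ "col z"]) auto
  next
    fix z assume "z \<in> (\<lambda>c. t (row y, c)) ` {..<col y}"
    then obtain c where c: "c < col y" "z = t (row y, c)" by auto
    then have "(row y, c) \<in> diagram \<nu>" using diagram_down_closed[OF cell_of(1)[OF y], of "row y" c] by simp
    then show "z \<in> {z. z < n \<and> row z = row y \<and> col z < col y}" using c entry by simp
  qed
  also have "card \<dots> = col y"
  proof -
    have "(row y, c) \<in> diagram \<nu>" if "c < col y" for c
      using that diagram_down_closed[OF cell_of(1)[OF y], of "row y" c] by simp
    then have "inj_on (\<lambda>c. t (row y, c)) {..<col y}" using entry(3) by (intro inj_onI) (metis lessThan_iff)
    then show ?thesis by (simp add: card_image)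
  qed
  finally show ?thesis by simp
qed

lemma row_equivalent_semistandard_eq:
  assumes I: "finite I" and x: "semistandard I x" and gx: "semistandard I (g \<circ> x)"
    and g: "g permutes {..<n}" and row_g: "\<And>y. y < n \<Longrightarrow> row (g y) = row y"
  shows "g \<circ> x = x"
proof
  fix i
  show "(g \<circ> x) i = x i"
  proof (cases "i \<in> I")
    case True
    define y where "y = x i"
    let ?A = "{z. z < n \<and> row z = row (g y) \<and> label I (g \<circ> x) z < label I (g \<circ> x) (g y)}" and ?Z = "{z. z < n \<and> row z = row y \<and> label I x z < label I x y}"
    have y: "y < n" using semistandard_word[OF x] True by (simp add: y_def words_def)
    have gn: "g z < n \<longleftrightarrow> z < n" for z using permutes_in_image[OF g, of z] by simp
    have lab: "label I (g \<circ> x) (g z) = label I x z" for z by (rule label_comp[OF permutes_inj[OF g]])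
    have pos: "label I x y > 0" using True by (auto simp: label_pos_iff y_def)
    have "?A =
        g ` ?Z"
    proof (intro subset_antisym subsetI)
      fix z assume z: "z \<in> ?A"
      obtain w where w: "z = g w" using permutes_surj[OF g] by (metis surjD)
      then show "z \<in> g ` ?Z"
        using z gn row_g y lab by auto
    next
      fix z assume "z \<in> g ` ?Z"
      then show "z \<in> ?A"
        using gn row_g y lab by auto
    qed
    then have "card ?A =
        card ?Z"
      using card_image[OF permutes_inj_on[OF g]] by simp
    then have "col (g y) = col y"
      using semistandard_col_eq_rank[OF I gx, of "g y"] semistandard_col_eq_rank[OF I x y pos] gn y lab pos
      by simp
    then have "g y = y" using cell_inj[of "g y" y] gn y row_g by simp
    then show ?thesis by (simp add: y_def)
  next
    case False
    then have "x i = n" using semistandard_word[OF x] by (simp add: words_def)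
    then show ?thesis using g by (simp add: permutes_def)
  qed
qed

text \<open>The homomorphism attached to the orbit of the pair \<open>(x0, {t})\<close> of a word and a tabloid: the value at
  the word \<open>x\<close> is the sum over the tabloids paired with \<open>x\<close> in this orbit, each counted as often as
  there are group elements producing it.\<close>

definition orbit_hom :: "(nat \<Rightarrow> nat) \<Rightarrow> (tabloid \<Rightarrow> complex) \<Rightarrow> (nat \<Rightarrow> nat) \<Rightarrow> complex" where
  "orbit_hom x0 v = (if v \<in> specht \<nu>
     then (\<lambda>x. \<Sum>g | g permutes {..<n} \<and> g \<circ> x0 = x. v (tabloid_of \<nu> (g \<circ> t))) else 0)"

lemma orbit_hom_mem:
  assumes x0: "x0 \<in> words n I"
  shows "orbit_hom x0 \<in> word_hom n (specht \<nu>) specht_act I {}"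
  unfolding word_hom_def Sn_hom_def mem_Collect_eq
proof (intro conjI allI ballI impI)
  have sub: "fn.subspace (specht \<nu>)" unfolding specht_def by (rule fn.subspace_span)
  fix u assume u: "u \<in> specht \<nu>"
  show "orbit_hom x0 u \<in> word_space n I {}"
  proof -
    have "(\<Sum>g | g permutes {..<n} \<and> g \<circ> x0 = x. u (tabloid_of \<nu> (g \<circ> t))) = 0" if "x \<notin> words n I" for x
    proof -
      have "{g. g permutes {..<n} \<and> g \<circ> x0 = x} = {}" using that x0 permutes_word by blast
      then show ?thesis by (simp only: sum.empty)
    qed
    then show ?thesis using u by (simp add: word_space_def orbit_hom_def)
  qed
  show "orbit_hom x0 (u + v) = orbit_hom x0 u + orbit_hom x0 v" if v: "v \<in> specht \<nu>" for v
  proof -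
    have "u + v \<in> specht \<nu>" by (rule fn.subspace_add[OF sub u v])
    then show ?thesis using u v by (simp add: orbit_hom_def fun_eq_iff sum.distrib)
  qed
  show "orbit_hom x0 (cscale c u) = cscale c (orbit_hom x0 u)" for c
    using u fn.subspace_scale[OF sub u, of c]
    by (simp add: orbit_hom_def cscale_def fun_eq_iff sum_distrib_left)
next
  fix p u assume p: "p permutes {..<n}" and u: "u \<in> specht \<nu>"
  show "orbit_hom x0 (specht_act p u) = word_act p (orbit_hom x0 u)"
  proof
    fix x
    let ?G = "\<lambda>x. {g. g permutes {..<n} \<and> g \<circ> x0 = x}"
    have ip: "inv p permutes {..<n}" using p by (rule permutes_inv)
    have inv: "p (inv p y) = y" "inv p (p y) = y" for y using permutes_inverses[OF p] by auto
    have "orbit_hom x0 (specht_act p u) x =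
        (\<Sum>g\<in>?G x. u (tabloid_of \<nu> (inv p \<circ> g \<circ> t)))"
      using specht_act_closed[OF p u]
      by (simp add: orbit_hom_def fun_act_def tabloid_act_tabloid_of comp_assoc)
    also have "\<dots> = (\<Sum>g\<in>?G (inv p \<circ> x). u (tabloid_of \<nu> (g \<circ> t)))"
    proof (rule sum.reindex_bij_witness[of _ "\<lambda>g. p \<circ> g" "\<lambda>g. inv p \<circ> g"])
      fix g assume "g \<in> ?G x"
      then have g: "g permutes {..<n}" "g \<circ> x0 = x" by auto
      show "p \<circ> (inv p \<circ> g) = g" by (simp add: fun_eq_iff inv)
      show "inv p \<circ> g \<in> ?G (inv p \<circ> x)"
        using permutes_compose[OF g(1) ip] g(2) by (auto simp: comp_assoc)
    next
      fix g assume "g \<in> ?G (inv p \<circ> x)"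
      then have g: "g permutes {..<n}" "g \<circ> x0 = inv p \<circ> x" by auto
      show "inv p \<circ> (p \<circ> g) = g" by (simp add: fun_eq_iff inv)
      have "p \<circ> g \<circ> x0 = x" unfolding comp_assoc g(2) by (simp add: fun_eq_iff inv)
      then show "p \<circ> g \<in> ?G x"
        using permutes_compose[OF g(1) p] by simp
    qed simp
    finally show "orbit_hom x0 (specht_act p u) x = word_act p (orbit_hom x0 u) x"
      using u by (simp add: orbit_hom_def fun_act_def)
  qed
next
  fix u assume "u \<notin> specht \<nu>"
  then show "orbit_hom x0 u = 0" by (simp add: orbit_hom_def)
qed

lemma word_weight_comp:
  assumes g: "g permutes {..<n}"
  shows "word_weight I x = (\<Sum>z<n. row (inv g z) * Suc (n * length \<nu>) ^ label I (g \<circ> x) z)"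
proof -
  have "label I (g \<circ> x) z = label I x (inv g z)" for z
    using label_comp[OF permutes_inj[OF g], of I x "inv g z"] permutes_inverses(1)[OF g] by simp
  then show ?thesis
    unfolding word_weight_def
    using sum.permute[OF permutes_inv[OF g], of "\<lambda>y. row y * Suc (n * length \<nu>) ^ label I x y"]
    by (simp add: comp_def)
qed

text \<open>If a tabloid of the orbit also occurs in the polytabloid, the word \<open>x0\<close> has the weight of a column
  permutation of \<open>x1\<close>. This is smaller than the weight of \<open>x1\<close> unless the permutation is trivial.\<close>

lemma orbit_hom_support:
  assumes x1: "semistandard I x1" and g: "g permutes {..<n}" "g \<circ> x0 = x1" and p: "p \<in> C"
    and T: "tabloid_of \<nu> (g \<circ> t) = tabloid_of \<nu> (p \<circ> t)" and le: "word_weight I x1 \<le> word_weight I x0"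
  shows "p = id"
proof (rule ccontr)
  assume "p \<noteq> id"
  have pp: "p permutes {..<n}" by (rule column_stabilizer_permutes[OF p])
  have "inv p \<noteq> id" using \<open>p \<noteq> id\<close> permutes_inv_inv[OF pp] by (metis inv_id)
  have "word_weight I x0 = (\<Sum>z<n. row (inv p z) * Suc (n * length \<nu>) ^ label I x1 z)"
    unfolding word_weight_comp[OF g(1)] g(2)
    using T tabloid_of_eq_iff[OF g(1) pp] by (intro sum.cong refl) simp
  also have "\<dots> < word_weight I x1"
    by (rule word_weight_column_permutation[OF x1 column_stabilizer_inv[OF p] \<open>inv p \<noteq> id\<close>])
  finally show False using le by simp
qed

lemma orbit_hom_polytabloid:
  "orbit_hom x0 e x = (\<Sum>g | g permutes {..<n} \<and> g \<circ> x0 = x. \<Sum>p\<in>C.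
      of_int (sign p) * (if tabloid_of \<nu> (g \<circ> t) = tabloid_of \<nu> (p \<circ> t) then 1 else 0))"
  using polytabloid_specht by (simp add: orbit_hom_def polytabloid_def[of _ t])

lemma orbit_hom_triangular:
  assumes I: "finite I" and x0: "semistandard I x0" and x1: "semistandard I x1" and nz: "orbit_hom x0 e x1 \<noteq> 0"
  shows "x0 = x1 \<or> word_weight I x0 < word_weight I x1"
proof (rule disjCI)
  assume "\<not> word_weight I x0 < word_weight I x1"
  then have le: "word_weight I x1 \<le> word_weight I x0" by simp
  obtain g p where g: "g permutes {..<n}" "g \<circ> x0 = x1" and p: "p \<in> C"
    and T: "tabloid_of \<nu> (g \<circ> t) = tabloid_of \<nu> (p \<circ> t)"
    using nz unfolding orbit_hom_polytabloid
    by (auto elim!: sum.not_neutral_contains_not_neutral split: if_splits)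
  have "p = id" by (rule orbit_hom_support[OF x1 g p T le])
  then have T: "tabloid_of \<nu> (g \<circ> t) = tabloid_of \<nu> (id \<circ> t)" using T by simp
  have row: "row (g y) = row y" if "y < n" for y
  proof -
    have "g y < n" using that permutes_in_image[OF g(1), of y] by simp
    then have "row (inv g (g y)) = row (g y)" using T tabloid_of_eq_iff[OF g(1) permutes_id] by simp
    then show ?thesis using permutes_inverses(2)[OF g(1)] by simp
  qed
  have "g \<circ> x0 = x0" by (rule row_equivalent_semistandard_eq[OF I x0 _ g(1) row]) (simp add: g x1)
  then show "x0 = x1" using g by simp
qed

lemma orbit_hom_diagonal:
  assumes x: "semistandard I x"
  shows "orbit_hom x e x \<noteq> 0"
proof -
  let ?h = "\<lambda>g p. of_int (sign p) * (if tabloid_of \<nu> (g \<circ> t) = tabloid_of \<nu> (p \<circ> t) then 1 else (0 :: complex))"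
  define G where "G = {g. g permutes {..<n} \<and> g \<circ> x = x}"
  define G0 where "G0 = {g \<in> G. tabloid_of \<nu> (g \<circ> t) = tabloid_of \<nu> t}"
  have finG: "finite G"
    unfolding G_def using finite_permutations[of "{..<n}"] by (rule rev_finite_subset) auto
  have idC: "id \<in> C" by (simp add: column_stabilizer_iff)
  have "(\<Sum>p\<in>C. ?h g p) =
      (if tabloid_of \<nu> (g \<circ> t) = tabloid_of \<nu> t then 1 else (0 :: complex))" if g: "g \<in> G" for g
  proof -
    have "(\<Sum>p\<in>C. ?h g p) =
        (\<Sum>p\<in>{id}. ?h g p)"
      using finite_column_stabilizer
    proof (rule sum.mono_neutral_right)
      show "\<forall>p\<in>C - {id}. ?h g p = 0"
        using orbit_hom_support[OF x, of g x] g by (auto simp: G_def)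
    qed (use idC in simp)
    then show ?thesis by simp
  qed
  then have "orbit_hom x e x = (\<Sum>g\<in>G. if tabloid_of \<nu> (g \<circ> t) = tabloid_of \<nu> t then 1 else 0)"
    unfolding orbit_hom_polytabloid G_def[symmetric] by (rule sum.cong[OF refl])
  also have "\<dots> = of_nat (card G0)"
    unfolding G0_def using sum.inter_filter[OF finG, of "\<lambda>_. 1 :: complex"] by simp
  finally have "orbit_hom x e x = of_nat (card G0)" .
  moreover have "id \<in> G0" by (simp add: G0_def G_def)
  then have "card G0 > 0" using finG by (auto simp: card_gt_0_iff G0_def)
  ultimately show ?thesis by simp
qed

text \<open>Equivariance turns the antisymmetry of the polytabloid and the Garnir relations into the
  hypotheses of \<open>straightening\<close> for the image of the polytabloid.\<close>

lemma word_hom_eq_0_if_semistandard: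
  assumes I: "finite I" and F: "F \<in> word_hom n (specht \<nu>) specht_act I {}"
    and ss: "\<And>x. semistandard I x \<Longrightarrow> F e x = 0"
  shows "F = 0"
proof -
  have sub: "fn.subspace (specht \<nu>)" unfolding specht_def by (rule fn.subspace_span)
  have F': "F \<in> Sn_hom n (specht \<nu>) specht_act (word_space n I {}) word_act"
    using F by (simp add: word_hom_def)
  have add: "F (u + v) = F u + F v" and sc: "F (cscale c u) = cscale c (F u)"
    and eq: "p permutes {..<n} \<Longrightarrow> F (specht_act p u) = word_act p (F u)"
    if "u \<in> specht \<nu>" "v \<in> specht \<nu>" for u v c p using F' that by (auto simp: Sn_hom_def)
  have Fsum: "F (sum h A) = (\<Sum>i\<in>A. F (h i))" if "\<And>i. i \<in> A \<Longrightarrow> h i \<in> specht \<nu>"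
    for h and A :: "(nat \<Rightarrow> nat) set"
    using that
  proof (induction A rule: infinite_finite_induct)
    case (insert i A)
    have "F (sum h (insert i A)) = F (h i + sum h A)" by (simp only: sum.insert[OF insert(1,2)])
    also have "\<dots> = F (h i) + F (sum h A)"
      using insert.prems by (intro add fn.subspace_sum[OF sub]) auto
    also have "F (sum h A) = (\<Sum>i\<in>A. F (h i))" by (rule insert.IH) (use insert.prems in auto)
    finally show ?case by (simp only: sum.insert[OF insert(1,2)])
  next
    case (infinite A)
    show ?case by (simp only: sum.infinite[OF infinite(1)] Sn_hom_zero[OF F'])
  next
    case empty
    show ?case by (simp only: sum.empty Sn_hom_zero[OF F'])
  qed
  have "F e x = 0" for x
  proof (rule straightening[of I "F e", OF I])
    show "F e x = 0" if "x \<notin> words n I" for x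
      using F' polytabloid_specht that by (auto simp: Sn_hom_def word_space_def)
    show "F e (p \<circ> x) = of_int (sign p) * F e x" if p: "p \<in> C" for p x
    proof -
      have ip: "inv p \<in> C" by (rule column_stabilizer_inv[OF p])
      have pp: "p permutes {..<n}" by (rule column_stabilizer_permutes[OF p])
      have "word_act (inv p) (F e) = F (specht_act (inv p) e)"
        using eq[OF polytabloid_specht polytabloid_specht column_stabilizer_permutes[OF ip]] by simp
      also have "\<dots> = cscale (of_int (sign (inv p))) (F e)"
        unfolding polytabloid_antisymmetric[OF ip] by (rule sc[OF polytabloid_specht polytabloid_specht])
      finally have "word_act (inv p) (F e) x = cscale (of_int (sign (inv p))) (F e) x" by simp
      then show ?thesis
        by (simp add: fun_act_def cscale_def permutes_inv_inv[OF pp] sign_inverse permutation_of_permutes[OF pp])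
    qed
    show "(\<Sum>q | q permutes Y. of_int (sign q) * F e (q \<circ> x)) = 0"
      if Y: "j < j'" "Y \<subseteq> {y. y < n \<and> (col y = j \<or> col y = j')}" "card {y. y < n \<and> col y = j} < card Y"
      for j j' Y x
    proof -
      have perm: "q permutes {..<n}" if "q permutes Y" for q
        using that by (rule permutes_subset) (use Y in auto)
      have "(\<Sum>q | q permutes Y. of_int (sign q) * F e (q \<circ> x)) =
          (\<Sum>q | q permutes Y. of_int (sign (inv q)) * F e (inv q \<circ> x))"
        by (rule sum_permutations_inverse)
      also have "\<dots> = (\<Sum>q | q permutes Y. F (cscale (of_int (sign q)) (specht_act q e)) x)"
      proof (rule sum.cong[OF refl])
        fix q assume "q \<in> {q. q permutes Y}"
        then have q: "q permutes {..<n}" by (simp add: perm)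
        have "F (cscale (of_int (sign q)) (specht_act q e)) = cscale (of_int (sign q)) (F (specht_act q e))"
          by (rule sc) (rule specht_act_mem[OF q])+
        also have "F (specht_act q e) = word_act q (F e)"
          by (rule eq[OF polytabloid_specht polytabloid_specht q])
        finally show "of_int (sign (inv q)) * F e (inv q \<circ> x) = F (cscale (of_int (sign q)) (specht_act q e)) x"
          by (simp add: cscale_def fun_act_def sign_inverse permutation_of_permutes[OF q])
      qed
      also have "\<dots> = (\<Sum>q | q permutes Y. F (cscale (of_int (sign q)) (specht_act q e))) x"
        by (rule sum_fun_apply[symmetric])
      also have "\<dots> = F (\<Sum>q | q permutes Y. cscale (of_int (sign q)) (specht_act q e)) x"
        by (subst Fsum) (auto intro!: fn.subspace_scale[OF sub] specht_act_mem perm)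
      also have "\<dots> = F 0 x" unfolding garnir_relation[OF Y] ..
      also have "\<dots> = 0" using Sn_hom_zero[OF F'] by simp
      finally show ?thesis .
    qed
    show "F e x = 0" if "semistandard I x" for x by (rule ss[OF that])
  qed
  then have "F e = 0" by (simp add: fun_eq_iff)
  then show ?thesis by (rule Sn_hom_eq_0_if_polytabloid[OF F'])
qed

theorem dim_word_hom_semistandard:
  assumes I: "finite I"
  shows "maps.dim (word_hom n (specht \<nu>) specht_act I {}) = card {x. semistandard I x}"
    and "\<exists>B. finite B \<and> word_hom n (specht \<nu>) specht_act I {} \<subseteq> maps.span B"
proof -
  let ?H = "word_hom n (specht \<nu>) specht_act I {}" and ?R = "{x. semistandard I x}"
  have fin: "finite ?R"
    using finite_words[OF I, of n] by (rule rev_finite_subset) (auto simp: semistandard_word)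
  have mem: "orbit_hom x \<in> ?H" if "x \<in> ?R" for x
    using that by (simp add: orbit_hom_mem semistandard_word)
  have diag: "orbit_hom x e x \<noteq> 0" if "x \<in> ?R" for x
    using that by (simp add: orbit_hom_diagonal)
  have tri: "x = y \<or> word_weight I x < word_weight I y"
    if "x \<in> ?R" "y \<in> ?R" "orbit_hom x e y \<noteq> 0" for x y
    using orbit_hom_triangular[OF I _ _ that(3)] that(1,2) by simp
  have det: "F = 0" if "F \<in> ?H"
    "\<And>x. x \<in> ?R \<Longrightarrow> F e x = 0" for F
    using word_hom_eq_0_if_semistandard[OF I that(1)] that(2) by simp
  note basis = triangular_family_basis[OF word_hom_subspace fin mem diag tri det]
  show "maps.dim (?H) = card ?R"
    by (rule basis(1)) assumption+
  show "\<exists>B. finite B \<and> ?H \<subseteq> maps.span B"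
    by (rule basis(2)) assumption+
qed

end

section \<open>Counting semistandard words\<close>

lemma card_diagram: "finite (diagram \<mu>)" "card (diagram \<mu>) = sum_list \<mu>"
proof -
  have eq: "diagram \<mu> = (SIGMA i:{..<length \<mu>}. {..<\<mu> ! i})" by (auto simp: diagram_def)
  show "finite (diagram \<mu>)" unfolding eq by simp
  show "card (diagram \<mu>) = sum_list \<mu>"
    unfolding eq by (simp add: sum_list_sum_nth atLeast0LessThan)
qed

text \<open>The order-preserving numbering of \<open>M\<close> from \<open>0\<close>; it turns fillings by minima of blocks into standard
  tableaux.\<close>

definition rank_in :: "nat set \<Rightarrow> nat \<Rightarrow> nat" where
  "rank_in M m = card {m' \<in> M. m' < m}"

lemma rank_in_less: "finite M \<Longrightarrow> m \<in> M \<Longrightarrow> m < m' \<Longrightarrow> rank_in M m < rank_in M m'"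
  unfolding rank_in_def by (intro psubset_card_mono) auto

lemma rank_in_less_iff: "finite M \<Longrightarrow> m \<in> M \<Longrightarrow> m' \<in> M \<Longrightarrow> rank_in M m < rank_in M m' \<longleftrightarrow> m < m'"
  using rank_in_less[of M m m'] rank_in_less[of M m' m] by (cases m m' rule: linorder_cases) auto

lemma rank_in_bij:
  assumes "finite M"
  shows "bij_betw (rank_in M) M {..<card M}"
proof -
  have inj: "inj_on (rank_in M) M"
    using rank_in_less_iff[OF assms] by (intro inj_onI) (metis less_irrefl linorder_neqE_nat)
  have "rank_in M m < card M" if "m \<in> M" for m
    unfolding rank_in_def using assms that by (intro psubset_card_mono) auto
  then have "rank_in M ` M \<subseteq> {..<card M}" by auto
  moreover have "card (rank_in M ` M) = card {..<card M}" using card_image[OF inj] by simp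
  ultimately have "rank_in M ` M = {..<card M}" by (intro card_subset_eq) auto
  then show ?thesis using inj by (simp add: bij_betw_def)
qed

lemma partition_Min:
  fixes P :: "nat set set"
  assumes I: "finite I" and P: "partition_on I P"
  shows "finite P" "inj_on Min P" "B \<in> P \<Longrightarrow> Min B \<in> B"
proof -
  show "finite P" by (rule finite_elements[OF I P])
  have Min: "Min B \<in> B" if "B \<in> P" for B
    using that P I by (intro Min_in) (auto simp: partition_on_def intro: finite_subset)
  then show "B \<in> P \<Longrightarrow> Min B \<in> B" .
  show "inj_on Min P"
  proof (rule inj_onI)
    fix A B assume "A \<in> P" "B \<in> P" "Min A = Min B"
    then have "A \<inter> B \<noteq> {}" using Min[of A] Min[of B] by auto
    then show "A = B" using P \<open>A \<in> P\<close> \<open>B \<in> P\<close> by (auto simp: partition_on_def disjoint_def)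
  qed
qed

lemma partition_unique_block: "partition_on I P \<Longrightarrow> i \<in> A \<Longrightarrow> i \<in> B \<Longrightarrow> A \<in> P \<Longrightarrow> B \<in> P \<Longrightarrow> A = B"
  by (auto simp: partition_on_def disjoint_def)

lemma standard_tableau_increasing:
  assumes s: "s \<in> standard_tableaux \<mu>" and \<mu>: "sorted_wrt (\<ge>) \<mu>"
  shows "(i, j) \<in> diagram \<mu> \<Longrightarrow> j' < j \<Longrightarrow> s (i, j') < s (i, j)"
    and "(i, j) \<in> diagram \<mu> \<Longrightarrow> i' < i \<Longrightarrow> s (i', j) < s (i, j)"
proof -
  have step: "\<And>i j. (i, Suc j) \<in> diagram \<mu> \<Longrightarrow> s (i, j) < s (i, Suc j)"
    "\<And>i j. (Suc i, j) \<in> diagram \<mu> \<Longrightarrow> s (i, j) < s (Suc i, j)"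
    using s by (auto simp: standard_tableaux_def)
  show "(i, j) \<in> diagram \<mu> \<Longrightarrow> j' < j \<Longrightarrow> s (i, j') < s (i, j)"
  proof (induction j)
    case (Suc j)
    then have "(i, j) \<in> diagram \<mu>" by (simp add: diagram_def)
    then show ?case using Suc step(1)[of i j] by (cases "j' = j") auto
  qed simp
  show "(i, j) \<in> diagram \<mu> \<Longrightarrow> i' < i \<Longrightarrow> s (i', j) < s (i, j)"
  proof (induction i)
    case (Suc i)
    then have "(i, j) \<in> diagram \<mu>"
      using sorted_wrt_nth_less[OF \<mu>, of i "Suc i"] by (simp add: diagram_def)
    then show ?case using Suc step(2)[of i j] by (cases "i' = i") auto
  qed simp
qed

definition fiber :: "nat set \<Rightarrow> (nat \<Rightarrow> nat) \<Rightarrow> nat \<Rightarrow> nat set" where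
  "fiber I x y = {i \<in> I. x i = y}"

lemma label_fiber: "y \<in> x ` I \<Longrightarrow> label I x y = Suc (Min (fiber I x y))"
  by (auto simp: label_def fiber_def)

lemma label_eq_0_iff: "label I x y = 0 \<longleftrightarrow> y \<notin> x ` I"
  using label_pos_iff[of I x y] by auto

lemma fiber_inj: "y \<in> x ` I \<Longrightarrow> fiber I x y = fiber I x z \<Longrightarrow> y = z"
  by (auto simp: fiber_def)

abbreviation fibers :: "nat set \<Rightarrow> (nat \<Rightarrow> nat) \<Rightarrow> nat set set" where
  "fibers I x \<equiv> fiber I x ` x ` I"

lemma fibers_partition: "partition_on I (fibers I x)"
  unfolding partition_on_def disjoint_def by (auto simp: fiber_def)

context numbered_diagram
begin

abbreviation lower_diagram :: "(nat \<times> nat) set" where "lower_diagram \<equiv> diagram (tl \<nu>)"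

lemma diagram_tl: "(r, c) \<in> lower_diagram \<longleftrightarrow> (Suc r, c) \<in> diagram \<nu>"
  by (cases \<nu>) (auto simp: diagram_def)

lemma sorted_tl: "sorted_wrt (\<ge>) (tl \<nu>)"
  using part by (cases \<nu>) (auto simp: partition_of_def)

abbreviation lower_points :: "nat set" where "lower_points \<equiv> {y. y < n \<and> row y > 0}"

lemma lower_cells_bij: "bij_betw (\<lambda>(r, c). t (Suc r, c)) (lower_diagram) lower_points"
proof (rule bij_betw_imageI)
  show "inj_on (\<lambda>(r, c). t (Suc r, c)) (lower_diagram)"
    using entry by (intro inj_onI) (auto simp: diagram_tl, metis nat.inject, metis)
  show "(\<lambda>(r, c). t (Suc r, c)) ` lower_diagram = lower_points"
  proof (intro subset_antisym subsetI)
    fix y assume y: "y \<in> lower_points"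
    then have "(row y - 1, col y) \<in> lower_diagram" "t (Suc (row y - 1), col y) = y"
      using cell_of[of y] by (simp_all add: diagram_tl)
    then show "y \<in> (\<lambda>(r, c). t (Suc r, c)) ` lower_diagram"
      by (intro image_eqI[of _ _ "(row y - 1, col y)"]) auto
  qed (use entry in \<open>auto simp: diagram_tl\<close>)
qed

lemma card_lower_cells: "card lower_points = sum_list (tl \<nu>)"
  using bij_betw_same_card[OF lower_cells_bij] card_diagram by simp

definition marked :: "nat set \<Rightarrow> (nat \<Rightarrow> nat) \<Rightarrow> nat set set" where
  "marked I x = fiber I x ` {y \<in> x ` I. row y > 0}"

text \<open>The top cell of the column has a smaller label.\<close>

lemma lower_cell_labelled:
  assumes x: "semistandard I x" and y: "y < n" "row y > 0"
  shows "y \<in> x ` I"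
proof -
  have d: "(0, col y) \<in> diagram \<nu>" using diagram_down_closed[OF cell_of(1)[OF y(1)]] by simp
  have "label I x (t (0, col y)) < label I x y"
    using semistandard_column[OF x entry(1)[OF d] y(1)] entry(2,3)[OF d] y(2) by simp
  then have "label I x y \<noteq> 0" by simp
  then show ?thesis by (simp add: label_eq_0_iff)
qed

lemma lower_cells_labelled:
  assumes x: "semistandard I x"
  shows "{y \<in> x ` I. row y > 0} = lower_points"
  using lower_cell_labelled[OF x] semistandard_word[OF x] by (auto simp: words_def)

lemma marked_partition_of_word:
  assumes x: "semistandard I x"
  shows "(fibers I x, marked I x) \<in> marked_partitions (sum_list (tl \<nu>)) I {}"
proof -
  have "inj_on (fiber I x) {y \<in> x ` I. row y > 0}" by (intro inj_onI fiber_inj) auto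
  then have "card (marked I x) = sum_list (tl \<nu>)"
    unfolding marked_def card_lower_cells[symmetric] lower_cells_labelled[OF x, symmetric] by (rule card_image)
  then show ?thesis using fibers_partition[of I x] by (auto simp: marked_partitions_def marked_def)
qed

lemma marked_fiber_iff: "y \<in> x ` I \<Longrightarrow> fiber I x y \<in> marked I x \<longleftrightarrow> row y > 0"
  unfolding marked_def using fiber_inj[of y x I] by (auto simp: image_iff) 

text \<open>Deleting the first row and replacing the labels by their relative order.\<close>

definition lower_filling :: "nat set \<Rightarrow> (nat \<Rightarrow> nat) \<Rightarrow> nat \<times> nat \<Rightarrow> nat" where
  "lower_filling I x = restrict (\<lambda>(r, c). rank_in (Min ` marked I x) (label I x (t (Suc r, c)) - 1)) (lower_diagram)"

lemma lower_labels_bij: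
  assumes I: "finite I" and x: "semistandard I x"
  shows "bij_betw (\<lambda>y. label I x y - 1) lower_points (Min ` marked I x)"
proof (rule bij_betw_imageI)
  have lab: "label I x y = Suc (Min (fiber I x y))" if "y < n" "row y > 0" for y
    by (rule label_fiber[OF lower_cell_labelled[OF x that]])
  show "inj_on (\<lambda>y. label I x y - 1) lower_points"
  proof (rule inj_onI)
    fix y z assume yz: "y \<in> lower_points" "z \<in> lower_points"
      "label I x y - 1 = label I x z - 1"
    then have "label I x y = label I x z" "label I x y > 0" using lab[of y] lab[of z] by simp_all
    then show "y = z" by (rule label_inj[OF I])
  qed
  have "(\<lambda>y. label I x y - 1) ` lower_points = (\<lambda>y. Min (fiber I x y)) ` lower_points"
    using lab by (intro image_cong refl) simp
  then show "(\<lambda>y. label I x y - 1) ` lower_points = Min ` marked I x"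
    by (simp add: marked_def lower_cells_labelled[OF x] image_image)
qed

lemma lower_filling_standard:
  assumes I: "finite I" and x: "semistandard I x"
  shows "lower_filling I x \<in> standard_tableaux (tl \<nu>)"
proof -
  let ?M = "Min ` marked I x" and ?d = "sum_list (tl \<nu>)"
  have part: "partition_on I (fibers I x)" by (rule fibers_partition)
  have mk: "marked I x \<subseteq> fibers I x" "card (marked I x) = ?d"
    using marked_partition_of_word[OF x] by (auto simp: marked_partitions_def)
  have fin: "finite ?M" using partition_Min(1)[OF I part] mk(1) by (auto intro: finite_subset)
  have card: "card ?M = ?d"
    using mk inj_on_subset[OF partition_Min(2)[OF I part] mk(1)] by (simp add: card_image)
  have bij: "bij_betw (rank_in ?M \<circ> (\<lambda>y. label I x y - 1) \<circ> (\<lambda>(r, c). t (Suc r, c))) (lower_diagram) {..<?d}"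
    using bij_betw_trans[OF lower_cells_bij bij_betw_trans[OF lower_labels_bij[OF I x] rank_in_bij[OF fin]]] card
    by (simp add: comp_assoc)
  have val: "lower_filling I x (r, c) = rank_in ?M (label I x (t (Suc r, c)) - 1)"
    if "(r, c) \<in> lower_diagram" for r c
    using that by (simp add: lower_filling_def)
  have "bij_betw (lower_filling I x) (lower_diagram) {..<?d}"
    by (rule bij_betw_cong[THEN iffD1, OF _ bij]) (auto simp: val)
  moreover have less: "lower_filling I x (r, c) < lower_filling I x (r', c')"
    if d: "(r, c) \<in> lower_diagram" "(r', c') \<in> lower_diagram"
      and l: "label I x (t (Suc r, c)) < label I x (t (Suc r', c'))" for r c r' c'
  proof -
    let ?y = "t (Suc r, c)"
    have "?y \<in> lower_points" using d entry by (simp add: diagram_tl)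
    then have "label I x ?y - 1 \<in> ?M" "label I x ?y \<noteq> 0"
      using lower_labels_bij[OF I x] lower_cell_labelled[OF x, of ?y] by (auto simp: bij_betw_def label_eq_0_iff)
    then show ?thesis unfolding val[OF d(1)] val[OF d(2)] using l by (intro rank_in_less[OF fin]) auto
  qed
  moreover have "lower_filling I x (i, j) < lower_filling I x (i, Suc j)" if d: "(i, Suc j) \<in> lower_diagram" for i j
  proof -
    have d': "(i, j) \<in> lower_diagram" using d by (simp add: diagram_def)
    note dd = d[unfolded diagram_tl] d'[unfolded diagram_tl]
    have le: "label I x (t (Suc i, j)) \<le> label I x (t (Suc i, Suc j))"
      using semistandard_row[OF x entry(1)[OF dd(2)] entry(1)[OF dd(1)]] entry(2,3)[OF dd(1)] entry(2,3)[OF dd(2)] by simp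
    have "label I x (t (Suc i, j)) \<noteq> label I x (t (Suc i, Suc j))"
    proof
      assume eq: "label I x (t (Suc i, j)) = label I x (t (Suc i, Suc j))"
      have "label I x (t (Suc i, j)) > 0"
        using lower_cell_labelled[OF x entry(1)[OF dd(2)]] entry(2)[OF dd(2)] label_eq_0_iff by (metis neq0_conv zero_less_Suc)
      then have "t (Suc i, j) = t (Suc i, Suc j)" using label_inj[OF I eq] by simp
      then show False using entry(3)[OF dd(1)] entry(3)[OF dd(2)] by simp
    qed
    then show ?thesis using less[OF d' d] le by simp
  qed
  moreover have "lower_filling I x (i, j) < lower_filling I x (Suc i, j)" if d: "(Suc i, j) \<in> lower_diagram" for i j
  proof -
    have d': "(i, j) \<in> lower_diagram"
      using d diagram_down_closed[of "Suc (Suc i)" j "Suc i" j] by (simp add: diagram_tl)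
    note dd = d[unfolded diagram_tl] d'[unfolded diagram_tl]
    show ?thesis
      using less[OF d' d] semistandard_column[OF x entry(1)[OF dd(2)] entry(1)[OF dd(1)]]
        entry(2,3)[OF dd(1)] entry(2,3)[OF dd(2)] by simp
  qed
  ultimately show ?thesis by (simp add: standard_tableaux_def tableau_def lower_filling_def)
qed

text \<open>The first row of a semistandard word consists of the unused points followed by the unmarked blocks
  in the order of their minima.\<close>

lemma upper_col:
  assumes I: "finite I" and x: "semistandard I x" and y: "y \<in> x ` I" "row y = 0"
  shows "col y = n - card (fibers I x) +
    rank_in (Min ` (fibers I x - marked I x)) (Min (fiber I x y))"
proof -
  let ?P = "fibers I x" and ?m = "Min (fiber I x y)"
  have part: "partition_on I ?P" by (rule fibers_partition)
  have xn: "x ` I \<subseteq> {..<n}" using semistandard_word[OF x] by (auto simp: words_def)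
  have yn: "y < n" using y xn by auto
  have laby: "label I x y = Suc ?m" by (rule label_fiber[OF y(1)])
  let ?U = "{z \<in> x ` I. row z = 0 \<and> Min (fiber I x z) < ?m}"
  have "{z. z < n \<and> row z = row y \<and> label I x z < label I x y} = ({..<n} - x ` I) \<union> ?U"
  proof (intro subset_antisym subsetI)
    fix z assume z: "z \<in> {z. z < n \<and> row z = row y \<and> label I x z < label I x y}"
    then show "z \<in> ({..<n} - x ` I) \<union> ?U"
      using y laby label_fiber[of z x I] by auto
  next
    fix z assume "z \<in> ({..<n} - x ` I) \<union> ?U"
    then consider "z < n" "z \<notin> x ` I" | "z \<in> ?U" by auto
    then show "z \<in> {z. z < n \<and> row z = row y \<and> label I x z < label I x y}"
    proof cases
      case 1
      then have "row z = 0" using lower_cell_labelled[OF x] by auto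
      then show ?thesis using 1 y laby label_eq_0_iff[of I x z] by auto
    next
      case 2
      then show ?thesis using xn y laby label_fiber[of z x I] by auto
    qed
  qed
  then have "col y = card (({..<n} - x ` I) \<union> ?U)"
    using semistandard_col_eq_rank[OF I x yn] laby by simp
  also have "\<dots> = card ({..<n} - x ` I) + card ?U"
    using I by (intro card_Un_disjoint) auto
  also have "card ({..<n} - x ` I) = n - card ?P"
  proof -
    have "inj_on (fiber I x) (x ` I)" by (intro inj_onI fiber_inj)
    then show ?thesis using xn I by (simp add: card_Diff_subset card_image)
  qed
  also have "card ?U = rank_in (Min ` (?P - marked I x)) ?m"
  proof -
    have inj: "inj_on (\<lambda>z. Min (fiber I x z)) ?U"
    proof (rule inj_onI)
      fix z w assume zw: "z \<in> ?U" "w \<in> ?U" "Min (fiber I x z) = Min (fiber I x w)"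
      then have "fiber I x z = fiber I x w" by (intro inj_onD[OF partition_Min(2)[OF I part]]) auto
      then show "z = w" using zw(1) by (intro fiber_inj) auto
    qed
    have "(\<lambda>z. Min (fiber I x z)) ` ?U = {m' \<in> Min ` (?P - marked I x). m' < ?m}"
    proof (intro subset_antisym subsetI)
      fix m' assume "m' \<in> (\<lambda>z. Min (fiber I x z)) ` ?U"
      then obtain z where z: "z \<in> x ` I" "row z = 0" "m' = Min (fiber I x z)" "m' < ?m" by auto
      then have "fiber I x z \<in> ?P - marked I x" using marked_fiber_iff[OF z(1)] by simp
      then show "m' \<in> {m' \<in> Min ` (?P - marked I x). m' < ?m}" using z by auto
    next
      fix m' assume "m' \<in> {m' \<in> Min ` (?P - marked I x). m' < ?m}"
      then obtain z where z: "z \<in> x ` I" "fiber I x z \<notin> marked I x" "m' = Min (fiber I x z)" "m' < ?m" by auto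
      then have "row z = 0" using marked_fiber_iff[OF z(1)] by simp
      then show "m' \<in> (\<lambda>z. Min (fiber I x z)) ` ?U" using z by auto
    qed
    then show ?thesis unfolding rank_in_def using card_image[OF inj] by simp
  qed
  finally show ?thesis .
qed

text \<open>Marked blocks are located by the filling of the lower rows, unmarked ones by \<open>upper_col\<close>.\<close>

lemma lower_filling_inj:
  assumes I: "finite I" and x: "semistandard I x" and x': "semistandard I x'"
    and P: "fibers I x = fibers I x'" and Q: "marked I x = marked I x'"
    and s: "lower_filling I x = lower_filling I x'"
  shows "x = x'"
proof
  fix i
  show "x i = x' i"
  proof (cases "i \<in> I")
    case False
    then show ?thesis using semistandard_word[OF x] semistandard_word[OF x'] by (simp add: words_def)
  next
    case i: True
    have part: "partition_on I (fibers I x)" by (rule fibers_partition)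
    have same: "fiber I x (x i) = fiber I x' (x' i)"
    proof (rule partition_unique_block[OF part])
      show "i \<in> fiber I x (x i)" "i \<in> fiber I x' (x' i)" using i by (simp_all add: fiber_def)
      show "fiber I x (x i) \<in> fibers I x" using i by (intro imageI)
      show "fiber I x' (x' i) \<in> fibers I x" unfolding P using i by (intro imageI)
    qed
    have in_img: "x i \<in> x ` I" "x' i \<in> x' ` I" using i by auto
    have xn: "x i < n" "x' i < n"
      using i semistandard_word[OF x] semistandard_word[OF x'] by (auto simp: words_def)
    have rows: "row (x i) > 0 \<longleftrightarrow> row (x' i) > 0"
      using marked_fiber_iff[OF in_img(1)] marked_fiber_iff[OF in_img(2)] same Q by simp
    show ?thesis
    proof (cases "row (x i) > 0")
      case True
      let ?c = "(row (x i) - 1, col (x i))"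
      have c: "?c \<in> lower_diagram" "t (Suc (row (x i) - 1), col (x i)) = x i"
        using True cell_of[OF xn(1)] by (simp_all add: diagram_tl)
      have M: "finite (Min ` marked I x)"
        unfolding marked_def using I by (intro finite_imageI) simp
      have "rank_in (Min ` marked I x) (label I x (x i) - 1) = rank_in (Min ` marked I x) (label I x' (x i) - 1)"
        using fun_cong[OF s, of ?c] c Q by (simp add: lower_filling_def)
      moreover have "x i \<in> lower_points" using True xn by simp
      then have "label I x (x i) - 1 \<in> Min ` marked I x" "label I x' (x i) - 1 \<in> Min ` marked I x"
        using lower_labels_bij[OF I x] lower_labels_bij[OF I x'] Q by (auto simp: bij_betw_def)
      ultimately have "label I x (x i) - 1 = label I x' (x i) - 1"
        using rank_in_bij[OF M] by (auto simp: bij_betw_def dest: inj_onD)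
      moreover have img': "x i \<in> x' ` I" by (rule lower_cell_labelled[OF x' xn(1) True])
      ultimately have "Min (fiber I x' (x' i)) = Min (fiber I x' (x i))"
        using label_fiber[OF in_img(1)] label_fiber[OF img'] same by simp
      then have "fiber I x' (x' i) = fiber I x' (x i)"
        using partition_Min(2)[OF I part] in_img(2) img' unfolding P by (auto dest: inj_onD)
      then show ?thesis using fiber_inj[OF in_img(2)] by simp
    next
      case False
      then have "col (x i) = col (x' i)"
        using upper_col[OF I x in_img(1)] upper_col[OF I x' in_img(2)] rows same P Q by simp
      then show ?thesis using cell_inj[OF xn] False rows by simp
    qed
  qed
qed


lemma top_row: "(0, c) \<in> diagram \<nu> \<longleftrightarrow> c < n - sum_list (tl \<nu>)"
  using size_eq by (cases \<nu>) (auto simp: diagram_def)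

lemma second_row: "(1, c) \<in> diagram \<nu> \<Longrightarrow> c < nth_default 0 \<nu> 1"
  by (auto simp: diagram_def nth_default_def)

text \<open>Marked blocks are placed in the lower rows according to \<open>s\<close>, unmarked ones at the end of the first
  row. The inequality \<open>room\<close> makes the unused initial part of the first row at least as long as the
  second row, so columns stay strictly increasing whatever the unmarked blocks are.\<close>

lemma filling_realised:
  assumes I: "finite I" and room: "card I + nth_default 0 \<nu> 1 \<le> n"
    and PQ: "(P, Q) \<in> marked_partitions (sum_list (tl \<nu>)) I {}" and s: "s \<in> standard_tableaux (tl \<nu>)"
  shows "\<exists>x. semistandard I x \<and> fibers I x = P \<and> marked I x = Q \<and> lower_filling I x = s"
proof -
  let ?d = "sum_list (tl \<nu>)" and ?M = "Min ` Q" and ?U = "Min ` (P - Q)" and ?z = "n - card P"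
  have P: "partition_on I P" and Q: "Q \<subseteq> P" "card Q = ?d" using PQ by (auto simp: marked_partitions_def)
  note finP = partition_Min(1)[OF I P] and injP = partition_Min(2)[OF I P] and MinB = partition_Min(3)[OF I P]
  have UnP: "\<Union>P = I" using P by (simp add: partition_on_def)
  have finM: "finite ?M" "finite ?U" using finP Q(1) by (auto intro: finite_subset)
  have cardM: "card ?M = ?d" using Q card_image[OF inj_on_subset[OF injP Q(1)]] by simp
  have "card ?U = card (P - Q)" by (rule card_image[OF inj_on_subset[OF injP]]) auto
  then have cardU: "card ?U = card P - ?d" using Q finP by (simp add: card_Diff_subset finite_subset)
  have dP: "?d \<le> card P" using Q card_mono[OF finP Q(1)] by simp
  have "Min ` P \<subseteq> I" using MinB UnP by auto
  then have PI: "card P \<le> card I" using card_mono[OF I] card_image[OF injP] by metis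
  have sb: "bij_betw s (lower_diagram) {..<?d}" using s by (simp add: standard_tableaux_def tableau_def)
  define \<sigma> where "\<sigma> = inv_into (lower_diagram) s"
  have \<sigma>: "\<sigma> r \<in> lower_diagram" "s (\<sigma> r) = r" if "r < ?d" for r
  proof -
    have "r \<in> s ` lower_diagram" using sb that by (simp add: bij_betw_def)
    then show "\<sigma> r \<in> lower_diagram" "s (\<sigma> r) = r" unfolding \<sigma>_def by (rule inv_into_into, rule f_inv_into_f)
  qed
  have \<sigma>s: "\<sigma> (s c) = c" if "c \<in> lower_diagram" for c
    using sb that unfolding \<sigma>_def by (simp add: bij_betw_def)
  define pl where "pl B = (if B \<in> Q then (Suc (fst (\<sigma> (rank_in ?M (Min B)))), snd (\<sigma> (rank_in ?M (Min B))))
    else (0, ?z + rank_in ?U (Min B)))" for B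
  have rankQ: "rank_in ?M (Min B) < ?d" if "B \<in> Q" for B
    using rank_in_bij[OF finM(1)] cardM that by (auto simp: bij_betw_def)
  have rankU: "rank_in ?U (Min B) < card P - ?d" if "B \<in> P - Q" for B
    using rank_in_bij[OF finM(2)] cardU that by (auto simp: bij_betw_def)
  have pl_mem: "pl B \<in> diagram \<nu>" if "B \<in> P" for B
  proof (cases "B \<in> Q")
    case True
    then show ?thesis using \<sigma>(1)[OF rankQ[OF True]] by (simp add: pl_def diagram_tl[symmetric])
  next
    case False
    then have "?z + rank_in ?U (Min B) < n - ?d" using rankU[of B] that PI room dP by simp
    then show ?thesis using False by (simp add: pl_def top_row)
  qed
  have pl_row: "fst (pl B) > 0 \<longleftrightarrow> B \<in> Q" for B by (simp add: pl_def)
  have pl_inj: "A = B" if AB: "A \<in> P" "B \<in> P" "pl A = pl B" for A B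
  proof (cases "A \<in> Q")
    case True
    then have B: "B \<in> Q" using pl_row AB(3) by metis
    have "\<sigma> (rank_in ?M (Min A)) = \<sigma> (rank_in ?M (Min B))"
      using AB(3) True B by (simp add: pl_def prod_eq_iff)
    then have "rank_in ?M (Min A) = rank_in ?M (Min B)" using \<sigma>(2) rankQ[OF True] rankQ[OF B] by metis
    then have "Min A = Min B" using rank_in_bij[OF finM(1)] True B by (auto simp: bij_betw_def dest: inj_onD)
    then show ?thesis using injP AB by (auto dest: inj_onD)
  next
    case False
    then have B: "B \<notin> Q" using pl_row AB(3) by metis
    then have "rank_in ?U (Min A) = rank_in ?U (Min B)" using AB(3) False by (simp add: pl_def)
    then have "Min A = Min B" using rank_in_bij[OF finM(2)] AB False B by (auto simp: bij_betw_def dest: inj_onD)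
    then show ?thesis using injP AB by (auto dest: inj_onD)
  qed
  define x where "x i = (if i \<in> I then t (pl (THE B. B \<in> P \<and> i \<in> B)) else n)" for i
  have xB: "x i = t (pl B)" if "B \<in> P" "i \<in> B" for i B
  proof -
    have "(THE B. B \<in> P \<and> i \<in> B) = B" using that partition_unique_block[OF P] by (intro the_equality) auto
    then show ?thesis using that UnP by (auto simp: x_def)
  qed
  have tpl: "t (pl B) < n" "row (t (pl B)) = fst (pl B)" "col (t (pl B)) = snd (pl B)" if "B \<in> P" for B
    using entry[of "fst (pl B)" "snd (pl B)"] pl_mem[OF that] by simp_all
  have block: "\<exists>B\<in>P. i \<in> B" if "i \<in> I" for i using that UnP by auto
  have word: "x \<in> words n I"
    unfolding words_def using block xB tpl(1) by (auto simp: x_def[of i for i], metis)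
  have tpl_inj: "A = B" if "A \<in> P" "B \<in> P" "t (pl A) = t (pl B)" for A B
    using pl_inj[OF that(1,2)] tpl(2,3)[OF that(1)] tpl(2,3)[OF that(2)] that(3) by (simp add: prod_eq_iff)
  have fib: "fiber I x (t (pl B)) = B" if "B \<in> P" for B
  proof (intro subset_antisym subsetI)
    fix i assume i: "i \<in> fiber I x (t (pl B))"
    then obtain A where A: "A \<in> P" "i \<in> A" using block by (auto simp: fiber_def)
    then have "t (pl A) = t (pl B)" using i xB[OF A] by (simp add: fiber_def)
    then show "i \<in> B" using tpl_inj[OF A(1) that] A by simp
  next
    fix i assume "i \<in> B"
    then show "i \<in> fiber I x (t (pl B))" using xB[OF that] that UnP by (auto simp: fiber_def)
  qed
  have img: "x ` I = (\<lambda>B. t (pl B)) ` P"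
  proof (intro subset_antisym subsetI)
    fix y assume "y \<in> x ` I"
    then show "y \<in> (\<lambda>B. t (pl B)) ` P" using block xB by blast
  next
    fix y assume "y \<in> (\<lambda>B. t (pl B)) ` P"
    then obtain B where B: "B \<in> P" "y = t (pl B)" by auto
    then have "x (Min B) = y" "Min B \<in> I" using xB[OF B(1) MinB[OF B(1)]] MinB[OF B(1)] UnP by auto
    then show "y \<in> x ` I" by auto
  qed
  have lab: "label I x (t (pl B)) = Suc (Min B)" if "B \<in> P" for B
    using label_fiber[of "t (pl B)" x I] fib[OF that] that by (simp add: img)
  have blocks: "fibers I x = P"
    unfolding img image_image using fib by simp
  have marks: "marked I x = Q"
  proof -
    have "{y \<in> x ` I. row y > 0} = (\<lambda>B. t (pl B)) ` Q"
      unfolding img using tpl(2) pl_row Q(1) by auto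
    then show ?thesis unfolding marked_def using fib Q(1) by (simp add: image_image subset_iff)
  qed
  have low: "\<exists>B\<in>Q. pl B = (Suc r, c) \<and> rank_in ?M (Min B) = s (r, c)" if rc: "(r, c) \<in> lower_diagram" for r c
  proof -
    have "s (r, c) \<in> rank_in ?M ` ?M"
      using sb rc rank_in_bij[OF finM(1)] cardM by (auto simp: bij_betw_def)
    then obtain B where B: "B \<in> Q" "rank_in ?M (Min B) = s (r, c)" by auto
    then show ?thesis using \<sigma>s[OF rc] by (intro bexI[of _ B]) (auto simp: pl_def)
  qed
  \<comment> \<open>All cells of the first row beyond the first \<open>?z\<close> are used.\<close>
  have top: "\<exists>B\<in>P - Q. pl B = (0, c) \<and> rank_in ?U (Min B) = c - ?z" if c: "(0, c) \<in> diagram \<nu>" "?z \<le> c" for c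
  proof -
    have "c - ?z < card P - ?d" using c PI room dP by (simp add: top_row)
    then have "c - ?z \<in> rank_in ?U ` ?U" using rank_in_bij[OF finM(2)] cardU by (simp add: bij_betw_def)
    then obtain B where B: "B \<in> P - Q" "rank_in ?U (Min B) = c - ?z" by auto
    then show ?thesis using c(2) by (intro bexI[of _ B]) (auto simp: pl_def)
  qed
  have unlabelled: "label I x y = 0" if y: "y < n" "row y = 0" "col y < ?z" for y
  proof -
    have "y \<noteq> t (pl B)" if "B \<in> P" for B
    proof
      assume "y = t (pl B)"
      then have "pl B = (0, col y)" using tpl(2,3)[OF that] y by (simp add: prod_eq_iff)
      then show False using y(3) by (auto simp: pl_def split: if_splits)
    qed
    then show ?thesis by (auto simp: label_eq_0_iff img)
  qed
  have lower: "\<exists>B\<in>Q. label I x y = Suc (Min B) \<and> rank_in ?M (Min B) = s (row y - 1, col y)"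
    if y: "y < n" "row y > 0" for y
  proof -
    have "(row y - 1, col y) \<in> lower_diagram" using cell_of(1)[OF y(1)] y(2) by (simp add: diagram_tl)
    from low[OF this] obtain B where B: "B \<in> Q" "pl B = (row y, col y)" "rank_in ?M (Min B) = s (row y - 1, col y)"
      using y(2) by auto
    then have "t (pl B) = y" using cell_of(2)[OF y(1)] by simp
    then show ?thesis using lab[of B] B Q(1) by auto
  qed
  have lower_less: "label I x y < label I x z"
    if yz: "y < n" "z < n" "row y > 0" "row z > 0" "s (row y - 1, col y) < s (row z - 1, col z)" for y z
  proof -
    obtain A where A: "A \<in> Q" "label I x y = Suc (Min A)" "rank_in ?M (Min A) = s (row y - 1, col y)"
      using lower[OF yz(1,3)] by auto
    obtain B where B: "B \<in> Q" "label I x z = Suc (Min B)" "rank_in ?M (Min B) = s (row z - 1, col z)"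
      using lower[OF yz(2,4)] by auto
    have "Min A < Min B" using rank_in_less_iff[OF finM(1), of "Min A" "Min B"] A B yz(5) by auto
    then show ?thesis using A B by simp
  qed
  note s_incr = standard_tableau_increasing[OF s sorted_tl]
  have "semistandard I x"
    unfolding semistandard_def
  proof (intro conjI allI impI word)
    fix y z assume yz: "y < n" "z < n" "col y = col z" "row y < row z"
    show "label I x y < label I x z"
    proof (cases "row y = 0")
      case True
      have "(1, col z) \<in> diagram \<nu>"
        using diagram_down_closed[OF cell_of(1)[OF yz(2)], of 1 "col z"] yz(4) by simp
      then have "col y < ?z" using second_row[of "col z"] yz(3) room PI by simp
      then have "label I x y = 0" by (rule unlabelled[OF yz(1) True])
      then show ?thesis using lower[OF yz(2)] yz(4) by auto
    next
      case False
      then have "s (row y - 1, col y) < s (row z - 1, col z)"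
        using s_incr(2)[of "row z - 1" "col z" "row y - 1"] cell_of(1)[OF yz(2)] yz by (simp add: diagram_tl)
      then show ?thesis using lower_less[OF yz(1,2)] False yz(4) by simp
    qed
  next
    fix y z assume yz: "y < n" "z < n" "row y = row z" "col y < col z"
    show "label I x y \<le> label I x z"
    proof (cases "row y = 0")
      case True
      show ?thesis
      proof (cases "col y < ?z")
        case True
        then show ?thesis using unlabelled[OF yz(1) \<open>row y = 0\<close>] by simp
      next
        case False
        have d: "(0, col y) \<in> diagram \<nu>" "(0, col z) \<in> diagram \<nu>"
          using cell_of(1)[OF yz(1)] cell_of(1)[OF yz(2)] True yz(3) by simp_all
        obtain A where A: "A \<in> P - Q" "pl A = (0, col y)" "rank_in ?U (Min A) = col y - ?z"
          using top[OF d(1)] False by auto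
        obtain B where B: "B \<in> P - Q" "pl B = (0, col z)" "rank_in ?U (Min B) = col z - ?z"
          using top[OF d(2)] False yz(4) by auto
        have "t (pl A) = y" "t (pl B) = z"
          using A(2) B(2) cell_of(2)[OF yz(1)] cell_of(2)[OF yz(2)] True yz(3) by simp_all
        then have l: "label I x y = Suc (Min A)" "label I x z = Suc (Min B)" using lab[of A] lab[of B] A(1) B(1) by simp_all
        have "rank_in ?U (Min A) < rank_in ?U (Min B)" using A B yz(4) False by simp
        then have "Min A < Min B" using rank_in_less_iff[OF finM(2), of "Min A" "Min B"] A(1) B(1) by blast
        then show ?thesis using l by simp
      qed
    next
      case False
      then have "s (row y - 1, col y) < s (row z - 1, col z)"
        using s_incr(1)[of "row z - 1" "col z" "col y"] cell_of(1)[OF yz(2)] yz by (simp add: diagram_tl)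
      then show ?thesis using lower_less[OF yz(1,2)] False yz(3) by simp
    qed
  qed
  moreover have "lower_filling I x = s"
  proof
    fix c :: "nat \<times> nat"
    obtain r j where c: "c = (r, j)" by (cases c)
    show "lower_filling I x c = s c"
    proof (cases "c \<in> lower_diagram")
      case True
      then obtain B where B: "B \<in> Q" "pl B = (Suc r, j)" "rank_in ?M (Min B) = s (r, j)" using low c by blast
      then have "label I x (t (Suc r, j)) = Suc (Min B)" using lab[of B] Q(1) by auto
      then show ?thesis using True B by (simp add: lower_filling_def c marks)
    next
      case False
      then show ?thesis using s by (simp add: lower_filling_def standard_tableaux_def extensional_def c)
    qed
  qed
  ultimately show ?thesis using blocks marks by blast
qed

theorem card_semistandard:
  assumes I: "finite I" and room: "card I + nth_default 0 \<nu> 1 \<le> n"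
  shows "card {x. semistandard I x} = f_std (tl \<nu>) * card (marked_partitions (sum_list (tl \<nu>)) I {})"
proof -
  let ?f = "\<lambda>x. ((fibers I x, marked I x), lower_filling I x)"
  have "bij_betw ?f {x. semistandard I x}
      (marked_partitions (sum_list (tl \<nu>)) I {} \<times> standard_tableaux (tl \<nu>))"
  proof (rule bij_betw_imageI)
    show "inj_on ?f {x. semistandard I x}"
      by (rule inj_onI) (auto intro: lower_filling_inj[OF I])
    show "?f ` {x. semistandard I x} = marked_partitions (sum_list (tl \<nu>)) I {} \<times> standard_tableaux (tl \<nu>)"
    proof (intro subset_antisym subsetI)
      fix a assume "a \<in> ?f ` {x. semistandard I x}"
      then show "a \<in> marked_partitions (sum_list (tl \<nu>)) I {} \<times> standard_tableaux (tl \<nu>)"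
        using marked_partition_of_word lower_filling_standard[OF I] by auto
    next
      fix a assume a: "a \<in> marked_partitions (sum_list (tl \<nu>)) I {} \<times> standard_tableaux (tl \<nu>)"
      obtain P Q s where [simp]: "a = ((P, Q), s)" by (metis prod.exhaust)
      obtain x where "semistandard I x" "fibers I x = P" "marked I x = Q" "lower_filling I x = s"
        using filling_realised[OF I room, of P Q s] a by auto
      then show "a \<in> ?f ` {x. semistandard I x}" by (intro image_eqI[of _ _ x]) auto
    qed
  qed
  then show ?thesis by (simp add: bij_betw_same_card f_std_def card_cartesian_product)
qed

end

section \<open>Tensor powers of the two-row module\<close>

text \<open>Without the rewriting of \<open>1\<close> to \<open>Suc 0\<close> the shape \<open>[n - 1, 1]\<close> keeps the form in which it occurs in
  the tensor power.\<close>

context notes One_nat_def [simp del]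
begin

text \<open>A tabloid of shape \<open>[n - 1, 1]\<close> is determined by the entry of its second row.\<close>

definition point :: "nat \<Rightarrow> nat \<Rightarrow> tabloid" where
  "point n y = [{..<n} - {y}, {y}]"

lemma point_eq_iff [simp]: "point n y = point n z \<longleftrightarrow> y = z"
  by (auto simp: point_def)

lemma tabloid_act_point: "p permutes {..<n} \<Longrightarrow> tabloid_act p (point n y) = point n (p y)"
  by (simp add: tabloid_act_def point_def image_set_diff permutes_inj permutes_image)

lemma two_row_diagram: "diagram [n - 1, 1] = {(0, j) | j. j < n - 1} \<union> {(1, 0)}"
  by (auto simp: diagram_def less_Suc_eq nth_Cons split: nat.splits)

lemma two_row_polytabloid:
  assumes n: "n \<ge> 2" and s: "tableau [n - 1, 1] s"
  shows "polytabloid [n - 1, 1] s =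
    (\<lambda>T. (if T = point n (s (1, 0)) then 1 else 0) - (if T = point n (s (0, 0)) then 1 else 0))"
    and "s (1, 0) < n" "s (0, 0) < n" "s (1, 0) \<noteq> s (0, 0)"
proof -
  interpret numbered_diagram "[n - 1, 1]" n s
    by unfold_locales (use n s in \<open>auto simp: partition_of_def\<close>)
  have d: "(0, 0) \<in> diagram [n - 1, 1]" "(1, 0) \<in> diagram [n - 1, 1]" unfolding two_row_diagram using n by auto
  let ?z = "s (0, 0)" and ?y = "s (1, 0)"
  show yz: "?y < n" "?z < n" "?y \<noteq> ?z"
    using entry[OF d(1)] entry[OF d(2)] by (metis zero_neq_one)+
  have row01: "row u = (if u = ?y then 1 else 0)" if "u < n" for u
  proof -
    have "(row u, col u) \<in> diagram [n - 1, 1]" "s (row u, col u) = u" using cell_of[OF that] by auto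
    then show ?thesis using entry(2)[OF d(2)] by (auto simp: two_row_diagram)
  qed
  have col0: "u = ?y \<or> u = ?z" if "u < n" "col u = 0" for u
  proof -
    have "(row u, col u) \<in> diagram [n - 1, 1]" "s (row u, col u) = u" using cell_of[OF that(1)] by auto
    then show ?thesis using that(2) by (auto simp: two_row_diagram)
  qed
  let ?\<tau> = "transpose ?y ?z"
  have C: "C = {id, ?\<tau>}"
  proof (intro subset_antisym subsetI)
    fix p assume p: "p \<in> C"
    then have pp: "p permutes {..<n}" by (rule column_stabilizer_permutes)
    have fix_other: "p u = u" if u: "u \<noteq> ?y" "u \<noteq> ?z" for u
    proof (cases "u < n")
      case True
      have pu: "p u < n" "col (p u) = col u"
        using True p permutes_in_image[OF pp, of u] by (auto simp: column_stabilizer_iff)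
      have "col u \<noteq> 0" using col0[OF True] u by auto
      then have "p u \<noteq> ?y" using pu entry(3)[OF d(2)] by auto
      then have "row (p u) = row u" using row01[OF pu(1)] row01[OF True] u by simp
      then show ?thesis using cell_inj[OF pu(1) True] pu(2) by simp
    qed (use permutes_not_in[OF pp] in simp)
    have "p permutes {?y, ?z}"
      by (rule permutes_superset[OF pp]) (use fix_other in auto)
    then show "p \<in> {id, ?\<tau>}" by (simp add: permutes_doubleton_iff)
  next
    fix p assume "p \<in> {id, ?\<tau>}"
    then show "p \<in> C"
      using column_swap[OF yz(1,2)] entry(3)[OF d(1)] entry(3)[OF d(2)] by (auto simp: column_stabilizer_iff)
  qed
  have tab: "tabloid_of [n - 1, 1] (p \<circ> s) = point n (p ?y)" if p: "p permutes {..<n}" for p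
  proof -
    have r: "{u. u < n \<and> row u = 0} = {..<n} - {?y}" "{u. u < n \<and> row u = 1} = {?y}"
      using yz(1) by (auto simp: row01 split: if_splits)
    have upt: "[0..<length [n - 1, 1]] = [0, 1]" by (simp add: upt_rec One_nat_def)
    have "tabloid_of [n - 1, 1] (p \<circ> s) = [p ` ({..<n} - {?y}), p ` {?y}]"
      unfolding tabloid_of_comp upt by (simp add: r)
    then show ?thesis using p by (simp add: point_def image_set_diff permutes_inj permutes_image)
  qed
  have perm: "?\<tau> permutes {..<n}" using yz by (simp add: permutes_swap_id)
  have ne: "id \<noteq> ?\<tau>" using yz(3) by (metis id_apply transpose_apply_first)
  show "polytabloid [n - 1, 1] s =
    (\<lambda>T. (if T = point n ?y then 1 else 0) - (if T = point n ?z then 1 else 0))"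
  proof
    fix T
    have "polytabloid [n - 1, 1] s T =
        (\<Sum>p\<in>{id, ?\<tau>}. of_int (sign p) * (if T = tabloid_of [n - 1, 1] (p \<circ> s) then 1 else 0))"
      by (simp only: polytabloid_def C)
    also have "\<dots> = of_int (sign (id :: nat \<Rightarrow> nat)) * (if T = tabloid_of [n - 1, 1] (id \<circ> s) then 1 else 0) +
        of_int (sign ?\<tau>) * (if T = tabloid_of [n - 1, 1] (?\<tau> \<circ> s) then 1 else 0)"
      using ne by simp
    also have "\<dots> = (if T = point n ?y then 1 else 0) - (if T = point n ?z then 1 else 0)"
      unfolding tab[OF permutes_id] tab[OF perm] using yz(3) by (simp add: sign_swap_id)
    finally show "polytabloid [n - 1, 1] s T =
      (if T = point n ?y then 1 else 0) - (if T = point n ?z then 1 else 0)" .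
  qed
qed

definition point_fun :: "nat \<Rightarrow> nat \<Rightarrow> tabloid \<Rightarrow> complex" where
  "point_fun n y T = (if T = point n y then 1 else 0)"

text \<open>The symmetric group is transitive on pairs of distinct points, so every difference of two points is
  a polytabloid.\<close>

lemma point_difference_specht:
  assumes n: "n \<ge> 2" and y: "y < n" and z: "z < n"
  shows "point_fun n y - point_fun n z \<in> specht [n - 1, 1]"
proof (cases "y = z")
  case True
  then show ?thesis unfolding specht_def by (simp add: fn.span_zero)
next
  case False
  have "finite (diagram [n - 1, 1])" by (auto simp: two_row_diagram)
  moreover have "card (diagram [n - 1, 1]) = n"
  proof -
    have eq: "diagram [n - 1, 1] = Pair 0 ` {..<n - 1} \<union> {(1, 0)}" by (auto simp: two_row_diagram)
    have "card (Pair (0 :: nat) ` {..<n - 1}) = n - 1" by (simp add: card_image inj_on_def)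
    moreover have "(1, 0) \<notin> Pair (0 :: nat) ` {..<n - 1}" by auto
    ultimately show ?thesis unfolding eq using n by simp
  qed
  ultimately obtain t where t: "bij_betw t (diagram [n - 1, 1]) {..<n}"
    using ex_bij_betw_finite_nat[of "diagram [n - 1, 1]"] by (auto simp: atLeast0LessThan)
  then have tab: "tableau [n - 1, 1] t" using n by (simp add: tableau_def)
  note t10 = two_row_polytabloid(2-4)[OF n tab]
  define q1 where "q1 = transpose (t (1, 0)) y"
  define q where "q = transpose (q1 (t (0, 0))) z \<circ> q1"
  have q1: "q1 permutes {..<n}" unfolding q1_def using t10 y by (simp add: permutes_swap_id)
  have "q1 (t (0, 0)) < n" using permutes_in_image[OF q1, of "t (0, 0)"] t10 by simp
  then have q: "q permutes {..<n}"
    unfolding q_def using z by (intro permutes_compose[OF q1] permutes_swap_id) auto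
  have "q1 (t (0, 0)) \<noteq> y" unfolding q1_def using t10 by (auto simp: transpose_def)
  then have qv: "q (t (1, 0)) = y" "q (t (0, 0)) = z" using False by (simp_all add: q_def q1_def transpose_def)
  have tq: "tableau [n - 1, 1] (q \<circ> t)"
    using bij_betw_trans[OF t permutes_imp_bij[OF q]] n by (simp add: tableau_def)
  have "point_fun n y - point_fun n z = polytabloid [n - 1, 1] (q \<circ> t)"
    unfolding two_row_polytabloid(1)[OF n tq] by (simp add: fun_eq_iff point_fun_def qv)
  then show ?thesis unfolding specht_def using tq by (auto intro: fn.span_base)
qed

text \<open>The projection of a point to the sum-zero functions along the constants.\<close>

lemma centered_point_specht:
  assumes n: "n \<ge> 2" and y: "y < n"
  shows "(\<lambda>T. point_fun n y T - (\<Sum>z<n. point_fun n z T) / of_nat n) \<in> specht [n - 1, 1]"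
proof -
  have "(\<Sum>z<n. cscale (1 / of_nat n) (point_fun n y - point_fun n z)) \<in> specht [n - 1, 1]"
    using point_difference_specht[OF n y] unfolding specht_def by (intro fn.span_sum fn.span_scale) auto
  also have "(\<Sum>z<n. cscale (1 / of_nat n) (point_fun n y - point_fun n z)) =
      (\<lambda>T. point_fun n y T - (\<Sum>z<n. point_fun n z T) / of_nat n)"
  proof
    fix T
    show "(\<Sum>z<n. cscale (1 / of_nat n) (point_fun n y - point_fun n z)) T =
        point_fun n y T - (\<Sum>z<n. point_fun n z T) / of_nat n"
      unfolding sum_fun_apply using n
      by (simp add: cscale_def sum_divide_distrib[symmetric] sum_subtractf diff_divide_distrib)
  qed
  finally show ?thesis .
qed

lemma two_row_specht_props:
  assumes n: "n \<ge> 2" and f: "f \<in> specht [n - 1, 1]"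
  shows "T \<notin> point n ` {..<n} \<Longrightarrow> f T = 0" and "(\<Sum>y<n. f (point n y)) = 0"
proof -
  have "(\<forall>T. T \<notin> point n ` {..<n} \<longrightarrow> f T = 0) \<and> (\<Sum>y<n. f (point n y)) = 0"
    using f unfolding specht_def
  proof (induction rule: fn.span_induct_alt)
    case (step c u v)
    then obtain s where s: "tableau [n - 1, 1] s" "u = polytabloid [n - 1, 1] s" by auto
    note u = two_row_polytabloid[OF n s(1), folded s(2)]
    have "(\<Sum>y<n. u (point n y)) = 0" unfolding u(1) using u(2,3) by (simp add: sum_subtractf)
    moreover have "u T = 0" if "T \<notin> point n ` {..<n}" for T unfolding u(1) using u(2,3) that by auto
    ultimately show ?case using step by (simp add: cscale_def sum.distrib sum_distrib_left[symmetric])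
  qed simp
  then show "T \<notin> point n ` {..<n} \<Longrightarrow> f T = 0" and "(\<Sum>y<n. f (point n y)) = 0" by auto
qed

definition encode :: "nat \<Rightarrow> nat \<Rightarrow> (nat \<Rightarrow> nat) \<Rightarrow> tabloid list" where
  "encode n k x = map (\<lambda>i. point n (x i)) [0..<k]"

lemma encode_inj: "x \<in> words n {..<k} \<Longrightarrow> y \<in> words n {..<k} \<Longrightarrow> encode n k x = encode n k y \<Longrightarrow> x = y"
proof
  fix i assume *: "x \<in> words n {..<k}" "y \<in> words n {..<k}" "encode n k x = encode n k y"
  show "x i = y i"
  proof (cases "i < k")
    case True
    then have "encode n k x ! i = encode n k y ! i" using *(3) by simp
    then show ?thesis using True by (simp add: encode_def)
  qed (use * in \<open>auto simp: words_def\<close>)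
qed

lemma encode_act: "p permutes {..<n} \<Longrightarrow> map (tabloid_act p) (encode n k x) = encode n k (p \<circ> x)"
  by (simp add: encode_def tabloid_act_point)

text \<open>A list of tabloids of shape \<open>[n - 1, 1]\<close> is a word of points; restriction to such lists and
  extension by \<open>0\<close> identify the tensor power with the functions on words having vanishing
  coordinate sums.\<close>

definition to_words :: "nat \<Rightarrow> nat \<Rightarrow> (tabloid list \<Rightarrow> complex) \<Rightarrow> (nat \<Rightarrow> nat) \<Rightarrow> complex" where
  "to_words n k f x = (if x \<in> words n {..<k} then f (encode n k x) else 0)"

definition from_words :: "nat \<Rightarrow> nat \<Rightarrow> ((nat \<Rightarrow> nat) \<Rightarrow> complex) \<Rightarrow> tabloid list \<Rightarrow> complex" where
  "from_words n k g xs = (\<Sum>x\<in>words n {..<k}. g x * (if xs = encode n k x then 1 else 0))"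

lemma from_words_encode:
  assumes "x \<in> words n {..<k}"
  shows "from_words n k g (encode n k x) = g x"
proof -
  have "from_words n k g (encode n k x) = (\<Sum>x'\<in>words n {..<k}. if x = x' then g x' else 0)"
    unfolding from_words_def using encode_inj[OF assms] by (intro sum.cong refl) auto
  then show ?thesis using assms finite_words[of "{..<k}" n] by simp
qed

lemma from_words_outside: "xs \<notin> encode n k ` words n {..<k} \<Longrightarrow> from_words n k g xs = 0"
  unfolding from_words_def by (intro sum.neutral) auto

lemma to_words_from_words:
  assumes "g \<in> word_space n {..<k} J"
  shows "to_words n k (from_words n k g) = g"
  using assms by (auto simp: fun_eq_iff to_words_def from_words_encode word_space_def)

lemma sum_words_split:
  assumes i: "i \<in> I"
  shows "(\<Sum>x\<in>words n I. h x) = (\<Sum>x\<in>words n (I - {i}). \<Sum>y<n. h (x(i := y)))"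
proof -
  have "(\<Sum>x\<in>words n I. h x) = (\<Sum>(x, y)\<in>words n (I - {i}) \<times> {..<n}. h (x(i := y)))"
  proof (rule sum.reindex_bij_witness[of _ "\<lambda>(x, y). x(i := y)" "\<lambda>x. (x(i := n), x i)"])
    fix x assume x: "x \<in> words n I"
    show "(case (x(i := n), x i) of (x, y) \<Rightarrow> x(i := y)) = x" by simp
    show "(x(i := n), x i) \<in> words n (I - {i}) \<times> {..<n}"
      using x i upd_words[OF i, of x "x i" n] by auto
    show "(case (x(i := n), x i) of (x, y) \<Rightarrow> h (x(i := y))) = h x" by simp
  next
    fix a assume "a \<in> words n (I - {i}) \<times> {..<n}"
    then obtain x y where a: "a = (x, y)" "x \<in> words n (I - {i})" "y < n" by auto
    have xi: "x(i := n) = x" by (rule upd_self_word[OF a(2)])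
    show "((case a of (x, y) \<Rightarrow> x(i := y))(i := n), (case a of (x, y) \<Rightarrow> x(i := y)) i) = a"
      using a xi by simp
    show "(case a of (x, y) \<Rightarrow> x(i := y)) \<in> words n I" using a xi upd_words[OF i, of x y n] by simp
  qed
  then show ?thesis by (simp add: sum.cartesian_product)
qed

text \<open>Constants added to a single tensor factor do not matter when paired with a function whose sum over
  that coordinate vanishes; the factors are exchanged one at a time.\<close>

lemma sum_words_shift:
  fixes a b :: "nat \<Rightarrow> nat \<Rightarrow> complex"
  assumes I: "finite I" and g: "g \<in> word_space n I I" and ab: "\<And>i y. a i y = b i y - c i"
  shows "(\<Sum>x\<in>words n I. g x * (\<Prod>i\<in>I. a i (x i))) = (\<Sum>x\<in>words n I. g x * (\<Prod>i\<in>I. b i (x i)))"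
proof -
  have "(\<Sum>x\<in>words n I. g x * ((\<Prod>i\<in>I - J. b i (x i)) * (\<Prod>i\<in>J. a i (x i)))) =
      (\<Sum>x\<in>words n I. g x * (\<Prod>i\<in>I. b i (x i)))" if "finite J" "J \<subseteq> I" for J
    using that
  proof (induction J rule: finite_induct)
    case (insert j J)
    then have j: "j \<in> I" "J \<subseteq> I" by auto
    define r where "r x = (\<Prod>i\<in>I - insert j J. b i (x i)) * (\<Prod>i\<in>J. a i (x i))" for x
    have r_upd: "r (x(j := y)) = r x" for x y
      unfolding r_def using insert by (intro arg_cong2[of _ _ _ _ "(*)"] prod.cong) auto
    have A: "(\<Prod>i\<in>I - insert j J. b i (x i)) * (\<Prod>i\<in>insert j J. a i (x i)) = r x * (b j (x j) - c j)" for x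
      unfolding r_def using insert by (simp add: ab)
    have B: "(\<Prod>i\<in>I - J. b i (x i)) * (\<Prod>i\<in>J. a i (x i)) = r x * b j (x j)" for x
    proof -
      have "I - J = insert j (I - insert j J)" using j insert by auto
      then have "(\<Prod>i\<in>I - J. b i (x i)) = (\<Prod>i\<in>insert j (I - insert j J). b i (x i))"
        by (rule arg_cong)
      also have "\<dots> = b j (x j) * (\<Prod>i\<in>I - insert j J. b i (x i))" using I by (intro prod.insert) auto
      finally show ?thesis unfolding r_def by (simp add: mult_ac)
    qed
    have "(\<Sum>x\<in>words n I. g x * (r x * c j)) = 0"
    proof -
      have "(\<Sum>x\<in>words n I. g x * (r x * c j)) =
          (\<Sum>x\<in>words n (I - {j}). (\<Sum>y<n. g (x(j := y))) * (r x * c j))"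
        unfolding sum_words_split[OF j(1)] r_upd by (simp add: sum_distrib_right)
      also have "\<dots> = 0" using g j(1) by (simp add: word_space_def)
      finally show ?thesis .
    qed
    then have "(\<Sum>x\<in>words n I. g x * (r x * (b j (x j) - c j))) = (\<Sum>x\<in>words n I. g x * (r x * b j (x j)))"
      by (simp add: algebra_simps sum_subtractf)
    then show ?case using insert.IH[OF j(2)] unfolding A B by simp
  qed simp
  from this[OF I subset_refl] show ?thesis by simp
qed

text \<open>A function with vanishing coordinate sums is a combination of products of point functions, and
  by \<open>sum_words_shift\<close> the point functions can be replaced by their projections to \<open>W\<close>.\<close>

lemma from_words_W_power:
  assumes n: "n \<ge> 2" and g: "g \<in> word_space n {..<k} {..<k}"
  shows "from_words n k g \<in> W_power k n"
proof -
  define w where "w y = (\<lambda>T. point_fun n y T - (\<Sum>z<n. point_fun n z T) / of_nat n)" for y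
  define ws where "ws x = map (\<lambda>i. w (x i)) [0..<k]" for x :: "nat \<Rightarrow> nat"
  have "from_words n k g = (\<Sum>x\<in>words n {..<k}. cscale (g x) (elem_tensor (ws x)))"
  proof
    fix xs
    show "from_words n k g xs = (\<Sum>x\<in>words n {..<k}. cscale (g x) (elem_tensor (ws x))) xs"
    proof (cases "length xs = k")
      case False
      then have "xs \<noteq> encode n k x" for x by (auto simp: encode_def)
      then show ?thesis
        unfolding sum_fun_apply from_words_def using False by (simp add: cscale_def elem_tensor_def ws_def)
    next
      case True
      have enc: "(if xs = encode n k x then 1 else 0) = (\<Prod>i<k. point_fun n (x i) (xs ! i))" for x
      proof -
        have "xs = encode n k x \<longleftrightarrow> (\<forall>i<k. xs ! i = point n (x i))"
          using True by (simp add: encode_def list_eq_iff_nth_eq)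
        then show ?thesis by (auto simp: point_fun_def intro: prod.neutral)
      qed
      have "from_words n k g xs = (\<Sum>x\<in>words n {..<k}. g x * (\<Prod>i<k. point_fun n (x i) (xs ! i)))"
        unfolding from_words_def enc ..
      also have "\<dots> = (\<Sum>x\<in>words n {..<k}. g x * (\<Prod>i<k. w (x i) (xs ! i)))"
        using g by (intro sum_words_shift[where c = "\<lambda>i. (\<Sum>z<n. point_fun n z (xs ! i)) / of_nat n", symmetric])
          (auto simp: w_def)
      also have "\<dots> = (\<Sum>x\<in>words n {..<k}. cscale (g x) (elem_tensor (ws x))) xs"
        unfolding sum_fun_apply using True by (simp add: cscale_def elem_tensor_def ws_def)
      finally show ?thesis .
    qed
  qed
  moreover have "elem_tensor (ws x) \<in> W_power k n" if "x \<in> words n {..<k}" for x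
    unfolding W_power_def tensor_power_def
  proof (rule fn.span_base, intro CollectI exI[of _ "ws x"] conjI refl)
    show "length (ws x) = k" by (simp add: ws_def)
    show "set (ws x) \<subseteq> specht [n - 1, 1]"
      using that centered_point_specht[OF n] by (auto simp: ws_def w_def words_def)
  qed
  ultimately show ?thesis
    unfolding W_power_def tensor_power_def by (simp only:) (intro fn.span_sum fn.span_scale)
qed

lemma to_words_add: "to_words n k (f + g) = to_words n k f + to_words n k g"
  and to_words_scale: "to_words n k (cscale c f) = cscale c (to_words n k f)"
  by (auto simp: to_words_def cscale_def fun_eq_iff)

lemma from_words_add: "from_words n k (f + g) = from_words n k f + from_words n k g"
  and from_words_scale: "from_words n k (cscale c f) = cscale c (from_words n k f)"
  by (auto simp: from_words_def cscale_def fun_eq_iff distrib_right sum.distrib sum_distrib_left mult.assoc)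

lemma to_words_equivariant:
  assumes "p permutes {..<n}"
  shows "to_words n k (W_power_act p f) = word_act p (to_words n k f)"
  using permutes_word[OF permutes_inv[OF assms]] encode_act[OF permutes_inv[OF assms]]
  by (auto simp: fun_eq_iff to_words_def diagonal_act_def fun_act_def)

lemma elem_tensor_props:
  assumes n: "n \<ge> 2" and ws: "length ws = k" "set ws \<subseteq> specht [n - 1, 1]"
  shows "xs \<notin> encode n k ` words n {..<k} \<Longrightarrow> elem_tensor ws xs = 0"
    and "to_words n k (elem_tensor ws) \<in> word_space n {..<k} {..<k}"
proof -
  have ws': "ws ! i \<in> specht [n - 1, 1]" if "i < k" for i using ws that by (auto dest: nth_mem)
  show "elem_tensor ws xs = 0" if out: "xs \<notin> encode n k ` words n {..<k}"
  proof (rule ccontr)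
    assume "elem_tensor ws xs \<noteq> 0"
    then have len: "length xs = k" and nz: "\<forall>i<k. (ws ! i) (xs ! i) \<noteq> 0"
      using ws(1) by (auto simp: elem_tensor_def split: if_splits)
    then have "\<forall>i<k. \<exists>y<n. xs ! i = point n y" using two_row_specht_props(1)[OF n ws'] by blast
    then obtain x where x: "\<forall>i<k. x i < n \<and> xs ! i = point n (x i)" by metis
    let ?x = "\<lambda>i. if i < k then x i else n"
    have "xs = encode n k ?x" using len x by (simp add: list_eq_iff_nth_eq encode_def)
    moreover have "?x \<in> words n {..<k}" using x by (simp add: words_def)
    ultimately show False using out by blast
  qed
  show "to_words n k (elem_tensor ws) \<in> word_space n {..<k} {..<k}"
    unfolding word_space_def
  proof (intro CollectI conjI allI impI ballI)
    show "to_words n k (elem_tensor ws) x = 0" if "x \<notin> words n {..<k}" for x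
      using that by (simp add: to_words_def)
    fix i x assume i: "i \<in> {..<k}"
    show "(\<Sum>y<n. to_words n k (elem_tensor ws) (x(i := y))) = 0"
    proof (cases "x(i := n) \<in> words n ({..<k} - {i})")
      case True
      have "to_words n k (elem_tensor ws) (x(i := y)) =
          (ws ! i) (point n y) * (\<Prod>j\<in>{..<k} - {i}. (ws ! j) (point n (x j)))" if "y < n" for y
      proof -
        have "x(i := y) \<in> words n {..<k}" using upd_words[OF i, of x y n] that True by simp
        then have "to_words n k (elem_tensor ws) (x(i := y)) = (\<Prod>j<k. (ws ! j) (point n ((x(i := y)) j)))"
          using ws(1) by (auto simp: to_words_def elem_tensor_def encode_def intro!: prod.cong)
        also have "\<dots> = (ws ! i) (point n y) * (\<Prod>j\<in>{..<k} - {i}. (ws ! j) (point n ((x(i := y)) j)))"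
          using i by (subst prod.remove[of _ i]) auto
        also have "(\<Prod>j\<in>{..<k} - {i}. (ws ! j) (point n ((x(i := y)) j))) = (\<Prod>j\<in>{..<k} - {i}. (ws ! j) (point n (x j)))"
          by (intro prod.cong) auto
        finally show ?thesis .
      qed
      then show ?thesis
        using two_row_specht_props(2)[OF n ws', of i] i by (simp add: sum_distrib_right[symmetric])
    next
      case False
      then have "x(i := y) \<notin> words n {..<k}" for y using upd_words[OF i] by blast
      then show ?thesis by (simp add: to_words_def)
    qed
  qed
qed

lemma W_power_props:
  assumes n: "n \<ge> 2" and f: "f \<in> W_power k n"
  shows "from_words n k (to_words n k f) = f" and "to_words n k f \<in> word_space n {..<k} {..<k}"
proof -
  have *: "(\<forall>xs. xs \<notin> encode n k ` words n {..<k} \<longrightarrow> f xs = 0) \<and> to_words n k f \<in> word_space n {..<k} {..<k}"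
    using f unfolding W_power_def tensor_power_def
  proof (induction rule: fn.span_induct_alt)
    case base
    have "to_words n k 0 = 0" by (simp add: to_words_def fun_eq_iff)
    then show ?case using fn.subspace_0[OF word_space_subspace, of n "{..<k}" "{..<k}"] by (metis zero_fun_def)
  next
    case (step c u v)
    then obtain ws where ws: "length ws = k" "set ws \<subseteq> specht [n - 1, 1]" "u = elem_tensor ws" by auto
    have "to_words n k (cscale c u + v) \<in> word_space n {..<k} {..<k}"
      unfolding to_words_add to_words_scale ws(3) using step elem_tensor_props(2)[OF n ws(1,2)]
      by (intro fn.subspace_add[OF word_space_subspace] fn.subspace_scale[OF word_space_subspace]) auto
    moreover have "(cscale c u + v) xs = 0" if "xs \<notin> encode n k ` words n {..<k}" for xs
      using step that elem_tensor_props(1)[OF n ws(1,2) that] ws(3) by (simp add: cscale_def)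
    ultimately show ?case by blast
  qed
  show "from_words n k (to_words n k f) = f"
  proof
    fix xs
    show "from_words n k (to_words n k f) xs = f xs"
    proof (cases "xs \<in> encode n k ` words n {..<k}")
      case True
      then show ?thesis by (auto simp: from_words_encode to_words_def)
    qed (use * from_words_outside in auto)
  qed
  show "to_words n k f \<in> word_space n {..<k} {..<k}" using * by simp
qed

lemma from_words_equivariant:
  assumes p: "p permutes {..<n}"
  shows "from_words n k (word_act p g) = W_power_act p (from_words n k g)"
proof
  fix xs
  have ip: "inv p permutes {..<n}" using p by (rule permutes_inv)
  have inv: "p (inv p y) = y" "inv p (p y) = y" for y using permutes_inverses[OF p] by auto
  have pinv: "p \<circ> (inv p \<circ> x) = x" "inv p \<circ> (p \<circ> x) = x" for x :: "nat \<Rightarrow> nat"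
    by (simp_all add: fun_eq_iff inv)
  have enc: "xs = encode n k (p \<circ> x) \<longleftrightarrow> map (tabloid_act (inv p)) xs = encode n k x" for x
  proof
    assume "xs = encode n k (p \<circ> x)"
    then show "map (tabloid_act (inv p)) xs = encode n k x"
      by (simp add: encode_act[OF ip] comp_def inv)
  next
    assume *: "map (tabloid_act (inv p)) xs = encode n k x"
    have "tabloid_act p (tabloid_act (inv p) T) = T" for T
      using tabloid_act_inv_eq_iff[OF p, of T] by metis
    then have "xs = map (tabloid_act p) (map (tabloid_act (inv p)) xs)" by (simp add: comp_def)
    then show "xs = encode n k (p \<circ> x)" unfolding * encode_act[OF p] .
  qed
  have "from_words n k (word_act p g) xs =
      (\<Sum>x\<in>words n {..<k}. g (inv p \<circ> x) * (if xs = encode n k x then 1 else 0))"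
    by (simp add: from_words_def fun_act_def)
  also have "\<dots> = (\<Sum>x\<in>words n {..<k}. g x * (if xs = encode n k (p \<circ> x) then 1 else 0))"
  proof (rule sum.reindex_bij_witness[of _ "\<lambda>x. p \<circ> x" "\<lambda>x. inv p \<circ> x"])
    show "p \<circ> (inv p \<circ> x) = x" "inv p \<circ> (p \<circ> x) = x" for x :: "nat \<Rightarrow> nat"
      by (simp_all only: pinv)
  qed (simp_all only: pinv permutes_word[OF p] permutes_word[OF ip])
  also have "\<dots> = W_power_act p (from_words n k g) xs"
    unfolding enc by (simp add: from_words_def diagonal_act_def fun_act_def)
  finally show "from_words n k (word_act p g) xs = W_power_act p (from_words n k g) xs" .
qed

theorem dim_QP_irrep_eq_word_hom:
  assumes n: "n \<ge> 2"
  shows "maps.dim (QP_irrep k n \<nu>) = maps.dim (word_hom n (specht \<nu>) specht_act {..<k} {..<k})"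
proof -
  define \<beta> :: "((tabloid \<Rightarrow> complex) \<Rightarrow> tabloid list \<Rightarrow> complex) \<Rightarrow> _" where
    "\<beta> F = (\<lambda>u. to_words n k (F u))" for F
  have lin: "Vector_Spaces.linear map_scale map_scale \<beta>"
    unfolding Vector_Spaces.linear_iff
    by (intro conjI maps.vector_space_axioms allI ext) (simp_all add: \<beta>_def to_words_add to_words_scale map_scale_def)
  have in_W: "F u \<in> W_power k n" if "F \<in> QP_irrep k n \<nu>" for F u
  proof (cases "u \<in> specht \<nu>")
    case False
    then have "F u = 0" using that by (simp add: QP_irrep_def Sn_hom_def)
    then show ?thesis unfolding W_power_def tensor_power_def by (simp only: fn.span_zero)
  qed (use that in \<open>simp add: QP_irrep_def Sn_hom_def\<close>)
  have inj: "inj_on \<beta> (QP_irrep k n \<nu>)"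
  proof (intro inj_onI ext)
    fix F G u xs assume FG: "F \<in> QP_irrep k n \<nu>" "G \<in> QP_irrep k n \<nu>" "\<beta> F = \<beta> G"
    have "to_words n k (F u) = to_words n k (G u)" using fun_cong[OF FG(3), of u] by (simp add: \<beta>_def)
    then have "F u = G u"
      using W_power_props(1)[OF n in_W[OF FG(1)]] W_power_props(1)[OF n in_W[OF FG(2)]] by metis
    then show "F u xs = G u xs" by simp
  qed
  have "\<beta> ` QP_irrep k n \<nu> = word_hom n (specht \<nu>) specht_act {..<k} {..<k}"
  proof (intro subset_antisym subsetI)
    fix G assume "G \<in> \<beta> ` QP_irrep k n \<nu>"
    then obtain F where F: "F \<in> QP_irrep k n \<nu>" "G = \<beta> F" by auto
    show "G \<in> word_hom n (specht \<nu>) specht_act {..<k} {..<k}"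
      unfolding F(2) \<beta>_def word_hom_def
      by (rule Sn_hom_post_compose[OF F(1)[unfolded QP_irrep_def]])
        (blast intro: W_power_props(2)[OF n] to_words_add to_words_scale to_words_equivariant)+
  next
    fix G assume G: "G \<in> word_hom n (specht \<nu>) specht_act {..<k} {..<k}"
    define F where "F = (\<lambda>u. from_words n k (G u))"
    have F: "F \<in> QP_irrep k n \<nu>"
      unfolding F_def QP_irrep_def
      by (rule Sn_hom_post_compose[OF G[unfolded word_hom_def]])
        (blast intro: from_words_W_power[OF n] from_words_add from_words_scale from_words_equivariant)+
    have "G u \<in> word_space n {..<k} {..<k}" for u
    proof (cases "u \<in> specht \<nu>")
      case False
      then have "G u = 0" using G by (simp add: word_hom_def Sn_hom_def)
      then show ?thesis by (simp only: fn.subspace_0[OF word_space_subspace])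
    qed (use G in \<open>simp add: word_hom_def Sn_hom_def\<close>)
    then have "to_words n k (from_words n k (G u)) = G u" for u by (rule to_words_from_words)
    then have "G = \<beta> F" by (simp add: F_def \<beta>_def)
    then show "G \<in> \<beta> ` QP_irrep k n \<nu>" using F by auto
  qed
  then show ?thesis using dim_injective_image[OF lin QP_irrep_subspace inj] by simp
qed

end

section \<open>The multiplicity in the tensor power\<close>

lemma word_hom_mono: "J' \<subseteq> J \<Longrightarrow> word_hom n U \<rho> I J \<subseteq> word_hom n U \<rho> I J'"
  by (auto simp: word_hom_def Sn_hom_def word_space_def)

text \<open>Both sides satisfy the same recursion in \<open>J\<close>; for empty \<open>J\<close> the count of semistandard words gives
  the dimension.\<close>

theorem (in numbered_diagram) dim_word_hom:
  assumes n: "n > 0" and "finite I" "J \<subseteq> I" "card I + nth_default 0 \<nu> 1 \<le> n"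
  shows "maps.dim (word_hom n (specht \<nu>) specht_act I J) =
    f_std (tl \<nu>) * card (marked_partitions (sum_list (tl \<nu>)) I J)"
proof -
  have "finite J" using assms(2,3) finite_subset by blast
  then show ?thesis using assms(2-4)
  proof (induction J arbitrary: I rule: finite_induct)
    case empty
    then show ?case by (simp add: dim_word_hom_semistandard(1) card_semistandard)
  next
    case (insert j J)
    let ?H = "word_hom n (specht \<nu>) specht_act" and ?N = "\<lambda>I J. card (marked_partitions (sum_list (tl \<nu>)) I J)"
    have j: "j \<in> I" "j \<notin> J" "J \<subseteq> I" using insert by auto
    obtain S where S: "finite S" "?H I {} \<subseteq> maps.span S"
      using dim_word_hom_semistandard(2)[OF \<open>finite I\<close>] by blast
    have "?H I J \<subseteq> maps.span S"
      using word_hom_mono[of "{}" J n "specht \<nu>" specht_act I] S(2) by simp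
    then have "maps.dim (?H I J) = maps.dim (?H I (insert j J)) + maps.dim (?H (I - {j}) J)"
      by (rule dim_word_hom_insert[OF n j S(1)])
    moreover have "?N I J = ?N I (insert j J) + ?N (I - {j}) J"
      by (rule card_marked_partitions_insert[OF \<open>finite I\<close> j(1,2)])
    moreover have "maps.dim (?H I J) = f_std (tl \<nu>) * ?N I J"
      using insert j by (intro insert.IH) auto
    moreover have "maps.dim (?H (I - {j}) J) = f_std (tl \<nu>) * ?N (I - {j}) J"
    proof (rule insert.IH)
      show "card (I - {j}) + nth_default 0 \<nu> 1 \<le> n" using insert.prems card_Diff1_le[of I j] by linarith
    qed (use insert j in auto)
    ultimately show ?case by (simp add: distrib_left)
  qed
qed

theorem theorem4p6:
  fixes k n :: nat and \<nu> lam :: "nat list"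
  assumes "k > 0" and "n > 0"
    and "partition_of \<nu> n"
    and "n > k + nth_default 0 \<nu> 1"
    and "indexes_QP_irrep k n \<nu>"
    and "lam = tl \<nu>"
  shows "maps.dim (QP_irrep k n \<nu>) =
    f_std lam * (\<Sum>m1 = 0..sum_list lam. (k choose m1) *
      (\<Sum>m2 = sum_list lam - m1..(k - m1) div 2.
        (m2 choose (sum_list lam - m1)) * sp2 (k - m1) m2))"
proof -
  have "card (diagram \<nu>) = n" using assms(3) by (simp add: card_diagram partition_of_def)
  then obtain t where t: "bij_betw t (diagram \<nu>) {..<n}"
    using ex_bij_betw_finite_nat[OF card_diagram(1)] by (auto simp: atLeast0LessThan)
  interpret numbered_diagram \<nu> n t
    by unfold_locales (use assms(3) t in \<open>auto simp: tableau_def partition_of_def\<close>)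
  have "n \<ge> 2" using assms(1,4) by simp
  then have "maps.dim (QP_irrep k n \<nu>) = maps.dim (word_hom n (specht \<nu>) specht_act {..<k} {..<k})"
    by (rule dim_QP_irrep_eq_word_hom)
  also have "\<dots> = f_std lam * card (marked_partitions (sum_list lam) {..<k} {..<k})"
    using dim_word_hom[of "{..<k}" "{..<k}"] assms by simp
  finally show ?thesis by (simp add: card_marked_partitions_all)
qed

end
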